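(* Let $L/K$ be a finite separable extension of fields with Galois closure $E$, $G=\mathrm{Gal}(E/K)$, $G_L=\mathrm{Gal}(E/L)$, $X=G/G_L$, and let $N$ be a finite group with $|N|=|X|$. Let $\alpha_1,\alpha_2:N\hookrightarrow\mathrm{Perm}(X)$ be injective homomorphisms whose images are regular and normalized by $\lambda(G)$, let $\beta_1,\beta_2:G\hookrightarrow\mathrm{Hol}(N)$ be the corresponding embeddings, and let $\overline{\beta_i}:G\to\mathrm{Aut}(N)$ be the composite of $\beta_i$ with the projection onto the automorphism component. Then $E[\alpha_1(N)]^G\cong E[\alpha_2(N)]^G$ as $K$-Hopf algebras if and only if there exists $\mu\in\mathrm{Aut}(N)$ such that $\overline{\beta_2}(g)=\mu\,\overline{\beta_1}(g)\,\mu^{-1}$ for all $g\in G$.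
   Context: $X=G/G_L$ is the set of left cosets $\overline{\tau}=\tau G_L$; $\lambda:G\to\mathrm{Perm}(X)$, $\lambda(\sigma)(\overline{\tau})=\overline{\sigma\tau}$. A subgroup of $\mathrm{Perm}(X)$ is regular if it has order $|X|$ and acts transitively. $G$ acts on $\mathrm{Perm}(X)$ by $\sigma\ast\eta=\lambda(\sigma)\eta\lambda(\sigma)^{-1}$, and on $E[\alpha_i(N)]$ by Galois action on $E$ and $\ast$ on $\alpha_i(N)$; $E[\alpha_i(N)]^G$ is the fixed $K$-Hopf algebra. $\mathrm{Hol}(N)$ is the normalizer in $\mathrm{Perm}(N)$ of the left translations $\lambda_N(\eta)(x)=\eta x$; every $h\in\mathrm{Hol}(N)$ can be written uniquely as $h=r_m\circ\mu$ with $m\in N$, $r_m(x)=xm$, $\mu\in\mathrm{Aut}(N)$, and the projection onto the automorphism component sends $h$ to $\mu$. Correspondence (Byott): given $\alpha$, let $a:N\to X$, $a(\eta)=\alpha(\eta)(\overline{1})$ (a bijection); then $\beta:G\to\mathrm{Hol}(N)$ is $\beta(g)=a^{-1}\circ\lambda(g)\circ a$. *)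

theory Defs
  imports
    "HOL-Algebra.Algebraic_Closure"
    "HOL-Algebra.Left_Coset"
    "HOL-Algebra.Group_Action"
    "HOL-Algebra.Bij"
    "HOL-Algebra.Module"
begin

section \<open>Field extensions\<close>

text \<open>Extensions are given by subfields \<open>K \<subseteq> L\<close> of a field \<open>E\<close>. An element is separable over
  \<open>K\<close> if its minimal polynomial has only simple roots in an algebraic closure (here of \<open>E\<close>, into
  which \<open>E\<close> embeds by \<open>indexed_const\<close>).\<close>

definition separable_extension :: "('e, 'r) ring_scheme \<Rightarrow> 'e set \<Rightarrow> 'e set \<Rightarrow> bool" where
  "separable_extension E K L \<longleftrightarrow>
     (\<forall>x\<in>L. \<not> ring.transcendental E K x \<and>
       (\<forall>y\<in>carrier (field.alg_closure E).
          ring.alg_mult (field.alg_closure E)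
            (map (ring.indexed_const E) (ring.Irr E K x)) y \<le> 1))"

definition gal :: "('e, 'r) ring_scheme \<Rightarrow> 'e set \<Rightarrow> ('e \<Rightarrow> 'e) monoid" where
  "gal E K = BijGroup (carrier E)
     \<lparr>carrier := {\<sigma> \<in> ring_hom E E \<inter> Bij (carrier E). \<forall>x\<in>K. \<sigma> x = x}\<rparr>"

definition galois_extension :: "('e, 'r) ring_scheme \<Rightarrow> 'e set \<Rightarrow> bool" where
  "galois_extension E K \<longleftrightarrow>
     field E \<and> subfield K E \<and> ring.finite_dimension E K (carrier E) \<and>
     {x \<in> carrier E. \<forall>\<sigma>\<in>carrier (gal E K). \<sigma> x = x} = K"

definition galois_closure :: "('e, 'r) ring_scheme \<Rightarrow> 'e set \<Rightarrow> 'e set \<Rightarrow> bool" where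
  "galois_closure E K L \<longleftrightarrow>
     galois_extension E K \<and> L \<subseteq> carrier E \<and>
     (\<forall>F. subfield F E \<and> L \<subseteq> F \<and> galois_extension (E\<lparr>carrier := F\<rparr>) K \<longrightarrow> F = carrier E)"


section \<open>The coset space and its permutations\<close>

definition coset_space :: "('e, 'r) ring_scheme \<Rightarrow> 'e set \<Rightarrow> 'e set \<Rightarrow> ('e \<Rightarrow> 'e) set set" where
  "coset_space E K L = lcosets\<^bsub>gal E K\<^esub> (carrier (gal E L))"

definition base_coset :: "('e, 'r) ring_scheme \<Rightarrow> 'e set \<Rightarrow> 'e set \<Rightarrow> ('e \<Rightarrow> 'e) set" where
  "base_coset E K L = \<one>\<^bsub>gal E K\<^esub> <#\<^bsub>gal E K\<^esub> carrier (gal E L)"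

definition coset_perm ::
  "('e, 'r) ring_scheme \<Rightarrow> 'e set \<Rightarrow> 'e set \<Rightarrow> ('e \<Rightarrow> 'e) \<Rightarrow> ('e \<Rightarrow> 'e) set \<Rightarrow> ('e \<Rightarrow> 'e) set" where
  "coset_perm E K L \<sigma> = (\<lambda>c\<in>coset_space E K L. \<sigma> <#\<^bsub>gal E K\<^esub> c)"

definition star_action ::
  "('e, 'r) ring_scheme \<Rightarrow> 'e set \<Rightarrow> 'e set \<Rightarrow> ('e \<Rightarrow> 'e) \<Rightarrow>
   (('e \<Rightarrow> 'e) set \<Rightarrow> ('e \<Rightarrow> 'e) set) \<Rightarrow> ('e \<Rightarrow> 'e) set \<Rightarrow> ('e \<Rightarrow> 'e) set" where
  "star_action E K L \<sigma> \<eta> =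
     coset_perm E K L \<sigma> \<otimes>\<^bsub>BijGroup (coset_space E K L)\<^esub> \<eta>
       \<otimes>\<^bsub>BijGroup (coset_space E K L)\<^esub> inv\<^bsub>BijGroup (coset_space E K L)\<^esub> (coset_perm E K L \<sigma>)"

definition regular_subgroup :: "'x set \<Rightarrow> ('x \<Rightarrow> 'x) set \<Rightarrow> bool" where
  "regular_subgroup S P \<longleftrightarrow>
     subgroup P (BijGroup S) \<and> card P = card S \<and> (\<forall>x\<in>S. \<forall>y\<in>S. \<exists>p\<in>P. p x = y)"


section \<open>The holomorph and Byott's correspondence\<close>

definition holomorph :: "('n, 'm) monoid_scheme \<Rightarrow> ('n \<Rightarrow> 'n) set" where
  "holomorph N =
     normalizer (BijGroup (carrier N)) ((\<lambda>\<eta>. \<lambda>x\<in>carrier N. \<eta> \<otimes>\<^bsub>N\<^esub> x) ` carrier N)"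

definition hol_aut :: "('n, 'm) monoid_scheme \<Rightarrow> ('n \<Rightarrow> 'n) \<Rightarrow> 'n \<Rightarrow> 'n" where
  "hol_aut N = (\<lambda>h\<in>holomorph N. THE \<mu>. \<mu> \<in> auto N \<and>
     (\<exists>m\<in>carrier N. h = compose (carrier N) (\<lambda>x\<in>carrier N. x \<otimes>\<^bsub>N\<^esub> m) \<mu>))"

definition byott ::
  "('e, 'r) ring_scheme \<Rightarrow> 'e set \<Rightarrow> 'e set \<Rightarrow> ('n, 'm) monoid_scheme \<Rightarrow>
   ('n \<Rightarrow> ('e \<Rightarrow> 'e) set \<Rightarrow> ('e \<Rightarrow> 'e) set) \<Rightarrow> ('e \<Rightarrow> 'e) \<Rightarrow> 'n \<Rightarrow> 'n" where
  "byott E K L N \<alpha> g =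
     (let a = (\<lambda>\<eta>. \<alpha> \<eta> (base_coset E K L))
      in (\<lambda>x\<in>carrier N. inv_into (carrier N) a (coset_perm E K L g (a x))))"

definition byott_aut ::
  "('e, 'r) ring_scheme \<Rightarrow> 'e set \<Rightarrow> 'e set \<Rightarrow> ('n, 'm) monoid_scheme \<Rightarrow>
   ('n \<Rightarrow> ('e \<Rightarrow> 'e) set \<Rightarrow> ('e \<Rightarrow> 'e) set) \<Rightarrow> ('e \<Rightarrow> 'e) \<Rightarrow> 'n \<Rightarrow> 'n" where
  "byott_aut E K L N \<alpha> g = hol_aut N (byott E K L N \<alpha> g)"


section \<open>Tensor products\<close>

text \<open>The tensor product \<open>V \<otimes>\<^sub>R W\<close> is the set of formal finite sums of pairs, i.e. finite multisets
  over \<open>V \<times> W\<close>, modulo the congruence generated by the bilinearity relations. The rule \<open>zero\<close> is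
  needed because the congruence is one of commutative monoids; negatives then exist, as
  \<open>(- v) \<otimes> w + v \<otimes> w = 0 \<otimes> w = 0\<close>.\<close>

inductive tensor_eq ::
  "('a, 'r) ring_scheme \<Rightarrow> ('a, 'b, 'v) module_scheme \<Rightarrow> ('a, 'c, 'w) module_scheme \<Rightarrow>
   ('b \<times> 'c) multiset \<Rightarrow> ('b \<times> 'c) multiset \<Rightarrow> bool"
  for R V W where
  refl: "set_mset A \<subseteq> carrier V \<times> carrier W \<Longrightarrow> tensor_eq R V W A A"
| sym: "tensor_eq R V W A B \<Longrightarrow> tensor_eq R V W B A"
| trans: "tensor_eq R V W A B \<Longrightarrow> tensor_eq R V W B C \<Longrightarrow> tensor_eq R V W A C"
| add: "tensor_eq R V W A B \<Longrightarrow> tensor_eq R V W C D \<Longrightarrow> tensor_eq R V W (A + C) (B + D)"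
| add_left: "v \<in> carrier V \<Longrightarrow> v' \<in> carrier V \<Longrightarrow> w \<in> carrier W \<Longrightarrow>
    tensor_eq R V W {#(v \<oplus>\<^bsub>V\<^esub> v', w)#} {#(v, w), (v', w)#}"
| add_right: "v \<in> carrier V \<Longrightarrow> w \<in> carrier W \<Longrightarrow> w' \<in> carrier W \<Longrightarrow>
    tensor_eq R V W {#(v, w \<oplus>\<^bsub>W\<^esub> w')#} {#(v, w), (v, w')#}"
| balanced: "r \<in> carrier R \<Longrightarrow> v \<in> carrier V \<Longrightarrow> w \<in> carrier W \<Longrightarrow>
    tensor_eq R V W {#(r \<odot>\<^bsub>V\<^esub> v, w)#} {#(v, r \<odot>\<^bsub>W\<^esub> w)#}"
| zero: "w \<in> carrier W \<Longrightarrow> tensor_eq R V W {#(\<zero>\<^bsub>V\<^esub>, w)#} {#}"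

definition tensor_class ::
  "('a, 'r) ring_scheme \<Rightarrow> ('a, 'b, 'v) module_scheme \<Rightarrow> ('a, 'c, 'w) module_scheme \<Rightarrow>
   ('b \<times> 'c) multiset \<Rightarrow> ('b \<times> 'c) multiset set" where
  "tensor_class R V W A = {B. tensor_eq R V W A B}"

definition tensor_product ::
  "('a, 'r) ring_scheme \<Rightarrow> ('a, 'b, 'v) module_scheme \<Rightarrow> ('a, 'c, 'w) module_scheme \<Rightarrow>
   ('b \<times> 'c) multiset set set" where
  "tensor_product R V W = tensor_class R V W ` {A. set_mset A \<subseteq> carrier V \<times> carrier W}"

text \<open>The map \<open>\<phi> \<otimes> \<psi>\<close> into \<open>V \<otimes>\<^sub>R W\<close>. The scalars of the source tensor product may form a smaller
  ring than \<open>R\<close>. All classes in the union agree.\<close>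

definition tensor_map ::
  "('a, 'r) ring_scheme \<Rightarrow> ('a, 'b, 'v) module_scheme \<Rightarrow> ('a, 'c, 'w) module_scheme \<Rightarrow>
   ('d \<Rightarrow> 'b) \<Rightarrow> ('f \<Rightarrow> 'c) \<Rightarrow> ('d \<times> 'f) multiset set \<Rightarrow> ('b \<times> 'c) multiset set" where
  "tensor_map R V W \<phi> \<psi> t = (\<Union>A\<in>t. tensor_class R V W (image_mset (map_prod \<phi> \<psi>) A))"


section \<open>Hopf algebras\<close>

record ('a, 'b) hopf_algebra = "('a, 'b) module" +
  comult :: "'b \<Rightarrow> ('b \<times> 'b) multiset set"
  counit :: "'b \<Rightarrow> 'a"
  antipode :: "'b \<Rightarrow> 'b"

definition hopf_iso ::
  "('a, 'r) ring_scheme \<Rightarrow> ('a, 'b, 'v) hopf_algebra_scheme \<Rightarrow>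
   ('a, 'c, 'w) hopf_algebra_scheme \<Rightarrow> ('b \<Rightarrow> 'c) set" where
  "hopf_iso R H H' = {\<phi> \<in> ring_iso H H'.
     (\<forall>r\<in>carrier R. \<forall>x\<in>carrier H. \<phi> (r \<odot>\<^bsub>H\<^esub> x) = r \<odot>\<^bsub>H'\<^esub> \<phi> x) \<and>
     (\<forall>x\<in>carrier H. comult H' (\<phi> x) = tensor_map R H' H' \<phi> \<phi> (comult H x)) \<and>
     (\<forall>x\<in>carrier H. counit H' (\<phi> x) = counit H x) \<and>
     (\<forall>x\<in>carrier H. antipode H' (\<phi> x) = \<phi> (antipode H x))}"

definition group_basis ::
  "('a, 'r) ring_scheme \<Rightarrow> ('g, 'm) monoid_scheme \<Rightarrow> 'g \<Rightarrow> 'g \<Rightarrow> 'a" where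
  "group_basis R M x = (\<lambda>y\<in>carrier M. if y = x then \<one>\<^bsub>R\<^esub> else \<zero>\<^bsub>R\<^esub>)"

text \<open>The Hopf algebra \<open>R[M]\<close> of a finite group \<open>M\<close>: the function \<open>f\<close> stands for
  \<open>\<Sum>x. f x \<sqdot> x\<close>, and every \<open>x \<in> M\<close> is group-like.\<close>

definition group_ring ::
  "('a, 'r) ring_scheme \<Rightarrow> ('g, 'm) monoid_scheme \<Rightarrow> ('a, 'g \<Rightarrow> 'a) module" where
  "group_ring R M =
     \<lparr>carrier = carrier M \<rightarrow>\<^sub>E carrier R,
      monoid.mult = (\<lambda>f g. \<lambda>x\<in>carrier M. \<Oplus>\<^bsub>R\<^esub>y\<in>carrier M. f y \<otimes>\<^bsub>R\<^esub> g (inv\<^bsub>M\<^esub> y \<otimes>\<^bsub>M\<^esub> x)),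
      one = group_basis R M \<one>\<^bsub>M\<^esub>,
      zero = (\<lambda>x\<in>carrier M. \<zero>\<^bsub>R\<^esub>),
      add = (\<lambda>f g. \<lambda>x\<in>carrier M. f x \<oplus>\<^bsub>R\<^esub> g x),
      smult = (\<lambda>r f. \<lambda>x\<in>carrier M. r \<otimes>\<^bsub>R\<^esub> f x)\<rparr>"

definition group_algebra ::
  "('a, 'r) ring_scheme \<Rightarrow> ('g, 'm) monoid_scheme \<Rightarrow> ('a, 'g \<Rightarrow> 'a) hopf_algebra" where
  "group_algebra R M =
     (let A = group_ring R M
      in \<lparr>carrier = carrier A, monoid.mult = monoid.mult A, one = one A, zero = zero A, add = add A,
          smult = smult A,
          comult = (\<lambda>f. tensor_class R A A
            (image_mset (\<lambda>x. (f x \<odot>\<^bsub>A\<^esub> group_basis R M x, group_basis R M x))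
              (mset_set (carrier M)))),
          counit = (\<lambda>f. \<Oplus>\<^bsub>R\<^esub>x\<in>carrier M. f x),
          antipode = (\<lambda>f. \<lambda>x\<in>carrier M. f (inv\<^bsub>M\<^esub> x))\<rparr>)"


section \<open>Descent\<close>

definition perm_group_algebra ::
  "('e, 'r) ring_scheme \<Rightarrow> 'x set \<Rightarrow> ('x \<Rightarrow> 'x) set \<Rightarrow> ('e, ('x \<Rightarrow> 'x) \<Rightarrow> 'e) hopf_algebra" where
  "perm_group_algebra E S P = group_algebra E (BijGroup S\<lparr>carrier := P\<rparr>)"

text \<open>\<open>\<sigma>\<close> sends \<open>\<Sum>\<eta>. f \<eta> \<sqdot> \<eta>\<close> to \<open>\<Sum>\<eta>. \<sigma> (f \<eta>) \<sqdot> (\<sigma> \<star> \<eta>)\<close>, whose coefficient at \<open>\<eta>\<close> is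
  \<open>\<sigma> (f (\<sigma>\<inverse> \<star> \<eta>))\<close>.\<close>

definition gal_action ::
  "('e, 'r) ring_scheme \<Rightarrow> 'e set \<Rightarrow> 'e set \<Rightarrow> (('e \<Rightarrow> 'e) set \<Rightarrow> ('e \<Rightarrow> 'e) set) set \<Rightarrow>
   ('e \<Rightarrow> 'e) \<Rightarrow> ((('e \<Rightarrow> 'e) set \<Rightarrow> ('e \<Rightarrow> 'e) set) \<Rightarrow> 'e) \<Rightarrow>
   (('e \<Rightarrow> 'e) set \<Rightarrow> ('e \<Rightarrow> 'e) set) \<Rightarrow> 'e" where
  "gal_action E K L P \<sigma> f = (\<lambda>\<eta>\<in>P. \<sigma> (f (star_action E K L (inv\<^bsub>gal E K\<^esub> \<sigma>) \<eta>)))"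

text \<open>The \<open>K\<close>-Hopf algebra \<open>H = E[P]\<^sup>G\<close>. All operations are restricted from \<open>E[P]\<close>; for the
  comultiplication this means that \<open>\<Delta> f\<close> is the element of \<open>H \<otimes>\<^sub>K H\<close> whose image under the
  canonical map \<open>H \<otimes>\<^sub>K H \<rightarrow> E[P] \<otimes>\<^sub>E E[P]\<close>, which is injective by Galois descent, is the
  comultiplication of \<open>f\<close> in \<open>E[P]\<close>.\<close>

definition fixed_hopf_algebra ::
  "('e, 'r) ring_scheme \<Rightarrow> 'e set \<Rightarrow> 'e set \<Rightarrow> (('e \<Rightarrow> 'e) set \<Rightarrow> ('e \<Rightarrow> 'e) set) set \<Rightarrow>
   ('e, (('e \<Rightarrow> 'e) set \<Rightarrow> ('e \<Rightarrow> 'e) set) \<Rightarrow> 'e) hopf_algebra" where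
  "fixed_hopf_algebra E K L P =
     (let A = perm_group_algebra E (coset_space E K L) P;
          H = A\<lparr>carrier := {f \<in> carrier A. \<forall>\<sigma>\<in>carrier (gal E K). gal_action E K L P \<sigma> f = f}\<rparr>
      in H\<lparr>comult := (\<lambda>f. THE t. t \<in> tensor_product (E\<lparr>carrier := K\<rparr>) H H \<and>
                         tensor_map E A A (\<lambda>x. x) (\<lambda>x. x) t = comult A f)\<rparr>)"

end

theory Submission
  imports Defs
begin

text \<open>
  Transported to \<open>N\<close> along \<open>\<alpha>\<close>, conjugation by \<open>\<lambda>(g)\<close> on \<open>\<alpha>(N)\<close> is the automorphism component of
  \<open>\<beta>(g)\<close>. Hence conjugacy of the two homomorphisms to \<open>Aut(N)\<close> means that \<open>\<alpha>\<^sub>1(N)\<close> and \<open>\<alpha>\<^sub>2(N)\<close> are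
  isomorphic as groups with \<open>G\<close>-action, and it remains to recover such a group \<open>P\<close> from the Hopf
  algebra \<open>H = E[P]\<^sup>G\<close>.

  Choose \<open>u\<^sub>i, v\<^sub>i \<in> E\<close> with \<open>\<Sum>i. u\<^sub>i \<rho>(v\<^sub>i) = [\<rho> = 1]\<close> for \<open>\<rho> \<in> G\<close>, and \<open>c \<in> E\<close> of trace 1. The traces
  of \<open>v\<^sub>i x\<close> and of \<open>c u\<^sub>i x\<close>, for \<open>x \<in> P\<close>, are families in \<open>H\<close> that are dual for the form
  \<open>\<langle>f, g\<rangle> = \<Sum>x. f x g x\<close>, which takes values in \<open>K\<close> on \<open>H\<close>. With these coordinates a tensor in
  \<open>H \<otimes>\<^sub>K H\<close> is determined by its values on \<open>P \<times> P\<close>, every \<open>G\<close>-invariant function on \<open>P \<times> P\<close> occurs, and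
  an element of \<open>E\<^sup>P\<close> that is orthogonal to \<open>H\<close> vanishes. So \<open>\<Delta> f\<close> is the function
  \<open>(x, y) \<mapsto> [x = y] f x\<close>, and a Hopf isomorphism is given by a matrix over \<open>E\<close> whose rows are orthogonal
  idempotents with sum 1, that is, by a bijection of the groups. It is multiplicative and equivariant
  because \<open>H\<close> separates points.
\<close>

text \<open>The tensor square is a quotient by a generated congruence, so telling tensors apart
  needs an invariant, and identifying them needs explicit rewriting. The invariant is the value
  function on P x P; the rewriting expands both factors in \<open>h\<close>, with coefficients that
  are read off from the values alone. The families \<open>h\<close> and \<open>t\<close> are not
  bases in general; all that matters is the reproducing identity sum_k t_k(x) h_k(y) = [x = y]. As
  they are written down directly as traces, no K-basis of H has to be chosen. The same identity
  shows that H spans E^P over E, which is how a map that is only K-linear acquires a matrix over E.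
  The idempotents come from duality: the dual of the coalgebra E[P] is the algebra E^P with
  pointwise product, so the transpose of a coalgebra map sends the indicator of a point to an
  idempotent, and this is the row of that point. The automorphism component appears because
  \<lambda>(g) a(x) = \<lambda>(g) \<alpha>(x) a(1) = (g \<star> \<alpha>(x)) \<lambda>(g) a(1),
  with a the bijection of Byott's correspondence: the first factor is transported to an automorphism
  of N, the rest to a constant right factor.\<close>

section \<open>Finite sums\<close>

text \<open>Summands outside the carrier are skipped, so that the step function commutes on the whole
  type, as \<open>fold_mset\<close> requires.\<close>

definition (in abelian_monoid) msum :: "('p \<Rightarrow> 'a) \<Rightarrow> 'p multiset \<Rightarrow> 'a" where
  "msum v M = fold_mset (\<lambda>p s. if v p \<in> carrier G \<and> s \<in> carrier G then v p \<oplus> s else s) \<zero> M"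

context abelian_monoid
begin

lemma msum_empty [simp]: "msum v {#} = \<zero>"
  by (simp add: msum_def)

lemma msum_step_commute:
  "comp_fun_commute (\<lambda>p s. if v p \<in> carrier G \<and> s \<in> carrier G then v p \<oplus> s else s)"
  by unfold_locales (auto simp: fun_eq_iff a_lcomm)

lemma msum_closed [simp]: "msum v M \<in> carrier G"
  unfolding msum_def
  by (induction M) (auto simp: comp_fun_commute.fold_mset_add_mset[OF msum_step_commute])

lemma msum_add_mset [simp]: "v p \<in> carrier G \<Longrightarrow> msum v (add_mset p M) = v p \<oplus> msum v M"
  using msum_closed[of v M]
  by (simp add: msum_def comp_fun_commute.fold_mset_add_mset[OF msum_step_commute])

lemma msum_union:
  "(\<And>p. p \<in># A + B \<Longrightarrow> v p \<in> carrier G) \<Longrightarrow> msum v (A + B) = msum v A \<oplus> msum v B"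
  by (induction A) (auto simp: a_assoc)

lemma msum_cong:
  "(\<And>p. p \<in># M \<Longrightarrow> v p \<in> carrier G) \<Longrightarrow> (\<And>p. p \<in># M \<Longrightarrow> v p = w p) \<Longrightarrow> msum v M = msum w M"
  by (induction M) auto

lemma msum_image:
  "(\<And>p. p \<in># M \<Longrightarrow> v (f p) \<in> carrier G) \<Longrightarrow> msum v (image_mset f M) = msum (\<lambda>p. v (f p)) M"
  by (induction M) auto

lemma msum_mset_set:
  assumes "finite A" and "v \<in> A \<rightarrow> carrier G"
  shows "msum v (mset_set A) = (\<Oplus>a\<in>A. v a)"
  using assms by (induction A) (auto simp: Pi_def)

text \<open>A single enumeration \<open>w\<close> serves all summands \<open>v\<close> at once.
  \<open>galois_coordinates\<close> depends on this, since the same elements must satisfy one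
  equation for each automorphism.\<close>

lemma msum_as_finsum:
  fixes M :: "'p multiset"
  shows "\<exists>(n::nat) w. (\<forall>i<n. w i \<in># M) \<and>
    (\<forall>v. (\<forall>p. p \<in># M \<longrightarrow> v p \<in> carrier G) \<longrightarrow> msum v M = (\<Oplus>i\<in>{..<n}. v (w i)))"
proof (induction M)
  case empty
  show ?case by (rule exI[of _ 0]) simp
next
  case (add p M)
  then obtain n :: nat and w where w: "\<And>i. i < n \<Longrightarrow> w i \<in># M"
    and eq: "\<And>v. (\<forall>p. p \<in># M \<longrightarrow> v p \<in> carrier G) \<Longrightarrow> msum v M = (\<Oplus>i\<in>{..<n}. v (w i))"
    by blast
  show ?case
  proof (rule exI[of _ "Suc n"], rule exI[of _ "w(n := p)"], intro conjI allI impI)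
    fix v :: "'p \<Rightarrow> 'a" assume v: "\<forall>q. q \<in># add_mset p M \<longrightarrow> v q \<in> carrier G"
    have "(\<Oplus>i\<in>{..<n}. v ((w(n := p)) i)) = (\<Oplus>i\<in>{..<n}. v (w i))"
      using v w by (intro finsum_cong') auto
    then show "msum v (add_mset p M) = (\<Oplus>i\<in>{..<Suc n}. v ((w(n := p)) i))"
      using v w eq[of v] by (simp add: lessThan_Suc Pi_def)
  qed (use w in \<open>auto simp: less_Suc_eq\<close>)
qed

lemma finsum_swap:
  assumes "finite A" "finite B" and "\<And>a b. a \<in> A \<Longrightarrow> b \<in> B \<Longrightarrow> f a b \<in> carrier G"
  shows "(\<Oplus>a\<in>A. \<Oplus>b\<in>B. f a b) = (\<Oplus>b\<in>B. \<Oplus>a\<in>A. f a b)"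
  using assms(1,3)
proof (induction A)
  case (insert a A)
  have "(\<Oplus>b\<in>B. \<Oplus>a\<in>insert a A. f a b) = (\<Oplus>b\<in>B. f a b \<oplus> (\<Oplus>a\<in>A. f a b))"
    using insert by (intro finsum_cong') (auto simp: Pi_def)
  then show ?case
    using insert by (simp add: Pi_def finsum_addf)
qed simp

lemma finsum_Times:
  assumes "finite A" "finite B" and "\<And>a b. a \<in> A \<Longrightarrow> b \<in> B \<Longrightarrow> f a b \<in> carrier G"
  shows "(\<Oplus>p\<in>A \<times> B. f (fst p) (snd p)) = (\<Oplus>a\<in>A. \<Oplus>b\<in>B. f a b)"
  using assms(1,3)
proof (induction A)
  case (insert a A)
  have "insert a A \<times> B = Pair a ` B \<union> A \<times> B" by auto
  moreover have "Pair a ` B \<inter> A \<times> B = {}" using insert by auto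
  moreover have "(\<Oplus>p\<in>Pair a ` B. f (fst p) (snd p)) = (\<Oplus>b\<in>B. f a b)"
    using insert by (subst finsum_reindex) (auto simp: inj_on_def)
  moreover have "(\<Oplus>p\<in>Pair a ` B \<union> A \<times> B. f (fst p) (snd p)) =
      (\<Oplus>p\<in>Pair a ` B. f (fst p) (snd p)) \<oplus> (\<Oplus>p\<in>A \<times> B. f (fst p) (snd p))"
    using insert assms(2) by (intro finsum_Un_disjoint) auto
  ultimately show ?case
    using insert assms(2) by (simp add: Pi_def)
qed simp

lemma finsum_delta:
  assumes "finite A" and "a \<in> A" and "f a \<in> carrier G"
  shows "(\<Oplus>x\<in>A. if x = a then f x else \<zero>) = f a"
proof -
  have "(\<Oplus>x\<in>A. if x = a then f x else \<zero>) = (\<Oplus>x\<in>A. if a = x then f a else \<zero>)"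
    using assms(3) by (intro finsum_cong') auto
  then show ?thesis
    using finsum_singleton[OF assms(2,1), of "\<lambda>_. f a"] assms(3) by simp
qed

end

lemma (in ring) msum_rdistr:
  assumes "a \<in> carrier R" and "\<And>p. p \<in># M \<Longrightarrow> v p \<in> carrier R"
  shows "a \<otimes> msum v M = msum (\<lambda>p. a \<otimes> v p) M"
  using assms(2) by (induction M) (auto simp: assms(1) r_distr)
section \<open>Tensor squares of modules of functions\<close>

definition (in ring) pairing :: "'x set \<Rightarrow> ('x \<Rightarrow> 'a) \<Rightarrow> ('x \<Rightarrow> 'a) \<Rightarrow> 'a" where
  "pairing P f g = (\<Oplus>x\<in>P. f x \<otimes> g x)"

text \<open>This is the map E^X \<otimes> E^Y \<rightarrow> E^(X x Y), f \<otimes> g \<mapsto> f(x)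
  g(y), on representatives. It is the invariant by which tensors are compared.\<close>

definition (in ring) tensor_value ::
  "(('x \<Rightarrow> 'a) \<times> ('y \<Rightarrow> 'a)) multiset \<Rightarrow> 'x \<Rightarrow> 'y \<Rightarrow> 'a" where
  "tensor_value M x y = msum (\<lambda>p. fst p x \<otimes> snd p y) M"

lemma (in ring) tensor_value_closed [simp]: "tensor_value M x y \<in> carrier R"
  by (simp add: tensor_value_def)

context cring
begin

lemma pairing_closed [simp]:
  "(\<And>x. x \<in> P \<Longrightarrow> f x \<in> carrier R) \<Longrightarrow> (\<And>x. x \<in> P \<Longrightarrow> g x \<in> carrier R) \<Longrightarrow> pairing P f g \<in> carrier R"
  by (auto simp: pairing_def)

lemma pairing_add_right:
  assumes "\<And>x. x \<in> P \<Longrightarrow> f x \<in> carrier R" "\<And>x. x \<in> P \<Longrightarrow> g x \<in> carrier R" "\<And>x. x \<in> P \<Longrightarrow> g' x \<in> carrier R"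
  shows "pairing P f (\<lambda>x. g x \<oplus> g' x) = pairing P f g \<oplus> pairing P f g'"
proof -
  have "pairing P f (\<lambda>x. g x \<oplus> g' x) = (\<Oplus>x\<in>P. f x \<otimes> g x \<oplus> f x \<otimes> g' x)"
    unfolding pairing_def using assms by (intro finsum_cong') (auto simp: r_distr)
  then show ?thesis using assms by (simp add: pairing_def finsum_addf Pi_def)
qed

lemma pairing_smult_right:
  assumes "\<And>x. x \<in> P \<Longrightarrow> f x \<in> carrier R" "\<And>x. x \<in> P \<Longrightarrow> g x \<in> carrier R" "r \<in> carrier R"
    and fin: "finite P"
  shows "pairing P f (\<lambda>x. r \<otimes> g x) = r \<otimes> pairing P f g"
    and "pairing P f (\<lambda>x. g x \<otimes> r) = pairing P f g \<otimes> r"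
proof -
  have "pairing P f (\<lambda>x. r \<otimes> g x) = (\<Oplus>x\<in>P. r \<otimes> (f x \<otimes> g x))"
    unfolding pairing_def using assms by (intro finsum_cong') (auto simp: m_ac)
  then show "pairing P f (\<lambda>x. r \<otimes> g x) = r \<otimes> pairing P f g"
    using assms fin by (simp add: pairing_def finsum_rdistr Pi_def)
  moreover have "pairing P f (\<lambda>x. g x \<otimes> r) = pairing P f (\<lambda>x. r \<otimes> g x)"
    unfolding pairing_def using assms by (intro finsum_cong') (auto simp: m_ac)
  ultimately show "pairing P f (\<lambda>x. g x \<otimes> r) = pairing P f g \<otimes> r"
    using assms by (simp add: m_comm)
qed

lemma pairing_cong:
  assumes "\<And>x. x \<in> P \<Longrightarrow> f x \<in> carrier R" "\<And>x. x \<in> P \<Longrightarrow> g x \<in> carrier R"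
    "\<And>x. x \<in> P \<Longrightarrow> f x = f' x" "\<And>x. x \<in> P \<Longrightarrow> g x = g' x"
  shows "pairing P f g = pairing P f' g'"
  unfolding pairing_def using assms by (intro finsum_cong') (auto simp: Pi_def)

lemma pairing_comm:
  assumes "\<And>x. x \<in> P \<Longrightarrow> f x \<in> carrier R" "\<And>x. x \<in> P \<Longrightarrow> g x \<in> carrier R"
  shows "pairing P f g = pairing P g f"
  unfolding pairing_def using assms by (intro finsum_cong') (auto simp: m_comm)

text \<open>Exchange of two finite sums. With \<open>w k\<close> a value of the dual family it
  yields the reproducing formulas; with \<open>w k\<close> a value of the image of
  \<open>h k\<close> under a linear map it yields the matrix of that map.\<close>

lemma finsum_pairing:
  assumes fin: "finite P" "finite I"
    and cl: "\<And>x. x \<in> P \<Longrightarrow> f x \<in> carrier R" "\<And>k x. k \<in> I \<Longrightarrow> x \<in> P \<Longrightarrow> u k x \<in> carrier R"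
      "\<And>k. k \<in> I \<Longrightarrow> w k \<in> carrier R"
  shows "(\<Oplus>k\<in>I. pairing P (u k) f \<otimes> w k) = (\<Oplus>x\<in>P. f x \<otimes> (\<Oplus>k\<in>I. u k x \<otimes> w k))"
proof -
  have "(\<Oplus>k\<in>I. pairing P (u k) f \<otimes> w k) = (\<Oplus>k\<in>I. \<Oplus>x\<in>P. f x \<otimes> (u k x \<otimes> w k))"
  proof (intro finsum_cong')
    fix k assume k: "k \<in> I"
    have "pairing P (u k) f \<otimes> w k = (\<Oplus>x\<in>P. u k x \<otimes> f x \<otimes> w k)"
      unfolding pairing_def using cl fin k by (intro finsum_ldistr) auto
    also have "\<dots> = (\<Oplus>x\<in>P. f x \<otimes> (u k x \<otimes> w k))"
      using cl k by (intro finsum_cong') (auto simp: m_ac)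
    finally show "pairing P (u k) f \<otimes> w k = (\<Oplus>x\<in>P. f x \<otimes> (u k x \<otimes> w k))" .
  qed (use cl in auto)
  also have "\<dots> = (\<Oplus>x\<in>P. \<Oplus>k\<in>I. f x \<otimes> (u k x \<otimes> w k))"
    using cl fin by (intro finsum_swap) auto
  also have "\<dots> = (\<Oplus>x\<in>P. f x \<otimes> (\<Oplus>k\<in>I. u k x \<otimes> w k))"
    using cl fin by (intro finsum_cong') (auto simp: finsum_rdistr)
  finally show ?thesis .
qed

end

text \<open>A module \<open>V\<close> of functions \<open>P \<rightarrow> E\<close> with \<open>\<langle>V, V\<rangle> \<subseteq> R\<close> for the form \<open>\<langle>f, g\<rangle> = \<Sum>x. f x g x\<close>,
  and with families \<open>h\<close>, \<open>t\<close> in \<open>V\<close> that are dual for this form. Both \<open>E[P]\<close> (over \<open>E\<close>) and its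
  descent \<open>E[P]\<^sup>G\<close> (over \<open>K\<close>) are of this kind.\<close>

locale function_coords = cring E for E :: "('a, 'r) ring_scheme" (structure) +
  fixes R :: "('a, 's) ring_scheme" and P :: "'x set"
    and V :: "('a, 'x \<Rightarrow> 'a, 'v) module_scheme"
    and I :: "'i set" and h t :: "'i \<Rightarrow> 'x \<Rightarrow> 'a"
  assumes R: "subring (carrier R) E"
    and finite_P: "finite P" and finite_I: "finite I"
    and V_fun: "carrier V \<subseteq> P \<rightarrow>\<^sub>E carrier E"
    and V_zero: "\<zero>\<^bsub>V\<^esub> = (\<lambda>x\<in>P. \<zero>)" and V_zero_closed: "\<zero>\<^bsub>V\<^esub> \<in> carrier V"
    and V_add: "\<And>f g. f \<in> carrier V \<Longrightarrow> g \<in> carrier V \<Longrightarrow> f \<oplus>\<^bsub>V\<^esub> g = (\<lambda>x\<in>P. f x \<oplus> g x)"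
    and V_add_closed: "\<And>f g. f \<in> carrier V \<Longrightarrow> g \<in> carrier V \<Longrightarrow> f \<oplus>\<^bsub>V\<^esub> g \<in> carrier V"
    and V_smult: "\<And>r f. r \<in> carrier R \<Longrightarrow> f \<in> carrier V \<Longrightarrow> r \<odot>\<^bsub>V\<^esub> f = (\<lambda>x\<in>P. r \<otimes> f x)"
    and V_smult_closed: "\<And>r f. r \<in> carrier R \<Longrightarrow> f \<in> carrier V \<Longrightarrow> r \<odot>\<^bsub>V\<^esub> f \<in> carrier V"
    and h: "\<And>k. k \<in> I \<Longrightarrow> h k \<in> carrier V" and t: "\<And>k. k \<in> I \<Longrightarrow> t k \<in> carrier V"
    and pairing: "\<And>f g. f \<in> carrier V \<Longrightarrow> g \<in> carrier V \<Longrightarrow> pairing P f g \<in> carrier R"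
    and dual: "\<And>x y. x \<in> P \<Longrightarrow> y \<in> P \<Longrightarrow>
      (\<Oplus>k\<in>I. t k x \<otimes> h k y) = (if x = y then \<one> else \<zero>)"
begin

lemma R_closed: "r \<in> carrier R \<Longrightarrow> r \<in> carrier E"
  using subringE(1)[OF R] by auto

lemma V_closed [simp]: "f \<in> carrier V \<Longrightarrow> x \<in> P \<Longrightarrow> f x \<in> carrier E"
  using V_fun by auto

lemma V_eqI: "f \<in> carrier V \<Longrightarrow> g \<in> extensional P \<Longrightarrow> (\<And>x. x \<in> P \<Longrightarrow> f x = g x) \<Longrightarrow> f = g"
  using V_fun by (intro extensionalityI[of _ P]) (auto simp: PiE_def)

lemma ht_closed [simp]:
  "k \<in> I \<Longrightarrow> x \<in> P \<Longrightarrow> h k x \<in> carrier E" "k \<in> I \<Longrightarrow> x \<in> P \<Longrightarrow> t k x \<in> carrier E"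
  using h t by auto

text \<open>Contract \<open>dual\<close> with \<open>f\<close>. The function is an arbitrary one
  with values in \<open>E\<close> and need not lie in \<open>V\<close>: the family \<open>h\<close>
  spans E^P over \<open>E\<close>, even if \<open>V\<close> is a module only over
  \<open>R\<close>.\<close>

lemma expand:
  assumes f: "\<And>x. x \<in> P \<Longrightarrow> f x \<in> carrier E" and y: "y \<in> P"
  shows "(\<Oplus>k\<in>I. pairing P (t k) f \<otimes> h k y) = f y"
proof -
  have "(\<Oplus>k\<in>I. pairing P (t k) f \<otimes> h k y) = (\<Oplus>x\<in>P. f x \<otimes> (\<Oplus>k\<in>I. t k x \<otimes> h k y))"
    using f y finite_P finite_I by (intro finsum_pairing) auto
  also have "\<dots> = (\<Oplus>x\<in>P. if x = y then f x else \<zero>)"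
    using f y by (intro finsum_cong') (auto simp: dual)
  also have "\<dots> = f y"
    using f y finite_P by (intro finsum_delta)
  finally show ?thesis .
qed

text \<open>The right side of \<open>dual\<close> is symmetric in the two points, so
  \<open>h\<close> and \<open>t\<close> may exchange roles.\<close>

lemma expand_dual:
  assumes b: "\<And>x. x \<in> P \<Longrightarrow> b x \<in> carrier E" and y: "y \<in> P"
  shows "(\<Oplus>k\<in>I. pairing P (h k) b \<otimes> t k y) = b y"
proof -
  have dual': "(\<Oplus>k\<in>I. h k x \<otimes> t k y) = (if x = y then \<one> else \<zero>)" if "x \<in> P" for x
  proof -
    have "(\<Oplus>k\<in>I. h k x \<otimes> t k y) = (\<Oplus>k\<in>I. t k y \<otimes> h k x)"
      using that y by (intro finsum_cong') (auto simp: m_comm)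
    then show ?thesis using that y by (auto simp: dual)
  qed
  have "(\<Oplus>k\<in>I. pairing P (h k) b \<otimes> t k y) = (\<Oplus>x\<in>P. b x \<otimes> (\<Oplus>k\<in>I. h k x \<otimes> t k y))"
    using b y finite_P finite_I by (intro finsum_pairing) auto
  also have "\<dots> = (\<Oplus>x\<in>P. if x = y then b x else \<zero>)"
    using b y by (intro finsum_cong') (auto simp: dual')
  also have "\<dots> = b y"
    using b y finite_P by (intro finsum_delta)
  finally show ?thesis .
qed

text \<open>By \<open>expand_dual\<close> the numbers \<open>pairing P (h k) b\<close> determine
  \<open>b\<close>. Identities between functions with values in \<open>E\<close> can thus be tested
  against \<open>V\<close> alone.\<close>

lemma separating:
  assumes b: "\<And>x. x \<in> P \<Longrightarrow> b x \<in> carrier E" and b': "\<And>x. x \<in> P \<Longrightarrow> b' x \<in> carrier E"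
    and eq: "\<And>f. f \<in> carrier V \<Longrightarrow> pairing P f b = pairing P f b'"
    and y: "y \<in> P"
  shows "b y = b' y"
proof -
  have "(\<Oplus>k\<in>I. pairing P (h k) b \<otimes> t k y) = (\<Oplus>k\<in>I. pairing P (h k) b' \<otimes> t k y)"
    using b b' y by (intro finsum_cong') (auto simp: eq h)
  then show ?thesis using expand_dual b b' y by simp
qed

text \<open>Pairing with the indicator of a point is evaluation there. If all of \<open>V\<close>
  agrees at two points, their indicators coincide by \<open>separating\<close>.\<close>

lemma points_separated:
  assumes x: "x \<in> P" and y: "y \<in> P" and nontriv: "\<one> \<noteq> \<zero>"
    and eq: "\<And>f. f \<in> carrier V \<Longrightarrow> f x = f y"
  shows "x = y"
proof (rule ccontr)
  assume "x \<noteq> y"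
  let ?d = "\<lambda>x z. if z = x then \<one> else \<zero>"
  have d: "pairing P f (?d z) = f z" if "f \<in> carrier V" "z \<in> P" for f z
  proof -
    have "pairing P f (?d z) = (\<Oplus>w\<in>P. if w = z then f w else \<zero>)"
      unfolding pairing_def using that by (intro finsum_cong') auto
    then show ?thesis using that finite_P by (simp add: finsum_delta)
  qed
  have "?d x x = ?d y x"
  proof (rule separating[of "?d x" "?d y"])
    fix f assume f: "f \<in> carrier V"
    show "pairing P f (?d x) = pairing P f (?d y)"
      unfolding d[OF f x] d[OF f y] by (rule eq[OF f])
  qed (use x in auto)
  then show False using \<open>x \<noteq> y\<close> nontriv by simp
qed

section \<open>Equality in the tensor square of V and its description by values on P x P\<close>

abbreviation teq where "teq \<equiv> tensor_eq R V V"

abbreviation tensors where "tensors \<equiv> {A. set_mset A \<subseteq> carrier V \<times> carrier V}"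

lemma tensors_val: "A \<in> tensors \<Longrightarrow> p \<in># A \<Longrightarrow> x \<in> P \<Longrightarrow> y \<in> P \<Longrightarrow> fst p x \<otimes> snd p y \<in> carrier E"
  by auto

lemma tensor_value_union:
  assumes "A \<in> tensors" "B \<in> tensors" "x \<in> P" "y \<in> P"
  shows "tensor_value (A + B) x y = tensor_value A x y \<oplus> tensor_value B x y"
  unfolding tensor_value_def
  using tensors_val[OF assms(1) _ assms(3,4)] tensors_val[OF assms(2) _ assms(3,4)]
  by (intro msum_union) auto

lemma tensor_value_add_mset:
  assumes "f \<in> carrier V" "g \<in> carrier V" "x \<in> P" "y \<in> P"
  shows "tensor_value (add_mset (f, g) A) x y = f x \<otimes> g y \<oplus> tensor_value A x y"
  using assms by (simp add: tensor_value_def)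

text \<open>Every generating relation preserves values. Membership in \<open>tensors\<close> is
  carried through the induction because additivity of values depends on it.\<close>

lemma teq_sound:
  assumes "teq A B"
  shows "A \<in> tensors \<and> B \<in> tensors \<and> (\<forall>x\<in>P. \<forall>y\<in>P. tensor_value A x y = tensor_value B x y)"
  using assms
proof (induction rule: tensor_eq.induct)
  case (add A B C D)
  then have "A \<in> tensors" "B \<in> tensors" "C \<in> tensors" "D \<in> tensors" by auto
  then show ?case using add by (auto simp: tensor_value_union)
next
  case (add_left v v' w)
  then show ?case
    using V_add_closed V_add by (auto simp: tensor_value_def l_distr)
next
  case (add_right v w w')
  then show ?case
    using V_add_closed V_add by (auto simp: tensor_value_def r_distr)
next
  case (balanced r v w)
  then show ?case
    using V_smult_closed V_smult R_closed by (auto simp: tensor_value_def m_ac)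
next
  case (zero w)
  then show ?case
    using V_zero_closed by (auto simp: tensor_value_def V_zero)
qed auto

lemma teq_sum:
  assumes "finite J" and "\<And>k. k \<in> J \<Longrightarrow> teq (A k) (B k)"
  shows "teq (sum A J) (sum B J)"
  using assms by (induction J) (auto intro: tensor_eq.intros)

text \<open>The rule \<open>zero\<close> concerns the left factor. For the right one, move the
  scalar 0 across: v \<otimes> 0 = v \<otimes> (0 0) = (0 v) \<otimes> 0 = 0 \<otimes> 0 =
  0.\<close>

lemma teq_zero_right: "v \<in> carrier V \<Longrightarrow> teq {#(v, \<zero>\<^bsub>V\<^esub>)#} {#}"
proof -
  assume v: "v \<in> carrier V"
  have 0: "\<zero> \<in> carrier R" using subringE(2)[OF R] .
  have "\<zero> \<odot>\<^bsub>V\<^esub> w = \<zero>\<^bsub>V\<^esub>" if "w \<in> carrier V" for w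
    using that by (simp add: V_smult[OF 0] V_zero cong: restrict_cong)
  then have "teq {#(\<zero>\<^bsub>V\<^esub>, \<zero>\<^bsub>V\<^esub>)#} {#(v, \<zero>\<^bsub>V\<^esub>)#}"
    using tensor_eq.balanced[of \<zero> R v V "\<zero>\<^bsub>V\<^esub>" V] 0 v V_zero_closed by simp
  then show ?thesis
    by (blast intro: tensor_eq.intros V_zero_closed)
qed

text \<open>Sums in \<open>V\<close> are taken pointwise, as the locale presents \<open>V\<close> as
  a set of functions with operations rather than as an abstract module.\<close>

definition fsum :: "'j set \<Rightarrow> ('j \<Rightarrow> 'x \<Rightarrow> 'a) \<Rightarrow> 'x \<Rightarrow> 'a" where
  "fsum J f = (\<lambda>x\<in>P. \<Oplus>k\<in>J. f k x)"

lemma fsum_empty [simp]: "fsum {} f = \<zero>\<^bsub>V\<^esub>"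
  by (simp add: fsum_def V_zero)

lemma fsum_insert:
  assumes "finite J" "j \<notin> J" "\<And>k. k \<in> insert j J \<Longrightarrow> f k \<in> carrier V" and "fsum J f \<in> carrier V"
  shows "fsum (insert j J) f = f j \<oplus>\<^bsub>V\<^esub> fsum J f"
proof -
  have "(\<Oplus>k\<in>insert j J. f k x) = f j x \<oplus> fsum J f x" if "x \<in> P" for x
    using that assms(1-3) by (subst finsum_insert) (auto simp: fsum_def)
  then show ?thesis
    using assms by (simp add: V_add) (simp add: fsum_def[of "insert j J"] cong: restrict_cong)
qed

lemma fsum_closed: "finite J \<Longrightarrow> (\<And>k. k \<in> J \<Longrightarrow> f k \<in> carrier V) \<Longrightarrow> fsum J f \<in> carrier V"
proof (induction J rule: finite_induct)
  case (insert j J)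
  then have "fsum (insert j J) f = f j \<oplus>\<^bsub>V\<^esub> fsum J f" by (intro fsum_insert) auto
  then show ?case using insert by (simp add: V_add_closed)
qed (simp add: V_zero_closed)

lemma teq_fsum_left:
  assumes "finite J" and "\<And>k. k \<in> J \<Longrightarrow> f k \<in> carrier V" and g: "g \<in> carrier V"
  shows "teq {#(fsum J f, g)#} (\<Sum>k\<in>J. {#(f k, g)#})"
  using assms(1,2)
proof (induction J)
  case empty
  show ?case using g by (simp add: tensor_eq.zero)
next
  case (insert j J)
  then have eq: "fsum (insert j J) f = f j \<oplus>\<^bsub>V\<^esub> fsum J f"
    using fsum_closed[of J f] by (intro fsum_insert) auto
  have "teq {#(fsum (insert j J) f, g)#} ({#(f j, g)#} + {#(fsum J f, g)#})"
    using insert g fsum_closed[of J f] tensor_eq.add_left[of "f j" V "fsum J f" g V R]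
    by (simp add: eq add_mset_commute)
  moreover have "teq ({#(f j, g)#} + {#(fsum J f, g)#}) ({#(f j, g)#} + (\<Sum>k\<in>J. {#(f k, g)#}))"
    using insert g by (intro tensor_eq.add) (auto intro: tensor_eq.refl)
  ultimately show ?case using insert by (auto intro: tensor_eq.trans)
qed

lemma teq_fsum_right:
  assumes "finite J" and "\<And>k. k \<in> J \<Longrightarrow> f k \<in> carrier V" and g: "g \<in> carrier V"
  shows "teq {#(g, fsum J f)#} (\<Sum>k\<in>J. {#(g, f k)#})"
  using assms(1,2)
proof (induction J)
  case empty
  show ?case using g by (simp add: teq_zero_right)
next
  case (insert j J)
  then have eq: "fsum (insert j J) f = f j \<oplus>\<^bsub>V\<^esub> fsum J f"
    using fsum_closed[of J f] by (intro fsum_insert) auto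
  have "teq {#(g, fsum (insert j J) f)#} ({#(g, f j)#} + {#(g, fsum J f)#})"
    using insert g fsum_closed[of J f] tensor_eq.add_right[of g V "f j" V "fsum J f" R]
    by (simp add: eq add_mset_commute)
  moreover have "teq ({#(g, f j)#} + {#(g, fsum J f)#}) ({#(g, f j)#} + (\<Sum>k\<in>J. {#(g, f k)#}))"
    using insert g by (intro tensor_eq.add) (auto intro: tensor_eq.refl)
  ultimately show ?case using insert by (auto intro: tensor_eq.trans)
qed

text \<open>This is \<open>expand\<close> read inside \<open>V\<close>: the form takes values in
  \<open>R\<close> on \<open>V\<close>, so the coefficients are scalars of \<open>V\<close>. A map
  that is linear over \<open>R\<close> can therefore be applied term by term.\<close>

lemma V_expand:
  assumes f: "f \<in> carrier V"
  shows "fsum I (\<lambda>k. pairing P (t k) f \<odot>\<^bsub>V\<^esub> h k) = f"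
proof (rule V_eqI[symmetric])
  fix y assume y: "y \<in> P"
  have "(\<Oplus>k\<in>I. (pairing P (t k) f \<odot>\<^bsub>V\<^esub> h k) y) = (\<Oplus>k\<in>I. pairing P (t k) f \<otimes> h k y)"
    using y f h t R_closed pairing by (intro finsum_cong') (auto simp: V_smult)
  then show "f y = fsum I (\<lambda>k. pairing P (t k) f \<odot>\<^bsub>V\<^esub> h k) y"
    using y f by (simp add: fsum_def expand)
qed (use f in \<open>auto simp: fsum_def\<close>)

text \<open>As \<open>h\<close> may be linearly dependent, a tensor can have many expressions of
  this shape. The function \<open>coefficient\<close> selects one that depends on the values
  only.\<close>

definition normal_form :: "('i \<Rightarrow> 'i \<Rightarrow> 'a) \<Rightarrow> (('x \<Rightarrow> 'a) \<times> ('x \<Rightarrow> 'a)) multiset" where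
  "normal_form c = (\<Sum>k\<in>I. \<Sum>l\<in>I. {#(c k l \<odot>\<^bsub>V\<^esub> h k, h l)#})"

definition pairing2 :: "('x \<Rightarrow> 'a) \<Rightarrow> ('x \<Rightarrow> 'a) \<Rightarrow> ('x \<Rightarrow> 'x \<Rightarrow> 'a) \<Rightarrow> 'a" where
  "pairing2 b c F = pairing P b (\<lambda>x. pairing P c (F x))"

definition coefficient :: "('x \<Rightarrow> 'x \<Rightarrow> 'a) \<Rightarrow> 'i \<Rightarrow> 'i \<Rightarrow> 'a" where
  "coefficient F k l = pairing2 (t k) (t l) F"

lemma normal_form_cong:
  "(\<And>k l. k \<in> I \<Longrightarrow> l \<in> I \<Longrightarrow> c k l = d k l) \<Longrightarrow> normal_form c = normal_form d"
  by (simp add: normal_form_def)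

lemma teq_normal_form_add:
  assumes "\<And>k l. k \<in> I \<Longrightarrow> l \<in> I \<Longrightarrow> c k l \<in> carrier R \<and> d k l \<in> carrier R"
  shows "teq (normal_form (\<lambda>k l. c k l \<oplus> d k l)) (normal_form c + normal_form d)"
proof -
  have "teq {#((c k l \<oplus> d k l) \<odot>\<^bsub>V\<^esub> h k, h l)#} ({#(c k l \<odot>\<^bsub>V\<^esub> h k, h l)#} + {#(d k l \<odot>\<^bsub>V\<^esub> h k, h l)#})"
    if kl: "k \<in> I" "l \<in> I" for k l
  proof -
    have cd: "c k l \<in> carrier R" "d k l \<in> carrier R" "c k l \<oplus> d k l \<in> carrier R"
      using assms[OF kl] subringE(7)[OF R] by auto
    then have "(c k l \<oplus> d k l) \<odot>\<^bsub>V\<^esub> h k = (c k l \<odot>\<^bsub>V\<^esub> h k) \<oplus>\<^bsub>V\<^esub> (d k l \<odot>\<^bsub>V\<^esub> h k)"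
      using h[OF kl(1)] R_closed
      by (simp add: V_add V_smult_closed) (auto simp: V_smult l_distr intro!: restrict_ext)
    then show ?thesis
      using tensor_eq.add_left[of "c k l \<odot>\<^bsub>V\<^esub> h k" V "d k l \<odot>\<^bsub>V\<^esub> h k" "h l" V R] cd h kl
      by (simp add: V_smult_closed add_mset_commute)
  qed
  then show ?thesis
    unfolding normal_form_def sum.distrib[symmetric]
    by (intro teq_sum finite_I) auto
qed

text \<open>Expand both factors by \<open>V_expand\<close> and move the scalar of the right factor
  to the left one with \<open>balanced\<close>.\<close>

lemma teq_normal_form_single:
  assumes f: "f \<in> carrier V" and g: "g \<in> carrier V"
  shows "teq {#(f, g)#} (normal_form (\<lambda>k l. pairing P (t k) f \<otimes> pairing P (t l) g))"
proof -
  let ?f = "\<lambda>k. pairing P (t k) f \<odot>\<^bsub>V\<^esub> h k" and ?g = "\<lambda>k. pairing P (t k) g \<odot>\<^bsub>V\<^esub> h k"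
  have fg: "?f k \<in> carrier V" "?g k \<in> carrier V" if "k \<in> I" for k
    using that f g h t pairing by (auto intro: V_smult_closed)
  have 1: "teq {#(f, g)#} (\<Sum>k\<in>I. {#(?f k, g)#})"
    using teq_fsum_left[of I ?f g] finite_I fg g V_expand[OF f] by simp
  have "teq {#(?f k, g)#} (\<Sum>l\<in>I. {#((pairing P (t k) f \<otimes> pairing P (t l) g) \<odot>\<^bsub>V\<^esub> h k, h l)#})"
    if k: "k \<in> I" for k
  proof -
    have 2: "teq {#(?f k, g)#} (\<Sum>l\<in>I. {#(?f k, ?g l)#})"
      using teq_fsum_right[of I ?g "?f k"] finite_I fg k V_expand[OF g] by simp
    have "teq {#(?f k, ?g l)#} {#((pairing P (t k) f \<otimes> pairing P (t l) g) \<odot>\<^bsub>V\<^esub> h k, h l)#}"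
      if l: "l \<in> I" for l
    proof -
      have r: "pairing P (t k) f \<in> carrier R" "pairing P (t l) g \<in> carrier R"
        "pairing P (t k) f \<otimes> pairing P (t l) g \<in> carrier R"
        using f g k l t pairing subringE(6)[OF R] by auto
      then have "pairing P (t l) g \<odot>\<^bsub>V\<^esub> ?f k = (pairing P (t k) f \<otimes> pairing P (t l) g) \<odot>\<^bsub>V\<^esub> h k"
        using h[OF k] fg[OF k] R_closed
        by (simp add: V_smult[OF r(2)]) (auto simp: V_smult m_ac intro!: restrict_ext)
      then show ?thesis
        using tensor_eq.sym[OF tensor_eq.balanced[OF r(2) fg(1)[OF k] h[OF l]]] by simp
    qed
    then show ?thesis by (intro tensor_eq.trans[OF 2] teq_sum finite_I)
  qed
  then show ?thesis
    unfolding normal_form_def by (intro tensor_eq.trans[OF 1] teq_sum finite_I)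
qed

lemma pairing2_add_mset:
  assumes fg: "f \<in> carrier V" "g \<in> carrier V"
    and bc: "\<And>x. x \<in> P \<Longrightarrow> b x \<in> carrier E" "\<And>x. x \<in> P \<Longrightarrow> c x \<in> carrier E"
  shows "pairing2 b c (tensor_value (add_mset (f, g) A))
    = pairing P b f \<otimes> pairing P c g \<oplus> pairing2 b c (tensor_value A)"
proof -
  have "pairing P c (tensor_value (add_mset (f, g) A) x)
      = f x \<otimes> pairing P c g \<oplus> pairing P c (tensor_value A x)" if x: "x \<in> P" for x
  proof -
    have "pairing P c (tensor_value (add_mset (f, g) A) x)
        = pairing P c (\<lambda>y. f x \<otimes> g y \<oplus> tensor_value A x y)"
      using fg bc x by (intro pairing_cong) (auto simp: tensor_value_add_mset)
    also have "\<dots> = pairing P c (\<lambda>y. f x \<otimes> g y) \<oplus> pairing P c (tensor_value A x)"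
      using fg bc x by (subst pairing_add_right) auto
    also have "pairing P c (\<lambda>y. f x \<otimes> g y) = f x \<otimes> pairing P c g"
      using fg bc x by (intro pairing_smult_right finite_P) auto
    finally show ?thesis .
  qed
  then have "pairing2 b c (tensor_value (add_mset (f, g) A))
      = pairing P b (\<lambda>x. f x \<otimes> pairing P c g \<oplus> pairing P c (tensor_value A x))"
    unfolding pairing2_def using fg bc by (intro pairing_cong) auto
  also have "\<dots> = pairing P b (\<lambda>x. f x \<otimes> pairing P c g) \<oplus> pairing2 b c (tensor_value A)"
    unfolding pairing2_def using fg bc by (subst pairing_add_right) auto
  also have "pairing P b (\<lambda>x. f x \<otimes> pairing P c g) = pairing P b f \<otimes> pairing P c g"
    using fg bc by (intro pairing_smult_right finite_P) auto
  finally show ?thesis .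
qed

text \<open>The left side sees only the values of the tensor, the right side only its factors. The
  functions \<open>b\<close> and \<open>c\<close> are arbitrary because later they are rows of the
  matrix of a Hopf isomorphism, and the right side is then a value of the image tensor.\<close>

lemma pairing2_tensor_value:
  assumes "A \<in> tensors"
    and bc: "\<And>x. x \<in> P \<Longrightarrow> b x \<in> carrier E" "\<And>x. x \<in> P \<Longrightarrow> c x \<in> carrier E"
  shows "pairing2 b c (tensor_value A) = msum (\<lambda>p. pairing P b (fst p) \<otimes> pairing P c (snd p)) A"
  using assms(1)
proof (induction A)
  case empty
  show ?case
    unfolding pairing2_def pairing_def tensor_value_def
    using bc by (simp add: add.finprod_one_eqI)
next
  case (add p A)
  obtain f g where p: "p = (f, g)" by (cases p)
  then have "f \<in> carrier V" "g \<in> carrier V" "A \<in> tensors" using add.prems by auto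
  then show ?case using add.IH bc by (simp add: p pairing2_add_mset)
qed

lemma coefficient_empty: "k \<in> I \<Longrightarrow> l \<in> I \<Longrightarrow> coefficient (tensor_value {#}) k l = \<zero>"
  unfolding coefficient_def by (subst pairing2_tensor_value) auto

lemma coefficient_add_mset:
  assumes "f \<in> carrier V" "g \<in> carrier V" "k \<in> I" "l \<in> I"
  shows "coefficient (tensor_value (add_mset (f, g) A)) k l
    = pairing P (t k) f \<otimes> pairing P (t l) g \<oplus> coefficient (tensor_value A) k l"
  unfolding coefficient_def using assms by (intro pairing2_add_mset) auto

text \<open>The normal form depends on the tensor only through its values on \<open>P \<times> P\<close>; hence equal values
  force equality in \<open>V \<otimes>\<^sub>R V\<close>.\<close>

lemma teq_normal_form:
  assumes "A \<in> tensors"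
  shows "(\<forall>k\<in>I. \<forall>l\<in>I. coefficient (tensor_value A) k l \<in> carrier R) \<and>
    teq A (normal_form (coefficient (tensor_value A)))"
  using assms
proof (induction A)
  case empty
  have 0: "\<zero> \<in> carrier R" using subringE(2)[OF R] .
  have "\<zero> \<odot>\<^bsub>V\<^esub> w = \<zero>\<^bsub>V\<^esub>" if "w \<in> carrier V" for w
    using that by (simp add: V_smult[OF 0] V_zero cong: restrict_cong)
  then have "teq (normal_form (\<lambda>k l. \<zero>)) (\<Sum>k\<in>I. \<Sum>l\<in>I. {#})"
    unfolding normal_form_def
    by (intro teq_sum finite_I) (simp add: h tensor_eq.zero)
  then have "teq {#} (normal_form (\<lambda>k l. \<zero>))" by (auto intro: tensor_eq.sym)
  also have "normal_form (\<lambda>k l. \<zero>) = normal_form (coefficient (tensor_value {#}))"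
    by (intro normal_form_cong) (simp add: coefficient_empty)
  finally show ?case using 0 by (simp add: coefficient_empty)
next
  case (add p A)
  obtain f g where p: "p = (f, g)" by (cases p)
  then have fg: "f \<in> carrier V" "g \<in> carrier V" and A: "A \<in> tensors" using add.prems by auto
  let ?c = "\<lambda>k l. pairing P (t k) f \<otimes> pairing P (t l) g" and ?d = "coefficient (tensor_value A)"
  have c: "?c k l \<in> carrier R" if "k \<in> I" "l \<in> I" for k l
    using fg that t pairing subringE(6)[OF R] by auto
  have d: "?d k l \<in> carrier R" if "k \<in> I" "l \<in> I" for k l
    using add.IH[OF A] that by auto
  have "teq ({#p#} + A) (normal_form ?c + normal_form ?d)"
    unfolding p using teq_normal_form_single[OF fg] add.IH[OF A] by (intro tensor_eq.add) auto
  moreover have "teq (normal_form ?c + normal_form ?d) (normal_form (\<lambda>k l. ?c k l \<oplus> ?d k l))"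
    using c d by (intro tensor_eq.sym[OF teq_normal_form_add]) auto
  moreover have "normal_form (\<lambda>k l. ?c k l \<oplus> ?d k l) = normal_form (coefficient (tensor_value (add_mset p A)))"
    unfolding p using fg by (intro normal_form_cong) (auto simp: coefficient_add_mset)
  ultimately have "teq (add_mset p A) (normal_form (coefficient (tensor_value (add_mset p A))))"
    by (auto intro: tensor_eq.trans)
  moreover have "coefficient (tensor_value (add_mset p A)) k l \<in> carrier R" if "k \<in> I" "l \<in> I" for k l
    unfolding p using that fg c d subringE(7)[OF R] by (simp add: coefficient_add_mset)
  ultimately show ?case by blast
qed

theorem teq_iff:
  "teq A B \<longleftrightarrow> A \<in> tensors \<and> B \<in> tensors \<and> (\<forall>x\<in>P. \<forall>y\<in>P. tensor_value A x y = tensor_value B x y)"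
proof (intro iffI)
  assume *: "A \<in> tensors \<and> B \<in> tensors \<and> (\<forall>x\<in>P. \<forall>y\<in>P. tensor_value A x y = tensor_value B x y)"
  then have "coefficient (tensor_value A) k l = coefficient (tensor_value B) k l"
    if "k \<in> I" "l \<in> I" for k l
    unfolding coefficient_def pairing2_def using that by (intro pairing_cong) auto
  then have "normal_form (coefficient (tensor_value A)) = normal_form (coefficient (tensor_value B))"
    by (intro normal_form_cong)
  then show "teq A B"
    using * teq_normal_form[of A] teq_normal_form[of B] by (auto intro: tensor_eq.trans tensor_eq.sym)
qed (rule teq_sound)

corollary tensor_class_eq:
  assumes "A \<in> tensors"
  shows "tensor_class R V V A = {B \<in> tensors. \<forall>x\<in>P. \<forall>y\<in>P. tensor_value B x y = tensor_value A x y}"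
  using assms by (auto simp: tensor_class_def teq_iff)

lemma tensor_value_sum:
  assumes "finite J" and "\<And>k. k \<in> J \<Longrightarrow> A k \<in> tensors" and "x \<in> P" "y \<in> P"
  shows "sum A J \<in> tensors \<and> tensor_value (sum A J) x y = (\<Oplus>k\<in>J. tensor_value (A k) x y)"
  using assms(1,2)
proof (induction J)
  case empty
  then show ?case by (simp add: tensor_value_def)
next
  case (insert j J)
  then have "A j \<in> tensors" "sum A J \<in> tensors" by auto
  then show ?case using insert assms(3,4) by (simp add: tensor_value_union)
qed

text \<open>The preimage is the normal form with the coefficients of \<open>F\<close>; applying
  \<open>expand\<close> once in each variable recovers \<open>F\<close>. The condition on the
  coefficients makes them legitimate scalars.\<close>

lemma tensor_value_surj:
  assumes F: "\<And>x y. x \<in> P \<Longrightarrow> y \<in> P \<Longrightarrow> F x y \<in> carrier E"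
    and c: "\<And>k l. k \<in> I \<Longrightarrow> l \<in> I \<Longrightarrow> coefficient F k l \<in> carrier R"
  obtains A where "A \<in> tensors" "\<And>x y. x \<in> P \<Longrightarrow> y \<in> P \<Longrightarrow> tensor_value A x y = F x y"
proof -
  let ?T = "\<lambda>k l. {#(coefficient F k l \<odot>\<^bsub>V\<^esub> h k, h l)#}"
  have T: "?T k l \<in> tensors" if "k \<in> I" "l \<in> I" for k l
    using that c h V_smult_closed by auto
  have T': "(\<Sum>l\<in>I. ?T k l) \<in> tensors" if "k \<in> I" for k
    using that T by (force simp: set_mset_sum finite_I)
  have "normal_form (coefficient F) \<in> tensors"
    using T' unfolding normal_form_def by (force simp: set_mset_sum finite_I)
  moreover have "tensor_value (normal_form (coefficient F)) x y = F x y" if xy: "x \<in> P" "y \<in> P" for x y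
  proof -
    let ?G = "\<lambda>l x. pairing P (t l) (F x)"
    have G: "?G l x \<in> carrier E" if "l \<in> I" "x \<in> P" for l x
      using that F by auto
    have cE: "coefficient F k l \<in> carrier E" if "k \<in> I" "l \<in> I" for k l
      using that c R_closed by auto
    have "tensor_value (normal_form (coefficient F)) x y = (\<Oplus>k\<in>I. tensor_value (\<Sum>l\<in>I. ?T k l) x y)"
      unfolding normal_form_def using tensor_value_sum[OF finite_I T' xy] by simp
    also have "\<dots> = (\<Oplus>k\<in>I. \<Oplus>l\<in>I. coefficient F k l \<otimes> h k x \<otimes> h l y)"
    proof (intro finsum_cong')
      fix k assume k: "k \<in> I"
      have "tensor_value (\<Sum>l\<in>I. ?T k l) x y = (\<Oplus>l\<in>I. tensor_value (?T k l) x y)"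
        using tensor_value_sum[OF finite_I T[OF k] xy] by simp
      also have "\<dots> = (\<Oplus>l\<in>I. coefficient F k l \<otimes> h k x \<otimes> h l y)"
        using k xy h c cE by (intro finsum_cong') (auto simp: tensor_value_def V_smult)
      finally show "tensor_value (\<Sum>l\<in>I. ?T k l) x y = (\<Oplus>l\<in>I. coefficient F k l \<otimes> h k x \<otimes> h l y)" .
    qed (use xy cE in auto)
    also have "\<dots> = (\<Oplus>l\<in>I. \<Oplus>k\<in>I. coefficient F k l \<otimes> h k x \<otimes> h l y)"
      using xy cE by (intro finsum_swap finite_I) auto
    also have "\<dots> = (\<Oplus>l\<in>I. ?G l x \<otimes> h l y)"
    proof (intro finsum_cong')
      fix l assume l: "l \<in> I"
      have "(\<Oplus>k\<in>I. coefficient F k l \<otimes> h k x \<otimes> h l y) = (\<Oplus>k\<in>I. coefficient F k l \<otimes> h k x) \<otimes> h l y"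
        using l xy cE finite_I by (subst finsum_ldistr) auto
      also have "(\<Oplus>k\<in>I. coefficient F k l \<otimes> h k x) = ?G l x"
        unfolding coefficient_def pairing2_def using G l xy by (intro expand) auto
      finally show "(\<Oplus>k\<in>I. coefficient F k l \<otimes> h k x \<otimes> h l y) = ?G l x \<otimes> h l y" .
    qed (use xy G in auto)
    also have "\<dots> = F x y"
      using F xy by (intro expand) auto
    finally show ?thesis .
  qed
  ultimately show thesis using that by blast
qed

end
section \<open>Galois groups and Galois coordinates\<close>

lemma gal_carrier: "carrier (gal E K) = {\<rho> \<in> ring_hom E E \<inter> Bij (carrier E). \<forall>x\<in>K. \<rho> x = x}"
  by (simp add: gal_def)

lemma gal_mult:
  "\<rho> \<in> carrier (gal E K) \<Longrightarrow> \<tau> \<in> carrier (gal E K) \<Longrightarrow> \<rho> \<otimes>\<^bsub>gal E K\<^esub> \<tau> = compose (carrier E) \<rho> \<tau>"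
  by (simp add: gal_def BijGroup_def)

lemma gal_one: "\<one>\<^bsub>gal E K\<^esub> = (\<lambda>x\<in>carrier E. x)"
  by (simp add: gal_def BijGroup_def)

lemma (in ring) subgroup_gal:
  assumes "K \<subseteq> carrier R"
  shows "subgroup (carrier (gal R K)) (BijGroup (carrier R))"
proof -
  interpret B: group "BijGroup (carrier R)" by (rule group_BijGroup)
  show ?thesis
  proof (rule B.subgroupI)
    have "(\<lambda>x\<in>carrier R. x) \<in> carrier (gal R K)"
      using assms by (auto simp: gal_carrier id_Bij intro!: ring_hom_memI)
    then show "carrier (gal R K) \<noteq> {}" by blast
  next
    fix \<rho> assume "\<rho> \<in> carrier (gal R K)"
    then have s: "\<rho> \<in> ring_hom R R" "\<rho> \<in> Bij (carrier R)" "\<And>x. x \<in> K \<Longrightarrow> \<rho> x = x"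
      by (auto simp: gal_carrier)
    let ?i = "inv_into (carrier R) \<rho>"
    have b: "bij_betw \<rho> (carrier R) (carrier R)" using s(2) by (simp add: Bij_def)
    have inv: "?i (\<rho> x) = x" "\<rho> (?i x) = x" "?i x \<in> carrier R" if "x \<in> carrier R" for x
      using b that by (auto simp: bij_betw_def inv_into_into f_inv_into_f)
    note h = ring_hom_memE[OF s(1)]
    have "?i (x \<otimes> y) = ?i x \<otimes> ?i y" "?i (x \<oplus> y) = ?i x \<oplus> ?i y"
      if xy: "x \<in> carrier R" "y \<in> carrier R" for x y
      using h(2,3)[of "?i x" "?i y"] inv(2,3)[OF xy(1)] inv(2,3)[OF xy(2)]
        inv(1)[of "?i x \<otimes> ?i y"] inv(1)[of "?i x \<oplus> ?i y"] by auto
    moreover have "?i \<one> = \<one>" using inv(1)[of \<one>] h(4) by simp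
    ultimately have "(\<lambda>x\<in>carrier R. ?i x) \<in> ring_hom R R"
      using inv by (intro ring_hom_memI) auto
    moreover have "(\<lambda>x\<in>carrier R. ?i x) x = x" if "x \<in> K" for x
      using inv(1)[of x] s(3)[OF that] that assms by auto
    ultimately show "inv\<^bsub>BijGroup (carrier R)\<^esub> \<rho> \<in> carrier (gal R K)"
      using s(2) by (simp add: inv_BijGroup gal_carrier restrict_inv_into_Bij)
  next
    fix \<rho> \<tau> assume a: "\<rho> \<in> carrier (gal R K)" "\<tau> \<in> carrier (gal R K)"
    then have h: "\<rho> \<in> ring_hom R R" "\<tau> \<in> ring_hom R R" by (auto simp: gal_carrier)
    have "compose (carrier R) \<rho> \<tau> \<in> ring_hom R R"
      using ring_hom_memE[OF h(1)] ring_hom_memE[OF h(2)]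
      by (intro ring_hom_memI) (simp_all add: compose_eq)
    moreover have "compose (carrier R) \<rho> \<tau> x = x" if "x \<in> K" for x
      using a that assms by (auto simp: gal_carrier compose_def)
    ultimately show "\<rho> \<otimes>\<^bsub>BijGroup (carrier R)\<^esub> \<tau> \<in> carrier (gal R K)"
      using a by (auto simp: gal_carrier BijGroup_def compose_Bij)
  qed (auto simp: gal_carrier BijGroup_def)
qed

lemma (in ring) group_gal: "K \<subseteq> carrier R \<Longrightarrow> group (gal R K)"
  using subgroup.subgroup_is_group[OF subgroup_gal group_BijGroup, of K] by (simp add: gal_def)

locale galois = field E for E :: "('a, 'r) ring_scheme" (structure) +
  fixes K :: "'a set"
  assumes galois: "galois_extension E K"
begin

abbreviation "G \<equiv> gal E K"

lemma subfield_K: "subfield K E"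
  using galois by (simp add: galois_extension_def)

lemma K_closed: "x \<in> K \<Longrightarrow> x \<in> carrier E"
  using subfieldE(3)[OF subfield_K] by auto

lemma fixed_in_K:
  "x \<in> carrier E \<Longrightarrow> (\<And>\<rho>. \<rho> \<in> carrier G \<Longrightarrow> \<rho> x = x) \<Longrightarrow> x \<in> K"
  using galois by (auto simp: galois_extension_def)

sublocale G: group G
  using K_closed by (intro group_gal) auto

lemma gal_hom: "\<rho> \<in> carrier G \<Longrightarrow> \<rho> \<in> ring_hom E E"
  by (simp add: gal_carrier)

lemma gal_ring_hom: "\<rho> \<in> carrier G \<Longrightarrow> ring_hom_ring E E \<rho>"
  by (intro ring_hom_ringI2 gal_hom ring_axioms)

lemma gal_simps [simp]:
  assumes "\<rho> \<in> carrier G"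
  shows "x \<in> carrier E \<Longrightarrow> \<rho> x \<in> carrier E"
    and "x \<in> carrier E \<Longrightarrow> y \<in> carrier E \<Longrightarrow> \<rho> (x \<otimes> y) = \<rho> x \<otimes> \<rho> y"
    and "x \<in> carrier E \<Longrightarrow> y \<in> carrier E \<Longrightarrow> \<rho> (x \<oplus> y) = \<rho> x \<oplus> \<rho> y"
    and "\<rho> \<one> = \<one>" and "\<rho> \<zero> = \<zero>"
  using ring_hom_memE[OF gal_hom[OF assms]] ring_hom_zero[OF gal_hom[OF assms] ring_axioms ring_axioms] assms
  by (auto simp: gal_carrier)

lemma gal_fix: "\<rho> \<in> carrier G \<Longrightarrow> k \<in> K \<Longrightarrow> \<rho> k = k"
  by (simp add: gal_carrier)

lemma gal_finsum:
  assumes "\<rho> \<in> carrier G" and "\<And>i. i \<in> A \<Longrightarrow> f i \<in> carrier E"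
  shows "\<rho> (\<Oplus>i\<in>A. f i) = (\<Oplus>i\<in>A. \<rho> (f i))"
  using ring_hom_ring.hom_finsum[OF gal_ring_hom[OF assms(1)], of f A] assms(2) by (simp add: Pi_def o_def)

lemma gal_mult_apply:
  "\<rho> \<in> carrier G \<Longrightarrow> \<tau> \<in> carrier G \<Longrightarrow> x \<in> carrier E \<Longrightarrow> (\<rho> \<otimes>\<^bsub>G\<^esub> \<tau>) x = \<rho> (\<tau> x)"
  by (simp add: gal_mult compose_def)

lemma gal_one_apply: "x \<in> carrier E \<Longrightarrow> \<one>\<^bsub>G\<^esub> x = x"
  by (simp add: gal_one)

lemma gal_eqI:
  "\<rho> \<in> carrier G \<Longrightarrow> \<tau> \<in> carrier G \<Longrightarrow> (\<And>x. x \<in> carrier E \<Longrightarrow> \<rho> x = \<tau> x) \<Longrightarrow> \<rho> = \<tau>"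
  by (rule extensionalityI[of _ "carrier E"]) (auto simp: gal_carrier Bij_def)

text \<open>\<open>b\<close> is algebraic because E is finite over K, and all its conjugates are
  roots of the same nonzero polynomial over K.\<close>

lemma finite_conjugates:
  assumes b: "b \<in> carrier E"
  shows "finite {\<rho> b |\<rho>. \<rho> \<in> carrier G}"
proof -
  have K: "subring K E" using subfieldE(1)[OF subfield_K] .
  have "finite_dimension K (carrier E)" using galois by (simp add: galois_extension_def)
  then have "(algebraic over K) b"
    using finite_dimension_imp_algebraic[OF subfield_K carrier_is_subring] b by simp
  then obtain p where p: "p \<in> carrier (K[X])" "p \<noteq> []" "eval p b = \<zero>"
    using algebraicE[OF K b] by blast
  have pK: "set p \<subseteq> K" using p(1,2) by (simp add: univ_poly_def polynomial_def)
  have "is_root p (\<rho> b)" if s: "\<rho> \<in> carrier G" for \<rho>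
  proof -
    have "map \<rho> p = p" using pK s gal_fix by (intro map_idI) auto
    moreover have "\<rho> (eval p b) = eval (map \<rho> p) (\<rho> b)"
      using pK K_closed by (intro ring_hom_ring.eval_hom'[OF gal_ring_hom[OF s] b]) auto
    ultimately show ?thesis using p s b by (simp add: is_root_def)
  qed
  then have "{\<rho> b |\<rho>. \<rho> \<in> carrier G} \<subseteq> {x. is_root p x}" by auto
  then show ?thesis
    using finite_number_of_roots[OF carrier_polynomial_shell[OF K p(1)]] finite_subset by blast
qed

lemma Span_agree:
  assumes "\<rho> \<in> carrier G" "\<tau> \<in> carrier G" and "set bs \<subseteq> carrier E" "map \<rho> bs = map \<tau> bs"
    and "x \<in> Span K bs"
  shows "x \<in> carrier E \<and> \<rho> x = \<tau> x"
  using assms(3-5)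
proof (induction bs arbitrary: x)
  case Nil
  then have "x = \<zero>" by simp
  then show ?case using assms(1,2) by simp
next
  case (Cons b bs)
  then obtain k v where "k \<in> K" "v \<in> Span K bs" "x = k \<otimes> b \<oplus> v"
    by (auto simp: line_extension_mem_iff)
  moreover have "v \<in> carrier E \<and> \<rho> v = \<tau> v"
    using Cons.prems \<open>v \<in> Span K bs\<close> by (intro Cons.IH) auto
  ultimately show ?case using Cons.prems assms(1,2) K_closed by (auto simp: gal_fix)
qed

text \<open>An automorphism over K is determined by its values on a spanning list, and each value
  lies among finitely many conjugates.\<close>

lemma finite_G: "finite (carrier G)"
proof -
  have "finite_dimension K (carrier E)" using galois by (simp add: galois_extension_def)
  then obtain n where "dimension n K (carrier E)" by (auto simp: finite_dimension_def)
  then obtain bs where bs: "set bs \<subseteq> carrier E" "Span K bs = carrier E"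
    using exists_base[OF subfield_K] by blast
  have "inj_on (\<lambda>\<rho>. map \<rho> bs) (carrier G)"
  proof (intro inj_onI gal_eqI)
    fix \<rho> \<tau> x assume "\<rho> \<in> carrier G" "\<tau> \<in> carrier G" "map \<rho> bs = map \<tau> bs" "x \<in> carrier E"
    then show "\<rho> x = \<tau> x" using Span_agree[of \<rho> \<tau> bs x] bs by blast
  qed
  moreover have "(\<lambda>\<rho>. map \<rho> bs) ` carrier G
      \<subseteq> {xs. set xs \<subseteq> (\<Union>b\<in>set bs. {\<rho> b |\<rho>. \<rho> \<in> carrier G}) \<and> length xs = length bs}"
  proof clarsimp
    fix \<rho> x assume "\<rho> \<in> carrier G" "x \<in> set bs"
    then show "\<exists>y\<in>set bs. \<exists>\<tau>. \<rho> x = \<tau> y \<and> \<tau> \<in> carrier G"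
      by (intro bexI[of _ x] exI[of _ \<rho>]) auto
  qed
  moreover have "finite {xs. set xs \<subseteq> (\<Union>b\<in>set bs. {\<rho> b |\<rho>. \<rho> \<in> carrier G}) \<and> length xs = length bs}"
    using bs finite_conjugates by (intro finite_lists_length_eq) auto
  ultimately show ?thesis using finite_imageD finite_subset by blast
qed

text \<open>For \<open>x\<close> moved by \<tau>, the interpolation polynomial (Z - \<tau> x) / (x -
  \<tau> x) is 1 at Z = x and 0 at Z = \<tau> x. Its two terms, with \<open>b = \<one>\<close> and
  \<open>b' = x\<close>, are the required sum.\<close>

lemma separating_pair:
  assumes \<tau>: "\<tau> \<in> carrier G" "\<tau> \<noteq> \<one>\<^bsub>G\<^esub>"
  obtains a b a' b' where "a \<in> carrier E" "b \<in> carrier E" "a' \<in> carrier E" "b' \<in> carrier E"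
    "a \<otimes> b \<oplus> a' \<otimes> b' = \<one>" "a \<otimes> \<tau> b \<oplus> a' \<otimes> \<tau> b' = \<zero>"
proof -
  obtain x where x: "x \<in> carrier E" "\<tau> x \<noteq> x"
    using gal_eqI[OF \<tau>(1) G.one_closed] \<tau>(2) gal_one_apply by metis
  let ?d = "x \<ominus> \<tau> x"
  have tx: "\<tau> x \<in> carrier E" using x \<tau> by simp
  have d: "?d \<in> carrier E" "?d \<noteq> \<zero>" using x tx by auto
  then have i: "inv ?d \<in> carrier E" "inv ?d \<otimes> ?d = \<one>" by (auto simp: field_Units)
  have "\<ominus> (\<tau> x) \<otimes> inv ?d \<otimes> \<one> \<oplus> inv ?d \<otimes> x = inv ?d \<otimes> ?d"
    using x(1) tx i(1) by algebra
  moreover have "\<ominus> (\<tau> x) \<otimes> inv ?d \<otimes> \<tau> \<one> \<oplus> inv ?d \<otimes> \<tau> x = \<zero>"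
    unfolding gal_simps(4)[OF \<tau>(1)] using x(1) tx i(1) by algebra
  ultimately show thesis
    using that[of "\<ominus> (\<tau> x) \<otimes> inv ?d" \<one> "inv ?d" x] x tx i by auto
qed

text \<open>Expand the product over \<open>\<tau> \<in> S\<close> of the two-term sums of \<open>separating_pair\<close>.\<close>

lemma galois_coordinates_mset:
  assumes "finite S" "S \<subseteq> carrier G - {\<one>\<^bsub>G\<^esub>}"
  shows "\<exists>M. set_mset M \<subseteq> carrier E \<times> carrier E \<and>
    msum (\<lambda>p. fst p \<otimes> snd p) M = \<one> \<and> (\<forall>\<rho>\<in>S. msum (\<lambda>p. fst p \<otimes> \<rho> (snd p)) M = \<zero>)"
  using assms
proof (induction S)
  case empty
  show ?case by (rule exI[of _ "{#(\<one>, \<one>)#}"]) simp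
next
  case (insert \<tau> S)
  then obtain M where M: "set_mset M \<subseteq> carrier E \<times> carrier E"
    and M1: "msum (\<lambda>p. fst p \<otimes> snd p) M = \<one>"
    and M0: "\<And>\<rho>. \<rho> \<in> S \<Longrightarrow> msum (\<lambda>p. fst p \<otimes> \<rho> (snd p)) M = \<zero>" by auto
  have \<tau>: "\<tau> \<in> carrier G" "\<tau> \<noteq> \<one>\<^bsub>G\<^esub>" using insert.prems by auto
  obtain a b a' b' where ab: "a \<in> carrier E" "b \<in> carrier E" "a' \<in> carrier E" "b' \<in> carrier E"
    "a \<otimes> b \<oplus> a' \<otimes> b' = \<one>" "a \<otimes> \<tau> b \<oplus> a' \<otimes> \<tau> b' = \<zero>"
    using separating_pair[OF \<tau>] by metis
  let ?M = "\<lambda>a b. image_mset (\<lambda>p. (fst p \<otimes> a, snd p \<otimes> b)) M"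
  have M': "fst p \<in> carrier E" "snd p \<in> carrier E" if "p \<in># M" for p
    using M that by auto
  \<comment> \<open>For fixed \<rho> the map u \<otimes> v \<mapsto> u \<rho>(v) is multiplicative.
    Hence the factor \<open>M\<close> keeps the zeros on \<open>S\<close>, the new factor adds the
    zero at \<tau>, and at the identity both factors give 1.\<close>
  have eq: "msum (\<lambda>p. fst p \<otimes> \<rho> (snd p)) (?M a b + ?M a' b')
      = msum (\<lambda>p. fst p \<otimes> \<rho> (snd p)) M \<otimes> (a \<otimes> \<rho> b \<oplus> a' \<otimes> \<rho> b')" if s: "\<rho> \<in> carrier G" for \<rho>
  proof -
    have 1: "msum (\<lambda>p. fst p \<otimes> \<rho> (snd p)) (?M a b) = msum (\<lambda>p. fst p \<otimes> \<rho> (snd p)) M \<otimes> (a \<otimes> \<rho> b)"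
      if "a \<in> carrier E" "b \<in> carrier E" for a b
    proof -
      have "msum (\<lambda>p. fst p \<otimes> \<rho> (snd p)) (?M a b) = msum (\<lambda>p. fst p \<otimes> a \<otimes> \<rho> (snd p \<otimes> b)) M"
        using that s M' by (subst msum_image) auto
      also have "\<dots> = msum (\<lambda>p. (a \<otimes> \<rho> b) \<otimes> (fst p \<otimes> \<rho> (snd p))) M"
        using that s M' by (intro msum_cong) (auto simp: m_ac)
      also have "\<dots> = (a \<otimes> \<rho> b) \<otimes> msum (\<lambda>p. fst p \<otimes> \<rho> (snd p)) M"
        using that s M' by (subst msum_rdistr) auto
      finally show ?thesis using that s by (simp add: m_comm)
    qed
    have "msum (\<lambda>p. fst p \<otimes> \<rho> (snd p)) (?M a b + ?M a' b')
        = msum (\<lambda>p. fst p \<otimes> \<rho> (snd p)) (?M a b) \<oplus> msum (\<lambda>p. fst p \<otimes> \<rho> (snd p)) (?M a' b')"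
      using ab M' s by (intro msum_union) auto
    also have "\<dots> = msum (\<lambda>p. fst p \<otimes> \<rho> (snd p)) M \<otimes> (a \<otimes> \<rho> b \<oplus> a' \<otimes> \<rho> b')"
      unfolding 1[OF ab(1,2)] 1[OF ab(3,4)] using ab s by (simp add: r_distr)
    finally show ?thesis .
  qed
  have one: "msum (\<lambda>p. fst p \<otimes> \<one>\<^bsub>G\<^esub> (snd p)) N = msum (\<lambda>p. fst p \<otimes> snd p) N"
    if "\<And>p. p \<in># N \<Longrightarrow> fst p \<in> carrier E \<and> snd p \<in> carrier E" for N
    using that by (intro msum_cong) (auto simp: gal_one_apply)
  show ?case
  proof (intro exI[of _ "?M a b + ?M a' b'"] conjI ballI)
    have "msum (\<lambda>p. fst p \<otimes> snd p) (?M a b + ?M a' b')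
        = msum (\<lambda>p. fst p \<otimes> \<one>\<^bsub>G\<^esub> (snd p)) (?M a b + ?M a' b')"
      using ab M' by (intro one[symmetric]) auto
    also have "\<dots> = \<one>"
      using eq[OF G.one_closed] one[of M] M' M1 ab by (simp add: gal_one_apply)
    finally show "msum (\<lambda>p. fst p \<otimes> snd p) (?M a b + ?M a' b') = \<one>" .
  next
    fix \<rho> assume "\<rho> \<in> insert \<tau> S"
    then have s: "\<rho> \<in> carrier G" "\<rho> = \<tau> \<or> \<rho> \<in> S" using insert.prems by auto
    then show "msum (\<lambda>p. fst p \<otimes> \<rho> (snd p)) (?M a b + ?M a' b') = \<zero>"
      unfolding eq[OF s(1)] using ab M0 by auto
  qed (use ab(1-4) M' in auto)
qed

text \<open>Take \<open>S\<close> to be all nontrivial automorphisms. Under u \<otimes> v \<mapsto>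
  (u \<rho>(v)) for \<rho> in G, the sum of the \<open>u i\<close> \<otimes> \<open>v i\<close> is
  the idempotent supported at the identity.\<close>

lemma galois_coordinates:
  obtains n :: nat and u v where "\<And>i. i < n \<Longrightarrow> u i \<in> carrier E" "\<And>i. i < n \<Longrightarrow> v i \<in> carrier E"
    "\<And>\<rho>. \<rho> \<in> carrier G \<Longrightarrow> (\<Oplus>i\<in>{..<n}. u i \<otimes> \<rho> (v i)) = (if \<rho> = \<one>\<^bsub>G\<^esub> then \<one> else \<zero>)"
proof -
  obtain M where M: "set_mset M \<subseteq> carrier E \<times> carrier E" "msum (\<lambda>p. fst p \<otimes> snd p) M = \<one>"
    "\<forall>\<rho>\<in>carrier G - {\<one>\<^bsub>G\<^esub>}. msum (\<lambda>p. fst p \<otimes> \<rho> (snd p)) M = \<zero>"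
    using galois_coordinates_mset[OF _ subset_refl] finite_G by blast
  obtain n :: nat and w where w: "\<forall>i<n. w i \<in># M"
    and eq: "\<forall>v. (\<forall>p. p \<in># M \<longrightarrow> v p \<in> carrier E) \<longrightarrow> msum v M = (\<Oplus>i\<in>{..<n}. v (w i))"
    using msum_as_finsum[of M] by blast
  show thesis
  proof (rule that[of n "\<lambda>i. fst (w i)" "\<lambda>i. snd (w i)"])
    fix i assume "i < n"
    then show "fst (w i) \<in> carrier E" "snd (w i) \<in> carrier E" using w M(1) by force+
  next
    fix \<rho> assume s: "\<rho> \<in> carrier G"
    have "(\<Oplus>i\<in>{..<n}. fst (w i) \<otimes> \<rho> (snd (w i))) = msum (\<lambda>p. fst p \<otimes> \<rho> (snd p)) M"
      using M(1) s by (intro eq[rule_format, symmetric]) auto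
    moreover have "msum (\<lambda>p. fst p \<otimes> \<one>\<^bsub>G\<^esub> (snd p)) M = \<one>"
      unfolding M(2)[symmetric] using M(1) by (intro msum_cong) (auto simp: gal_one_apply)
    ultimately show "(\<Oplus>i\<in>{..<n}. fst (w i) \<otimes> \<rho> (snd (w i))) = (if \<rho> = \<one>\<^bsub>G\<^esub> then \<one> else \<zero>)"
      using M(3) s by auto
  qed
qed

section \<open>Traces from E to K\<close>

lemma bij_betw_gal_mult: "\<tau> \<in> carrier G \<Longrightarrow> bij_betw (\<lambda>\<rho>. \<tau> \<otimes>\<^bsub>G\<^esub> \<rho>) (carrier G) (carrier G)"
  by (intro bij_betwI[where g = "\<lambda>\<rho>. inv\<^bsub>G\<^esub> \<tau> \<otimes>\<^bsub>G\<^esub> \<rho>"] Pi_I) (simp_all add: G.m_assoc[symmetric])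

lemma finsum_gal_shift:
  assumes "\<tau> \<in> carrier G" and "\<And>\<rho>. \<rho> \<in> carrier G \<Longrightarrow> f \<rho> \<in> carrier E"
  shows "(\<Oplus>\<rho>\<in>carrier G. f (\<tau> \<otimes>\<^bsub>G\<^esub> \<rho>)) = (\<Oplus>\<rho>\<in>carrier G. f \<rho>)"
proof -
  have b: "(\<lambda>\<rho>. \<tau> \<otimes>\<^bsub>G\<^esub> \<rho>) ` carrier G = carrier G" "inj_on (\<lambda>\<rho>. \<tau> \<otimes>\<^bsub>G\<^esub> \<rho>) (carrier G)"
    using bij_betw_gal_mult[OF assms(1)] by (auto simp: bij_betw_def)
  have "f \<in> (\<lambda>\<rho>. \<tau> \<otimes>\<^bsub>G\<^esub> \<rho>) ` carrier G \<rightarrow> carrier E"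
    unfolding b(1) using assms(2) by (intro Pi_I)
  from finsum_reindex[OF this b(2)] show ?thesis unfolding b(1) by simp
qed

lemma trace_in_K:
  assumes "x \<in> carrier E"
  shows "(\<Oplus>\<rho>\<in>carrier G. \<rho> x) \<in> K"
proof (rule fixed_in_K)
  fix \<tau> assume t: "\<tau> \<in> carrier G"
  then have "\<tau> (\<Oplus>\<rho>\<in>carrier G. \<rho> x) = (\<Oplus>\<rho>\<in>carrier G. \<tau> (\<rho> x))"
    using assms by (intro gal_finsum) auto
  also have "\<dots> = (\<Oplus>\<rho>\<in>carrier G. (\<tau> \<otimes>\<^bsub>G\<^esub> \<rho>) x)"
    using assms t by (intro finsum_cong') (auto simp: gal_mult_apply)
  also have "\<dots> = (\<Oplus>\<rho>\<in>carrier G. \<rho> x)"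
    using assms t by (intro finsum_gal_shift) auto
  finally show "\<tau> (\<Oplus>\<rho>\<in>carrier G. \<rho> x) = (\<Oplus>\<rho>\<in>carrier G. \<rho> x)" .
qed (use assms in auto)

text \<open>Summing the coordinate relations over G gives sum_i u_i Tr(v_i) = 1, so some Tr(v_i) is
  nonzero. It lies in K, so its inverse is fixed by G and can be pulled out of the trace; this works
  in every characteristic.\<close>

lemma trace_one:
  obtains c where "c \<in> carrier E" "(\<Oplus>\<rho>\<in>carrier G. \<rho> c) = \<one>"
proof -
  obtain n :: nat and u v where uv: "\<And>i. i < n \<Longrightarrow> u i \<in> carrier E" "\<And>i. i < n \<Longrightarrow> v i \<in> carrier E"
    and eq: "\<And>\<rho>. \<rho> \<in> carrier G \<Longrightarrow> (\<Oplus>i\<in>{..<n}. u i \<otimes> \<rho> (v i)) = (if \<rho> = \<one>\<^bsub>G\<^esub> then \<one> else \<zero>)"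
    by (rule galois_coordinates) (rule that)
  let ?T = "\<lambda>x. \<Oplus>\<rho>\<in>carrier G. \<rho> x"
  have "(\<Oplus>i\<in>{..<n}. u i \<otimes> ?T (v i)) = (\<Oplus>i\<in>{..<n}. \<Oplus>\<rho>\<in>carrier G. u i \<otimes> \<rho> (v i))"
    using uv finite_G by (intro finsum_cong') (auto simp: finsum_rdistr)
  also have "\<dots> = (\<Oplus>\<rho>\<in>carrier G. \<Oplus>i\<in>{..<n}. u i \<otimes> \<rho> (v i))"
    using uv finite_G by (intro finsum_swap) auto
  also have "\<dots> = (\<Oplus>\<rho>\<in>carrier G. if \<rho> = \<one>\<^bsub>G\<^esub> then \<one> else \<zero>)"
    using eq by (intro finsum_cong') auto
  also have "\<dots> = \<one>"
    using finite_G by (intro finsum_delta) auto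
  finally have sum: "(\<Oplus>i\<in>{..<n}. u i \<otimes> ?T (v i)) = \<one>" .
  have "\<exists>i<n. ?T (v i) \<noteq> \<zero>"
  proof (rule ccontr)
    assume "\<not> (\<exists>i<n. ?T (v i) \<noteq> \<zero>)"
    then have "(\<Oplus>i\<in>{..<n}. u i \<otimes> ?T (v i)) = \<zero>"
      using uv by (intro add.finprod_one_eqI) auto
    then show False using sum one_not_zero by simp
  qed
  then obtain i where i: "i < n" "?T (v i) \<noteq> \<zero>" by blast
  have TK: "?T (v i) \<in> K" using trace_in_K uv i by simp
  then have TE: "?T (v i) \<in> carrier E" "inv (?T (v i)) \<in> carrier E" "inv (?T (v i)) \<otimes> ?T (v i) = \<one>"
    using K_closed i by (auto simp: field_Units)
  have iK: "inv (?T (v i)) \<in> K"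
    using subfield_m_inv(1)[OF subfield_K] TK i by auto
  have "?T (inv (?T (v i)) \<otimes> v i) = (\<Oplus>\<rho>\<in>carrier G. inv (?T (v i)) \<otimes> \<rho> (v i))"
    using TE(2) iK uv i by (intro finsum_cong') (auto simp: gal_fix)
  also have "\<dots> = \<one>"
    using TE uv i finite_G by (subst finsum_rdistr[symmetric]) auto
  finally show thesis using that[of "inv (?T (v i)) \<otimes> v i"] TE(2) uv i by simp
qed

end
section \<open>Descent of functions on a finite \<open>G\<close>-set\<close>

locale gal_set = galois +
  fixes P :: "'x set" and s :: "('a \<Rightarrow> 'a) \<Rightarrow> 'x \<Rightarrow> 'x"
  assumes finite_P: "finite P"
    and s_closed [simp]: "\<And>\<rho> x. \<rho> \<in> carrier (gal E K) \<Longrightarrow> x \<in> P \<Longrightarrow> s \<rho> x \<in> P"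
    and s_one: "\<And>x. x \<in> P \<Longrightarrow> s \<one>\<^bsub>gal E K\<^esub> x = x"
    and s_mult: "\<And>\<rho> \<tau> x. \<rho> \<in> carrier (gal E K) \<Longrightarrow> \<tau> \<in> carrier (gal E K) \<Longrightarrow> x \<in> P \<Longrightarrow>
      s (\<rho> \<otimes>\<^bsub>gal E K\<^esub> \<tau>) x = s \<rho> (s \<tau> x)"
begin

text \<open>The invariants of E^P under (\<rho> f)(x) = \<rho> (f (\<rho>^-1 x)), written without
  the inverse.\<close>

definition fixed_functions :: "('x \<Rightarrow> 'a) set" where
  "fixed_functions = {f \<in> P \<rightarrow>\<^sub>E carrier E. \<forall>\<rho>\<in>carrier G. \<forall>x\<in>P. \<rho> (f x) = f (s \<rho> x)}"

lemma fixed_closed [simp]: "f \<in> fixed_functions \<Longrightarrow> x \<in> P \<Longrightarrow> f x \<in> carrier E"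
  by (auto simp: fixed_functions_def)

lemma fixed_extensional: "f \<in> fixed_functions \<Longrightarrow> f \<in> extensional P"
  unfolding fixed_functions_def PiE_def by blast

lemma fixed_equivariant: "f \<in> fixed_functions \<Longrightarrow> \<rho> \<in> carrier G \<Longrightarrow> x \<in> P \<Longrightarrow> \<rho> (f x) = f (s \<rho> x)"
  by (auto simp: fixed_functions_def)

lemma s_inv_cancel [simp]:
  assumes "\<rho> \<in> carrier G" "x \<in> P"
  shows "s \<rho> (s (inv\<^bsub>G\<^esub> \<rho>) x) = x" "s (inv\<^bsub>G\<^esub> \<rho>) (s \<rho> x) = x"
  using s_mult[of \<rho> "inv\<^bsub>G\<^esub> \<rho>" x] s_mult[of "inv\<^bsub>G\<^esub> \<rho>" \<rho> x] assms s_one by auto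

lemma s_bij: "\<rho> \<in> carrier G \<Longrightarrow> bij_betw (s \<rho>) P P"
  by (intro bij_betwI[where g = "s (inv\<^bsub>G\<^esub> \<rho>)"]) auto

lemma finsum_s_shift:
  assumes "\<rho> \<in> carrier G" and "\<And>x. x \<in> P \<Longrightarrow> f x \<in> carrier E"
  shows "(\<Oplus>x\<in>P. f (s \<rho> x)) = (\<Oplus>x\<in>P. f x)"
proof -
  have b: "s \<rho> ` P = P" "inj_on (s \<rho>) P" using s_bij[OF assms(1)] by (auto simp: bij_betw_def)
  have "f \<in> s \<rho> ` P \<rightarrow> carrier E"
    unfolding b(1) using assms(2) by (intro Pi_I)
  from finsum_reindex[OF this b(2)] show ?thesis unfolding b(1) by simp
qed

lemma invariant_sum_in_K:
  assumes "\<And>x. x \<in> P \<Longrightarrow> f x \<in> carrier E"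
    and "\<And>\<rho> x. \<rho> \<in> carrier G \<Longrightarrow> x \<in> P \<Longrightarrow> \<rho> (f x) = f (s \<rho> x)"
  shows "(\<Oplus>x\<in>P. f x) \<in> K"
proof (rule fixed_in_K)
  fix \<rho> assume r: "\<rho> \<in> carrier G"
  have "\<rho> (\<Oplus>x\<in>P. f x) = (\<Oplus>x\<in>P. \<rho> (f x))"
    using r assms(1) by (intro gal_finsum)
  also have "\<dots> = (\<Oplus>x\<in>P. f (s \<rho> x))"
    using r assms by (intro finsum_cong') auto
  also have "\<dots> = (\<Oplus>x\<in>P. f x)"
    using r assms(1) by (intro finsum_s_shift)
  finally show "\<rho> (\<Oplus>x\<in>P. f x) = (\<Oplus>x\<in>P. f x)" .
qed (use assms(1) in auto)

lemma pairing_in_K: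
  assumes "f \<in> fixed_functions" "g \<in> fixed_functions"
  shows "pairing P f g \<in> K"
  unfolding pairing_def using assms by (intro invariant_sum_in_K) (auto simp: fixed_equivariant)

text \<open>The trace of \<open>e \<sqdot> x\<close>, that is \<open>\<Sum>\<rho>. \<rho> e \<sqdot> (s \<rho> x)\<close>.\<close>

definition orbit_sum :: "'a \<Rightarrow> 'x \<Rightarrow> 'x \<Rightarrow> 'a" where
  "orbit_sum e x = (\<lambda>y\<in>P. \<Oplus>\<rho>\<in>carrier G. if s \<rho> x = y then \<rho> e else \<zero>)"

text \<open>Applying \<tau> permutes the summands by \<rho> \<mapsto> \<tau> \<rho>.\<close>

lemma orbit_sum_fixed:
  assumes e: "e \<in> carrier E" and x: "x \<in> P"
  shows "orbit_sum e x \<in> fixed_functions"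
  unfolding fixed_functions_def
proof (intro CollectI conjI ballI)
  show "orbit_sum e x \<in> P \<rightarrow>\<^sub>E carrier E"
    using e by (auto simp: orbit_sum_def)
next
  fix \<tau> y assume t: "\<tau> \<in> carrier G" and y: "y \<in> P"
  have "\<tau> (orbit_sum e x y) = (\<Oplus>\<rho>\<in>carrier G. \<tau> (if s \<rho> x = y then \<rho> e else \<zero>))"
    using t y e by (simp add: orbit_sum_def gal_finsum)
  also have "\<dots> = (\<Oplus>\<rho>\<in>carrier G. if s (\<tau> \<otimes>\<^bsub>G\<^esub> \<rho>) x = s \<tau> y then (\<tau> \<otimes>\<^bsub>G\<^esub> \<rho>) e else \<zero>)"
  proof (intro finsum_cong' Pi_I)
    fix \<rho> assume r: "\<rho> \<in> carrier G"
    have "s \<rho> x = y \<longleftrightarrow> s (\<tau> \<otimes>\<^bsub>G\<^esub> \<rho>) x = s \<tau> y"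
      using s_bij[OF t] r t x y by (auto simp: s_mult bij_betw_def inj_on_def)
    then show "\<tau> (if s \<rho> x = y then \<rho> e else \<zero>) =
        (if s (\<tau> \<otimes>\<^bsub>G\<^esub> \<rho>) x = s \<tau> y then (\<tau> \<otimes>\<^bsub>G\<^esub> \<rho>) e else \<zero>)"
      using t r e by (simp add: gal_mult_apply)
  qed (use t e in auto)
  also have "\<dots> = (\<Oplus>\<rho>\<in>carrier G. if s \<rho> x = s \<tau> y then \<rho> e else \<zero>)"
    using t e by (intro finsum_gal_shift) auto
  also have "\<dots> = orbit_sum e x (s \<tau> y)"
    using t y by (simp add: orbit_sum_def)
  finally show "\<tau> (orbit_sum e x y) = orbit_sum e x (s \<tau> y)" .
qed

text \<open>Apply \<rho> to the coordinate relation for \<rho>^-1 \<tau>.\<close>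

lemma galois_orthogonality:
  assumes uv: "\<And>i. i < (n::nat) \<Longrightarrow> u i \<in> carrier E" "\<And>i. i < n \<Longrightarrow> v i \<in> carrier E"
    and eq: "\<And>\<rho>. \<rho> \<in> carrier G \<Longrightarrow> (\<Oplus>i\<in>{..<n}. u i \<otimes> \<rho> (v i)) = (if \<rho> = \<one>\<^bsub>G\<^esub> then \<one> else \<zero>)"
    and r: "\<rho> \<in> carrier G" and t: "\<tau> \<in> carrier G"
  shows "(\<Oplus>i\<in>{..<n}. \<rho> (u i) \<otimes> \<tau> (v i)) = (if \<tau> = \<rho> then \<one> else \<zero>)"
proof -
  let ?\<theta> = "inv\<^bsub>G\<^esub> \<rho> \<otimes>\<^bsub>G\<^esub> \<tau>"
  have th: "?\<theta> \<in> carrier G" "\<rho> \<otimes>\<^bsub>G\<^esub> ?\<theta> = \<tau>" using r t by (auto simp: G.m_assoc[symmetric])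
  have "(\<Oplus>i\<in>{..<n}. \<rho> (u i) \<otimes> \<tau> (v i)) = (\<Oplus>i\<in>{..<n}. \<rho> (u i \<otimes> ?\<theta> (v i)))"
  proof (intro finsum_cong' Pi_I)
    fix i assume "i \<in> {..<n}"
    then show "\<rho> (u i) \<otimes> \<tau> (v i) = \<rho> (u i \<otimes> ?\<theta> (v i))"
      using uv r th gal_mult_apply[OF r th(1), of "v i"] by simp
  qed (use uv r t th in auto)
  also have "\<dots> = \<rho> (\<Oplus>i\<in>{..<n}. u i \<otimes> ?\<theta> (v i))"
    using uv r th by (intro gal_finsum[symmetric]) auto
  also have "\<dots> = \<rho> (if ?\<theta> = \<one>\<^bsub>G\<^esub> then \<one> else \<zero>)"
    using eq[OF th(1)] by simp
  also have "?\<theta> = \<one>\<^bsub>G\<^esub> \<longleftrightarrow> \<tau> = \<rho>"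
    using r t th G.r_one by fastforce
  finally show ?thesis using r by auto
qed

text \<open>Multiply out the two traces. By \<open>galois_orthogonality\<close> the sum over
  \<open>i\<close> leaves only \<tau> = \<rho>; then \<rho> sends \<open>z\<close> both to
  \<open>x\<close> and to \<open>y\<close>, which forces \<open>x = y\<close>.\<close>

lemma orbit_sum_dual_aux:
  assumes uv: "\<And>i. i < (n::nat) \<Longrightarrow> u i \<in> carrier E" "\<And>i. i < n \<Longrightarrow> v i \<in> carrier E"
    and eq: "\<And>\<rho>. \<rho> \<in> carrier G \<Longrightarrow> (\<Oplus>i\<in>{..<n}. u i \<otimes> \<rho> (v i)) = (if \<rho> = \<one>\<^bsub>G\<^esub> then \<one> else \<zero>)"
    and c: "c \<in> carrier E" and z: "z \<in> P" and xy: "x \<in> P" "y \<in> P"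
  shows "(\<Oplus>i\<in>{..<n}. orbit_sum (c \<otimes> u i) z x \<otimes> orbit_sum (v i) z y)
    = (\<Oplus>\<rho>\<in>carrier G. if s \<rho> z = x \<and> x = y then \<rho> c else \<zero>)"
proof -
  let ?f = "\<lambda>i \<rho>. if s \<rho> z = x then \<rho> (c \<otimes> u i) else \<zero>" and ?g = "\<lambda>i \<tau>. if s \<tau> z = y then \<tau> (v i) else \<zero>"
  have f: "?f i \<rho> \<in> carrier E" "?g i \<rho> \<in> carrier E" if "\<rho> \<in> carrier G" "i < n" for i \<rho>
    using that uv c by auto
  have "(\<Oplus>i\<in>{..<n}. orbit_sum (c \<otimes> u i) z x \<otimes> orbit_sum (v i) z y)
      = (\<Oplus>i\<in>{..<n}. \<Oplus>\<rho>\<in>carrier G. ?f i \<rho> \<otimes> (\<Oplus>\<tau>\<in>carrier G. ?g i \<tau>))"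
  proof (intro finsum_cong' Pi_I)
    fix i assume "i \<in> {..<n}"
    then show "orbit_sum (c \<otimes> u i) z x \<otimes> orbit_sum (v i) z y
        = (\<Oplus>\<rho>\<in>carrier G. ?f i \<rho> \<otimes> (\<Oplus>\<tau>\<in>carrier G. ?g i \<tau>))"
      unfolding orbit_sum_def restrict_apply'[OF xy(1)] restrict_apply'[OF xy(2)]
      using f finite_G by (intro finsum_ldistr) (auto intro!: finsum_closed)
  qed (use f in \<open>auto intro!: finsum_closed\<close>)
  also have "\<dots> = (\<Oplus>\<rho>\<in>carrier G. \<Oplus>i\<in>{..<n}. ?f i \<rho> \<otimes> (\<Oplus>\<tau>\<in>carrier G. ?g i \<tau>))"
    using f finite_G by (intro finsum_swap) (auto intro!: finsum_closed m_closed)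
  also have "\<dots> = (\<Oplus>\<rho>\<in>carrier G. if s \<rho> z = x \<and> x = y then \<rho> c else \<zero>)"
  proof (intro finsum_cong' Pi_I)
    fix \<rho> assume r: "\<rho> \<in> carrier G"
    have "(\<Oplus>i\<in>{..<n}. ?f i \<rho> \<otimes> (\<Oplus>\<tau>\<in>carrier G. ?g i \<tau>))
        = (\<Oplus>i\<in>{..<n}. \<Oplus>\<tau>\<in>carrier G. ?f i \<rho> \<otimes> ?g i \<tau>)"
      using f r finite_G by (intro finsum_cong' finsum_rdistr Pi_I) (auto intro!: finsum_closed m_closed)
    also have "\<dots> = (\<Oplus>\<tau>\<in>carrier G. \<Oplus>i\<in>{..<n}. ?f i \<rho> \<otimes> ?g i \<tau>)"
      using f r finite_G by (intro finsum_swap) (auto intro!: m_closed)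
    also have "\<dots> = (\<Oplus>\<tau>\<in>carrier G. if \<tau> = \<rho> then if s \<rho> z = x \<and> x = y then \<rho> c else \<zero> else \<zero>)"
    proof (intro finsum_cong' Pi_I)
      fix \<tau> assume t: "\<tau> \<in> carrier G"
      show "(\<Oplus>i\<in>{..<n}. ?f i \<rho> \<otimes> ?g i \<tau>)
          = (if \<tau> = \<rho> then if s \<rho> z = x \<and> x = y then \<rho> c else \<zero> else \<zero>)"
      proof (cases "s \<rho> z = x \<and> s \<tau> z = y")
        case True
        then have "(\<Oplus>i\<in>{..<n}. ?f i \<rho> \<otimes> ?g i \<tau>) = (\<Oplus>i\<in>{..<n}. \<rho> c \<otimes> (\<rho> (u i) \<otimes> \<tau> (v i)))"
          using r t c uv by (intro finsum_cong') (auto simp: m_assoc)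
        also have "\<dots> = \<rho> c \<otimes> (if \<tau> = \<rho> then \<one> else \<zero>)"
          using galois_orthogonality[OF uv eq r t] r t c uv by (subst finsum_rdistr[symmetric]) auto
        finally show ?thesis using True r c by auto
      next
        case False
        then have "(\<Oplus>i\<in>{..<n}. ?f i \<rho> \<otimes> ?g i \<tau>) = \<zero>"
          using r t c uv by (intro add.finprod_one_eqI) auto
        then show ?thesis using False by auto
      qed
    qed (use r c in auto)
    also have "\<dots> = (if s \<rho> z = x \<and> x = y then \<rho> c else \<zero>)"
      using r c finite_G by (subst finsum_delta) auto
    finally show "(\<Oplus>i\<in>{..<n}. ?f i \<rho> \<otimes> (\<Oplus>\<tau>\<in>carrier G. ?g i \<tau>))
        = (if s \<rho> z = x \<and> x = y then \<rho> c else \<zero>)" .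
  qed (use c in auto)
  finally show ?thesis .
qed

text \<open>Sum \<open>orbit_sum_dual_aux\<close> over \<open>z\<close>. Each \<rho> sends exactly
  one \<open>z\<close> to \<open>x\<close>, so the diagonal value is the trace of \<open>c\<close>,
  which is 1. Without \<open>c\<close> it would be the order of G, which may vanish in positive
  characteristic.\<close>

lemma dual_families:
  "\<exists>(I :: ('x \<times> nat) set) h t. finite I \<and> h \<in> I \<rightarrow> fixed_functions \<and> t \<in> I \<rightarrow> fixed_functions \<and>
    (\<forall>x\<in>P. \<forall>y\<in>P. (\<Oplus>k\<in>I. t k x \<otimes> h k y) = (if x = y then \<one> else \<zero>))"
proof -
  obtain n :: nat and u v where uv: "\<And>i. i < n \<Longrightarrow> u i \<in> carrier E" "\<And>i. i < n \<Longrightarrow> v i \<in> carrier E"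
    and eq: "\<And>\<rho>. \<rho> \<in> carrier G \<Longrightarrow> (\<Oplus>i\<in>{..<n}. u i \<otimes> \<rho> (v i)) = (if \<rho> = \<one>\<^bsub>G\<^esub> then \<one> else \<zero>)"
    by (rule galois_coordinates) (rule that)
  obtain c where c: "c \<in> carrier E" "(\<Oplus>\<rho>\<in>carrier G. \<rho> c) = \<one>"
    by (rule trace_one)
  let ?t = "\<lambda>k. orbit_sum (c \<otimes> u (snd k)) (fst k)" and ?h = "\<lambda>k. orbit_sum (v (snd k)) (fst k)"
  have ff: "orbit_sum (c \<otimes> u i) z \<in> fixed_functions" "orbit_sum (v i) z \<in> fixed_functions"
    if "i < n" "z \<in> P" for i z
    using that uv c by (auto intro!: orbit_sum_fixed)
  have dual: "(\<Oplus>k\<in>P \<times> {..<n}. ?t k x \<otimes> ?h k y) = (if x = y then \<one> else \<zero>)"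
    if xy: "x \<in> P" "y \<in> P" for x y
  proof -
    have "(\<Oplus>k\<in>P \<times> {..<n}. ?t k x \<otimes> ?h k y)
        = (\<Oplus>z\<in>P. \<Oplus>i\<in>{..<n}. orbit_sum (c \<otimes> u i) z x \<otimes> orbit_sum (v i) z y)"
      using ff xy finite_P by (intro finsum_Times) auto
    also have "\<dots> = (\<Oplus>z\<in>P. \<Oplus>\<rho>\<in>carrier G. if s \<rho> z = x \<and> x = y then \<rho> c else \<zero>)"
      using c orbit_sum_dual_aux[OF uv eq c(1) _ xy] by (intro finsum_cong') auto
    also have "\<dots> = (\<Oplus>\<rho>\<in>carrier G. \<Oplus>z\<in>P. if s \<rho> z = x \<and> x = y then \<rho> c else \<zero>)"
      using c finite_P finite_G by (intro finsum_swap) auto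
    also have "\<dots> = (\<Oplus>\<rho>\<in>carrier G. if x = y then \<rho> c else \<zero>)"
    proof (intro finsum_cong' Pi_I)
      fix \<rho> assume r: "\<rho> \<in> carrier G"
      have "(\<Oplus>z\<in>P. if s \<rho> z = x \<and> x = y then \<rho> c else \<zero>)
          = (\<Oplus>z\<in>P. if z = s (inv\<^bsub>G\<^esub> \<rho>) x then if x = y then \<rho> c else \<zero> else \<zero>)"
        using c r xy by (intro finsum_cong') auto
      also have "\<dots> = (if x = y then \<rho> c else \<zero>)"
        using c r xy finite_P by (subst finsum_delta) auto
      finally show "(\<Oplus>z\<in>P. if s \<rho> z = x \<and> x = y then \<rho> c else \<zero>) = (if x = y then \<rho> c else \<zero>)" .
    qed (use c in auto)
    also have "\<dots> = (if x = y then \<one> else \<zero>)"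
      using c by simp
    finally show ?thesis .
  qed
  show ?thesis
    by (intro exI[of _ "P \<times> {..<n}"] exI[of _ ?h] exI[of _ ?t]) (use ff dual finite_P in auto)
qed

end
section \<open>The descended Hopf algebra\<close>

text \<open>The construction of \<open>fixed_hopf_algebra\<close> for an arbitrary finite group \<open>M\<close> with an action \<open>s\<close>
  of the Galois group.\<close>

definition descent_carrier ::
  "('e, 'r) ring_scheme \<Rightarrow> 'e set \<Rightarrow> ('x, 'm) monoid_scheme \<Rightarrow> (('e \<Rightarrow> 'e) \<Rightarrow> 'x \<Rightarrow> 'x) \<Rightarrow> ('x \<Rightarrow> 'e) set"
  where
  "descent_carrier E K M s =
     {f \<in> carrier M \<rightarrow>\<^sub>E carrier E. \<forall>\<sigma>\<in>carrier (gal E K). \<forall>x\<in>carrier M. \<sigma> (f x) = f (s \<sigma> x)}"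

definition descent_comult ::
  "('e, 'r) ring_scheme \<Rightarrow> 'e set \<Rightarrow> ('x, 'm) monoid_scheme \<Rightarrow> (('e \<Rightarrow> 'e) \<Rightarrow> 'x \<Rightarrow> 'x) \<Rightarrow>
   ('x \<Rightarrow> 'e) \<Rightarrow> (('x \<Rightarrow> 'e) \<times> ('x \<Rightarrow> 'e)) multiset set" where
  "descent_comult E K M s f =
     (let A = group_algebra E M; H = A\<lparr>carrier := descent_carrier E K M s\<rparr>
      in THE t. t \<in> tensor_product (E\<lparr>carrier := K\<rparr>) H H \<and>
           tensor_map E A A (\<lambda>x. x) (\<lambda>x. x) t = comult A f)"

definition descent_algebra ::
  "('e, 'r) ring_scheme \<Rightarrow> 'e set \<Rightarrow> ('x, 'm) monoid_scheme \<Rightarrow> (('e \<Rightarrow> 'e) \<Rightarrow> 'x \<Rightarrow> 'x) \<Rightarrow>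
   ('e, 'x \<Rightarrow> 'e) hopf_algebra" where
  "descent_algebra E K M s =
     group_algebra E M\<lparr>carrier := descent_carrier E K M s, comult := descent_comult E K M s\<rparr>"

lemma group_algebra_simps:
  "carrier (group_algebra E M) = carrier M \<rightarrow>\<^sub>E carrier E"
  "f \<otimes>\<^bsub>group_algebra E M\<^esub> g =
    (\<lambda>x\<in>carrier M. \<Oplus>\<^bsub>E\<^esub>y\<in>carrier M. f y \<otimes>\<^bsub>E\<^esub> g (inv\<^bsub>M\<^esub> y \<otimes>\<^bsub>M\<^esub> x))"
  "\<one>\<^bsub>group_algebra E M\<^esub> = group_basis E M \<one>\<^bsub>M\<^esub>"
  "\<zero>\<^bsub>group_algebra E M\<^esub> = (\<lambda>x\<in>carrier M. \<zero>\<^bsub>E\<^esub>)"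
  "f \<oplus>\<^bsub>group_algebra E M\<^esub> g = (\<lambda>x\<in>carrier M. f x \<oplus>\<^bsub>E\<^esub> g x)"
  "r \<odot>\<^bsub>group_algebra E M\<^esub> f = (\<lambda>x\<in>carrier M. r \<otimes>\<^bsub>E\<^esub> f x)"
  "counit (group_algebra E M) f = (\<Oplus>\<^bsub>E\<^esub>x\<in>carrier M. f x)"
  "antipode (group_algebra E M) f = (\<lambda>x\<in>carrier M. f (inv\<^bsub>M\<^esub> x))"
  by (simp_all add: group_algebra_def group_ring_def Let_def)

locale gal_group = gal_set E K "carrier M" s + M: group M
  for E :: "('a, 'r) ring_scheme" (structure) and K and M :: "('x, 'm) monoid_scheme"
    and s :: "('a \<Rightarrow> 'a) \<Rightarrow> 'x \<Rightarrow> 'x" +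
  assumes s_hom: "\<And>\<rho> x y. \<rho> \<in> carrier (gal E K) \<Longrightarrow> x \<in> carrier M \<Longrightarrow> y \<in> carrier M \<Longrightarrow>
    s \<rho> (x \<otimes>\<^bsub>M\<^esub> y) = s \<rho> x \<otimes>\<^bsub>M\<^esub> s \<rho> y"
begin

abbreviation "P \<equiv> carrier M"
abbreviation "A \<equiv> group_algebra E M"
abbreviation "H \<equiv> descent_algebra E K M s"
abbreviation "R \<equiv> E\<lparr>carrier := K\<rparr>"

lemma descent_carrier: "descent_carrier E K M s = fixed_functions"
  by (simp add: descent_carrier_def fixed_functions_def)

lemma descent_simps:
  "carrier H = fixed_functions"
  "f \<otimes>\<^bsub>H\<^esub> g = (\<lambda>x\<in>P. \<Oplus>y\<in>P. f y \<otimes> g (inv\<^bsub>M\<^esub> y \<otimes>\<^bsub>M\<^esub> x))"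
  "\<one>\<^bsub>H\<^esub> = group_basis E M \<one>\<^bsub>M\<^esub>"
  "\<zero>\<^bsub>H\<^esub> = (\<lambda>x\<in>P. \<zero>)"
  "f \<oplus>\<^bsub>H\<^esub> g = (\<lambda>x\<in>P. f x \<oplus> g x)"
  "r \<odot>\<^bsub>H\<^esub> f = (\<lambda>x\<in>P. r \<otimes> f x)"
  "counit H f = (\<Oplus>x\<in>P. f x)"
  "antipode H f = (\<lambda>x\<in>P. f (inv\<^bsub>M\<^esub> x))"
  by (simp_all add: descent_algebra_def group_algebra_simps descent_carrier)

text \<open>As \<rho> acts on \<open>M\<close> by a group automorphism, it permutes the summands of
  the convolution.\<close>

lemma mult_fixed:
  assumes f: "f \<in> fixed_functions" and g: "g \<in> fixed_functions"
  shows "f \<otimes>\<^bsub>H\<^esub> g \<in> fixed_functions"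
  unfolding fixed_functions_def
proof (intro CollectI conjI ballI)
  show "f \<otimes>\<^bsub>H\<^esub> g \<in> P \<rightarrow>\<^sub>E carrier E"
    using f g by (auto simp: descent_simps intro!: finsum_closed)
  fix \<rho> x assume r: "\<rho> \<in> carrier G" and x: "x \<in> P"
  have "group_hom M M (s \<rho>)"
    using r s_hom by (intro group_hom.intro group_hom_axioms.intro M.group_axioms homI) auto
  then have s_inv: "s \<rho> (inv\<^bsub>M\<^esub> y) = inv\<^bsub>M\<^esub> (s \<rho> y)" if "y \<in> P" for y
    using group_hom.hom_inv that by metis
  have "\<rho> ((f \<otimes>\<^bsub>H\<^esub> g) x) = (\<Oplus>y\<in>P. \<rho> (f y \<otimes> g (inv\<^bsub>M\<^esub> y \<otimes>\<^bsub>M\<^esub> x)))"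
    using f g r x by (simp add: descent_simps gal_finsum)
  also have "\<dots> = (\<Oplus>y\<in>P. f (s \<rho> y) \<otimes> g (inv\<^bsub>M\<^esub> (s \<rho> y) \<otimes>\<^bsub>M\<^esub> s \<rho> x))"
    using f g r x by (intro finsum_cong') (auto simp: fixed_equivariant s_hom s_inv)
  also have "\<dots> = (\<Oplus>y\<in>P. f y \<otimes> g (inv\<^bsub>M\<^esub> y \<otimes>\<^bsub>M\<^esub> s \<rho> x))"
    using f g r x by (intro finsum_s_shift) auto
  also have "\<dots> = (f \<otimes>\<^bsub>H\<^esub> g) (s \<rho> x)"
    using r x by (simp add: descent_simps)
  finally show "\<rho> ((f \<otimes>\<^bsub>H\<^esub> g) x) = (f \<otimes>\<^bsub>H\<^esub> g) (s \<rho> x)" .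
qed

text \<open>Stated for any record with these operations, since it is applied both to
  \<open>H\<close> and to the record with restricted carrier inside \<open>descent_comult\<close>,
  where the comultiplication is not yet replaced.\<close>

lemma fixed_module_coords:
  fixes V :: "('a, 'x \<Rightarrow> 'a, 'v) module_scheme"
  assumes V: "carrier V = fixed_functions" "\<zero>\<^bsub>V\<^esub> = (\<lambda>x\<in>P. \<zero>)"
    "\<And>f g. f \<oplus>\<^bsub>V\<^esub> g = (\<lambda>x\<in>P. f x \<oplus> g x)" "\<And>r f. r \<odot>\<^bsub>V\<^esub> f = (\<lambda>x\<in>P. r \<otimes> f x)"
  shows "\<exists>(I :: ('x \<times> nat) set) h t. function_coords E R P V I h t"
proof -
  obtain I :: "('x \<times> nat) set" and h t where I: "finite I" "h \<in> I \<rightarrow> fixed_functions"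
    "t \<in> I \<rightarrow> fixed_functions"
    "\<forall>x\<in>P. \<forall>y\<in>P. (\<Oplus>k\<in>I. t k x \<otimes> h k y) = (if x = y then \<one> else \<zero>)"
    using dual_families by blast
  have "function_coords E R P V I h t"
  proof (intro function_coords.intro function_coords_axioms.intro cring_axioms)
    show "subring (carrier R) E" using subfieldE(1)[OF subfield_K] by simp
    show "carrier V \<subseteq> P \<rightarrow>\<^sub>E carrier E" by (auto simp: V fixed_functions_def)
    show "\<zero>\<^bsub>V\<^esub> \<in> carrier V" by (auto simp: V fixed_functions_def)
    show "f \<oplus>\<^bsub>V\<^esub> g \<in> carrier V" if "f \<in> carrier V" "g \<in> carrier V" for f g
      using that by (auto simp: V fixed_functions_def PiE_mem)
    show "r \<odot>\<^bsub>V\<^esub> f \<in> carrier V" if "r \<in> carrier R" "f \<in> carrier V" for r f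
      using that K_closed by (auto simp: V fixed_functions_def PiE_mem gal_fix)
  qed (use I V finite_P pairing_in_K in auto)
  then show ?thesis by blast
qed

lemma H_coords: "\<exists>(I :: ('x \<times> nat) set) h t. function_coords E R P H I h t"
  by (rule fixed_module_coords) (simp_all add: descent_simps)

text \<open>Over \<open>E\<close> the group elements are their own dual family. The record varies
  because the comultiplication of \<open>A\<close> is written over \<open>group_ring E M\<close>,
  whereas the descent condition is stated over \<open>A\<close>.\<close>

lemma full_module_coords:
  fixes V :: "('a, 'x \<Rightarrow> 'a, 'v) module_scheme"
  assumes V: "carrier V = P \<rightarrow>\<^sub>E carrier E" "\<zero>\<^bsub>V\<^esub> = (\<lambda>x\<in>P. \<zero>)"
    "\<And>f g. f \<oplus>\<^bsub>V\<^esub> g = (\<lambda>x\<in>P. f x \<oplus> g x)" "\<And>r f. r \<odot>\<^bsub>V\<^esub> f = (\<lambda>x\<in>P. r \<otimes> f x)"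
  shows "function_coords E E P V P (group_basis E M) (group_basis E M)"
proof (intro function_coords.intro function_coords_axioms.intro cring_axioms)
  show "(\<Oplus>k\<in>P. group_basis E M k x \<otimes> group_basis E M k y) = (if x = y then \<one> else \<zero>)"
    if "x \<in> P" "y \<in> P" for x y
  proof -
    have "(\<Oplus>k\<in>P. group_basis E M k x \<otimes> group_basis E M k y)
        = (\<Oplus>k\<in>P. if k = x then if x = y then \<one> else \<zero> else \<zero>)"
      using that by (intro finsum_cong') (auto simp: group_basis_def)
    then show ?thesis using that finite_P by (simp add: finsum_delta)
  qed
  show "pairing P f g \<in> carrier E" if "f \<in> carrier V" "g \<in> carrier V" for f g
    using that by (intro pairing_closed) (auto simp: V)
qed (auto simp: finite_P carrier_is_subring V group_basis_def)

lemma A_coords: "function_coords E E P A P (group_basis E M) (group_basis E M)"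
  by (rule full_module_coords) (simp_all add: group_algebra_simps)

text \<open>All representatives of the comultiplication of \<open>f\<close> in \<open>H\<close>, as
  \<open>comult_H\<close> shows: the diagonal values encode the sum of the f(x) x \<otimes>
  x.\<close>

definition coproducts :: "('x \<Rightarrow> 'a) \<Rightarrow> (('x \<Rightarrow> 'a) \<times> ('x \<Rightarrow> 'a)) multiset set" where
  "coproducts f = {B. set_mset B \<subseteq> fixed_functions \<times> fixed_functions \<and>
     (\<forall>x\<in>P. \<forall>y\<in>P. tensor_value B x y = (if x = y then f x else \<zero>))}"

text \<open>The coefficients of the diagonal function are the sums over x of t_k(x) t_l(x) f(x).
  These are invariant and hence in K, so \<open>tensor_value_surj\<close> applies.\<close>

lemma coproducts_nonempty:
  assumes f: "f \<in> fixed_functions"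
  shows "coproducts f \<noteq> {}"
proof -
  let ?F = "\<lambda>x y. if x = y then f x else \<zero>"
  obtain I :: "('x \<times> nat) set" and h t where "function_coords E R P H I h t" using H_coords by blast
  then interpret H: function_coords E R P H I h t .
  have "H.coefficient ?F k l \<in> carrier R" if "k \<in> I" "l \<in> I" for k l
  proof -
    have tf: "t k \<in> fixed_functions" "t l \<in> fixed_functions"
      using that H.t by (auto simp: descent_simps)
    have "pairing P (t l) (?F x) = t l x \<otimes> f x" if x: "x \<in> P" for x
    proof -
      have "pairing P (t l) (?F x) = (\<Oplus>y\<in>P. if y = x then t l y \<otimes> f y else \<zero>)"
        unfolding pairing_def using x f tf by (intro finsum_cong') auto
      then show ?thesis using x f tf finite_P by (simp add: finsum_delta)
    qed
    then have "H.coefficient ?F k l = (\<Oplus>x\<in>P. t k x \<otimes> (t l x \<otimes> f x))"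
      unfolding H.coefficient_def H.pairing2_def pairing_def[of P "t k"]
      using f tf by (intro finsum_cong') auto
    also have "\<dots> \<in> K"
      using f tf by (intro invariant_sum_in_K) (auto simp: fixed_equivariant)
    finally show ?thesis by simp
  qed
  then obtain B where "B \<in> H.tensors" "\<And>x y. x \<in> P \<Longrightarrow> y \<in> P \<Longrightarrow> tensor_value B x y = ?F x y"
    using f by (auto intro: H.tensor_value_surj[of ?F])
  then show ?thesis by (auto simp: coproducts_def descent_simps)
qed

lemma comult_A:
  assumes f: "f \<in> P \<rightarrow>\<^sub>E carrier E"
  shows "comult A f = {B. set_mset B \<subseteq> carrier A \<times> carrier A \<and>
    (\<forall>x\<in>P. \<forall>y\<in>P. tensor_value B x y = (if x = y then f x else \<zero>))}"
proof -
  let ?A = "group_ring E M"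
  interpret A: function_coords E E P ?A P "group_basis E M" "group_basis E M"
    by (rule full_module_coords) (simp_all add: group_ring_def)
  let ?e = "\<lambda>z. (f z \<odot>\<^bsub>?A\<^esub> group_basis E M z, group_basis E M z)"
  let ?D = "image_mset ?e (mset_set P)"
  have e: "?e z \<in> carrier ?A \<times> carrier ?A" if "z \<in> P" for z
    using that f A.h[OF that] by (auto intro!: A.V_smult_closed)
  have D: "?D \<in> A.tensors" using e finite_P by auto
  have "tensor_value ?D x y = (if x = y then f x else \<zero>)" if xy: "x \<in> P" "y \<in> P" for x y
  proof -
    have "tensor_value ?D x y = msum (\<lambda>z. (f z \<odot>\<^bsub>?A\<^esub> group_basis E M z) x \<otimes> group_basis E M z y) (mset_set P)"
      unfolding tensor_value_def using e xy finite_P by (subst msum_image) (auto intro!: m_closed A.V_closed)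
    also have "\<dots> = (\<Oplus>z\<in>P. (f z \<odot>\<^bsub>?A\<^esub> group_basis E M z) x \<otimes> group_basis E M z y)"
      using e xy finite_P by (intro msum_mset_set) (auto intro!: m_closed A.V_closed)
    also have "\<dots> = (\<Oplus>z\<in>P. if z = x then if x = y then f x else \<zero> else \<zero>)"
      using f xy by (intro finsum_cong') (auto simp: group_ring_def group_basis_def PiE_mem)
    also have "\<dots> = (if x = y then f x else \<zero>)"
      using f xy finite_P by (subst finsum_delta) auto
    finally show ?thesis .
  qed
  moreover have "comult A f = tensor_class E ?A ?A ?D"
    by (simp add: group_algebra_def Let_def)
  moreover have "carrier A = carrier ?A"
    by (simp add: group_algebra_def Let_def)
  ultimately show ?thesis using A.tensor_class_eq[OF D] by auto
qed

text \<open>Existence of the tensor is \<open>coproducts_nonempty\<close>. Uniqueness is the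
  injectivity of the canonical map into the tensor square over E: that map preserves values, and
  values determine the class over K as well as over E.\<close>

lemma comult_H:
  assumes f: "f \<in> fixed_functions"
  shows "comult H f = coproducts f"
proof -
  let ?H = "A\<lparr>carrier := fixed_functions\<rparr>"
  have "\<exists>(I :: ('x \<times> nat) set) h t. function_coords E R P ?H I h t"
    by (rule fixed_module_coords) (simp_all add: group_algebra_simps)
  then obtain I :: "('x \<times> nat) set" and h t where "function_coords E R P ?H I h t" by blast
  then interpret H: function_coords E R P ?H I h t .
  interpret A: function_coords E E P A P "group_basis E M" "group_basis E M" by (rule A_coords)
  have fA: "fixed_functions \<subseteq> carrier A" by (auto simp: fixed_functions_def group_algebra_simps)
  have fP: "f \<in> P \<rightarrow>\<^sub>E carrier E" using f by (auto simp: fixed_functions_def)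
  have id: "image_mset (map_prod (\<lambda>x. x) (\<lambda>x. x)) B = B" for B :: "(('x \<Rightarrow> 'a) \<times> ('x \<Rightarrow> 'a)) multiset"
    by (simp add: map_prod_def)
  have cls: "tensor_class R ?H ?H B = {C. set_mset C \<subseteq> fixed_functions \<times> fixed_functions \<and>
      (\<forall>x\<in>P. \<forall>y\<in>P. tensor_value C x y = tensor_value B x y)}"
    if "set_mset B \<subseteq> fixed_functions \<times> fixed_functions" for B
    using H.tensor_class_eq[of B] that by simp
  have clsA: "tensor_class E A A B = {C. set_mset C \<subseteq> carrier A \<times> carrier A \<and>
      (\<forall>x\<in>P. \<forall>y\<in>P. tensor_value C x y = tensor_value B x y)}"
    if "set_mset B \<subseteq> fixed_functions \<times> fixed_functions" for B
    using A.tensor_class_eq[of B] that fA by auto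
  have "(THE t. t \<in> tensor_product R ?H ?H \<and> tensor_map E A A (\<lambda>x. x) (\<lambda>x. x) t = comult A f) = coproducts f"
  proof (rule the_equality)
    obtain B where B: "B \<in> coproducts f" using coproducts_nonempty[OF f] by blast
    then have B': "set_mset B \<subseteq> fixed_functions \<times> fixed_functions" by (simp add: coproducts_def)
    have "coproducts f = tensor_class R ?H ?H B"
      using B by (subst cls[OF B']) (auto simp: coproducts_def)
    then have "coproducts f \<in> tensor_product R ?H ?H"
      using B' by (auto simp: tensor_product_def)
    moreover have "tensor_class E A A C = comult A f" if "C \<in> coproducts f" for C
      using that by (subst clsA) (auto simp: coproducts_def comult_A[OF fP])
    then have "tensor_map E A A (\<lambda>x. x) (\<lambda>x. x) (coproducts f) = comult A f"
      unfolding tensor_map_def id using B by auto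
    ultimately show "coproducts f \<in> tensor_product R ?H ?H \<and>
        tensor_map E A A (\<lambda>x. x) (\<lambda>x. x) (coproducts f) = comult A f" by simp
  next
    fix t assume t: "t \<in> tensor_product R ?H ?H \<and> tensor_map E A A (\<lambda>x. x) (\<lambda>x. x) t = comult A f"
    then obtain B where B: "set_mset B \<subseteq> fixed_functions \<times> fixed_functions" "t = tensor_class R ?H ?H B"
      by (auto simp: tensor_product_def)
    \<comment> \<open>\<open>tensor_map\<close> unites the classes of all representatives, so
      \<open>B\<close>, regarded over \<open>E\<close>, belongs to the image and has the diagonal
      values.\<close>
    then have "B \<in> t" by (simp add: cls)
    moreover have "B \<in> tensor_class E A A B" using B(1) fA by (subst clsA) auto
    ultimately have "B \<in> comult A f" using t unfolding tensor_map_def id by blast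
    then have "\<forall>x\<in>P. \<forall>y\<in>P. tensor_value B x y = (if x = y then f x else \<zero>)"
      using comult_A[OF fP] by auto
    then show "t = coproducts f" unfolding B(2) by (subst cls[OF B(1)]) (auto simp: coproducts_def)
  qed
  then show ?thesis
    by (simp add: descent_algebra_def descent_comult_def Let_def descent_carrier)
qed

end
section \<open>Isomorphisms of descended Hopf algebras\<close>

locale gal_group_pair = galois E K + D1: gal_group E K M1 s1 + D2: gal_group E K M2 s2
  for E :: "('a, 'r) ring_scheme" (structure) and K
    and M1 :: "('x, 'm) monoid_scheme" and M2 :: "('y, 'n) monoid_scheme" and s1 s2
begin

text \<open>The isomorphism is f \<mapsto> f \<circ> \<pi>^-1, the restriction to fixed functions of
  the E-linear extension of \<pi>. Equivariance makes it preserve fixedness.\<close>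

lemma hopf_iso_of_equivariant_iso:
  assumes iso: "\<pi> \<in> iso M1 M2"
    and eqv: "\<And>\<rho> x. \<rho> \<in> carrier G \<Longrightarrow> x \<in> carrier M1 \<Longrightarrow> \<pi> (s1 \<rho> x) = s2 \<rho> (\<pi> x)"
  shows "hopf_iso D1.R D1.H D2.H \<noteq> {}"
proof -
  define p where "p = inv_into (carrier M1) \<pi>"
  have bij: "bij_betw \<pi> (carrier M1) (carrier M2)" and hom: "\<pi> \<in> hom M1 M2"
    using iso by (auto simp: iso_def)
  have pi_cl [simp]: "\<pi> x \<in> carrier M2" "p (\<pi> x) = x" if "x \<in> carrier M1" for x
    using bij that by (auto simp: p_def bij_betw_def)
  have p_cl [simp]: "p y \<in> carrier M1" "\<pi> (p y) = y" if "y \<in> carrier M2" for y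
    using bij that by (auto simp: p_def bij_betw_def inv_into_into f_inv_into_f)
  have p_bij: "bij_betw p (carrier M2) (carrier M1)"
    by (intro bij_betwI[where g = \<pi>]) auto
  have p_mult: "p (y \<otimes>\<^bsub>M2\<^esub> z) = p y \<otimes>\<^bsub>M1\<^esub> p z" if "y \<in> carrier M2" "z \<in> carrier M2" for y z
    using that hom_mult[OF hom, of "p y" "p z"] pi_cl(2)[of "p y \<otimes>\<^bsub>M1\<^esub> p z"] by simp
  have p_hom: "group_hom M2 M1 p"
    by (intro group_hom.intro group_hom_axioms.intro D1.M.group_axioms D2.M.group_axioms homI)
      (auto simp: p_mult)
  have p_one: "p \<one>\<^bsub>M2\<^esub> = \<one>\<^bsub>M1\<^esub>" using group_hom.hom_one[OF p_hom] .
  have p_inv: "p (inv\<^bsub>M2\<^esub> y) = inv\<^bsub>M1\<^esub> (p y)" if "y \<in> carrier M2" for y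
    using group_hom.hom_inv[OF p_hom that] .
  have p_s: "p (s2 \<rho> y) = s1 \<rho> (p y)" if "\<rho> \<in> carrier G" "y \<in> carrier M2" for \<rho> y
    using that eqv[of \<rho> "p y"] pi_cl(2)[of "s1 \<rho> (p y)"] by simp
  have reindex: "(\<Oplus>v\<in>carrier M1. F v) = (\<Oplus>u\<in>carrier M2. F (p u))"
    if "\<And>v. v \<in> carrier M1 \<Longrightarrow> F v \<in> carrier E" for F
    using finsum_reindex[of F p "carrier M2"] p_bij that by (simp add: bij_betw_def Pi_def)
  define \<Phi> where "\<Phi> f = (\<lambda>y\<in>carrier M2. f (p y))" for f :: "'x \<Rightarrow> 'a"
  have \<Phi>_app [simp]: "\<Phi> f y = f (p y)" if "y \<in> carrier M2" for f y
    using that by (simp add: \<Phi>_def)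
  have \<Phi>_cl: "\<Phi> f \<in> D2.fixed_functions" if f: "f \<in> D1.fixed_functions" for f
    unfolding D2.fixed_functions_def
  proof (intro CollectI conjI ballI)
    show "\<Phi> f \<in> carrier M2 \<rightarrow>\<^sub>E carrier E" using f by (auto simp: \<Phi>_def)
    fix \<rho> y assume "\<rho> \<in> carrier G" "y \<in> carrier M2"
    then show "\<rho> (\<Phi> f y) = \<Phi> f (s2 \<rho> y)"
      using D1.fixed_equivariant[OF f, of \<rho> "p y"] by (simp add: p_s)
  qed
  define \<Psi> where "\<Psi> g = (\<lambda>x\<in>carrier M1. g (\<pi> x))" for g :: "'y \<Rightarrow> 'a"
  have \<Psi>_cl: "\<Psi> g \<in> D1.fixed_functions" if g: "g \<in> D2.fixed_functions" for g
    unfolding D1.fixed_functions_def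
  proof (intro CollectI conjI ballI)
    show "\<Psi> g \<in> carrier M1 \<rightarrow>\<^sub>E carrier E" using g by (auto simp: \<Psi>_def)
    fix \<rho> x assume "\<rho> \<in> carrier G" "x \<in> carrier M1"
    then show "\<rho> (\<Psi> g x) = \<Psi> g (s1 \<rho> x)"
      using D2.fixed_equivariant[OF g, of \<rho> "\<pi> x"] by (simp add: \<Psi>_def eqv)
  qed
  have "bij_betw \<Phi> D1.fixed_functions D2.fixed_functions"
  proof (rule bij_betwI[where g = \<Psi>])
    fix f assume "f \<in> D1.fixed_functions"
    then show "\<Psi> (\<Phi> f) = f"
      by (intro extensionalityI[of _ "carrier M1"] D1.fixed_extensional \<Phi>_cl \<Psi>_cl) (auto simp: \<Psi>_def)
  next
    fix g assume "g \<in> D2.fixed_functions"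
    then show "\<Phi> (\<Psi> g) = g"
      by (intro extensionalityI[of _ "carrier M2"] D2.fixed_extensional \<Phi>_cl \<Psi>_cl) (auto simp: \<Phi>_def \<Psi>_def)
  qed (use \<Phi>_cl \<Psi>_cl in auto)
  moreover have "\<Phi> \<in> ring_hom D1.H D2.H"
  proof (rule ring_hom_memI)
    fix f g assume fg: "f \<in> carrier D1.H" "g \<in> carrier D1.H"
    show "\<Phi> (f \<otimes>\<^bsub>D1.H\<^esub> g) = \<Phi> f \<otimes>\<^bsub>D2.H\<^esub> \<Phi> g"
    proof (rule extensionalityI[of _ "carrier M2"])
      fix y assume y: "y \<in> carrier M2"
      have "\<Phi> (f \<otimes>\<^bsub>D1.H\<^esub> g) y = (\<Oplus>v\<in>carrier M1. f v \<otimes> g (inv\<^bsub>M1\<^esub> v \<otimes>\<^bsub>M1\<^esub> p y))"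
        using y by (simp add: D1.descent_simps)
      also have "\<dots> = (\<Oplus>u\<in>carrier M2. f (p u) \<otimes> g (inv\<^bsub>M1\<^esub> (p u) \<otimes>\<^bsub>M1\<^esub> p y))"
        using fg y by (intro reindex) (auto simp: D1.descent_simps)
      also have "\<dots> = (\<Oplus>u\<in>carrier M2. \<Phi> f u \<otimes> \<Phi> g (inv\<^bsub>M2\<^esub> u \<otimes>\<^bsub>M2\<^esub> y))"
        using fg y by (intro finsum_cong') (auto simp: D1.descent_simps p_mult p_inv)
      finally show "\<Phi> (f \<otimes>\<^bsub>D1.H\<^esub> g) y = (\<Phi> f \<otimes>\<^bsub>D2.H\<^esub> \<Phi> g) y"
        using y by (simp add: D2.descent_simps)
    qed (auto simp: \<Phi>_def D2.descent_simps)
    show "\<Phi> (f \<oplus>\<^bsub>D1.H\<^esub> g) = \<Phi> f \<oplus>\<^bsub>D2.H\<^esub> \<Phi> g"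
      by (rule extensionalityI[of _ "carrier M2"]) (auto simp: \<Phi>_def D1.descent_simps D2.descent_simps)
  next
    show "\<Phi> \<one>\<^bsub>D1.H\<^esub> = \<one>\<^bsub>D2.H\<^esub>"
    proof (rule extensionalityI[of _ "carrier M2"])
      fix y assume y: "y \<in> carrier M2"
      have "p y = \<one>\<^bsub>M1\<^esub> \<longleftrightarrow> y = \<one>\<^bsub>M2\<^esub>" using y p_one p_cl(2) D2.M.one_closed by metis
      then show "\<Phi> \<one>\<^bsub>D1.H\<^esub> y = \<one>\<^bsub>D2.H\<^esub> y"
        using y by (simp add: D1.descent_simps D2.descent_simps group_basis_def)
    qed (auto simp: \<Phi>_def D2.descent_simps group_basis_def)
  qed (use \<Phi>_cl in \<open>auto simp: D1.descent_simps D2.descent_simps\<close>)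
  moreover have "\<Phi> (r \<odot>\<^bsub>D1.H\<^esub> f) = r \<odot>\<^bsub>D2.H\<^esub> \<Phi> f" for r f
    by (rule extensionalityI[of _ "carrier M2"]) (auto simp: \<Phi>_def D1.descent_simps D2.descent_simps)
  moreover have "comult D2.H (\<Phi> f) = tensor_map D1.R D2.H D2.H \<Phi> \<Phi> (comult D1.H f)"
    if f: "f \<in> D1.fixed_functions" for f
  proof -
    obtain I :: "('y \<times> nat) set" and h t where "function_coords E D1.R (carrier M2) D2.H I h t"
      using D2.H_coords by blast
    then interpret C2: function_coords E D1.R "carrier M2" D2.H I h t .
    \<comment> \<open>Values are pulled back along the injective map \<open>p\<close>, so a diagonal
      function stays diagonal. All classes in the union of \<open>tensor_map\<close> therefore
      coincide.\<close>
    have "tensor_class D1.R D2.H D2.H (image_mset (map_prod \<Phi> \<Phi>) B) = D2.coproducts (\<Phi> f)"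
      if B: "B \<in> D1.coproducts f" for B
    proof -
      have B': "fst q \<in> D1.fixed_functions" "snd q \<in> D1.fixed_functions" if "q \<in># B" for q
        using B that by (auto simp: D1.coproducts_def)
      have "tensor_value (image_mset (map_prod \<Phi> \<Phi>) B) y z = (if y = z then \<Phi> f y else \<zero>)"
        if yz: "y \<in> carrier M2" "z \<in> carrier M2" for y z
      proof -
        have "tensor_value (image_mset (map_prod \<Phi> \<Phi>) B) y z = tensor_value B (p y) (p z)"
          unfolding tensor_value_def using B' yz by (subst msum_image) auto
        moreover have "p y = p z \<longleftrightarrow> y = z" using yz p_cl(2) by metis
        ultimately show ?thesis using B yz by (simp add: D1.coproducts_def)
      qed
      moreover have "image_mset (map_prod \<Phi> \<Phi>) B \<in> C2.tensors"
        using B' \<Phi>_cl by (auto simp: D2.descent_simps map_prod_def split_beta)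
      ultimately show ?thesis
        by (subst C2.tensor_class_eq) (auto simp: D2.coproducts_def D2.descent_simps)
    qed
    then show ?thesis
      using D1.coproducts_nonempty[OF f] f \<Phi>_cl[OF f]
      by (auto simp: tensor_map_def D1.comult_H D2.comult_H)
  qed
  moreover have "counit D2.H (\<Phi> f) = counit D1.H f" if f: "f \<in> D1.fixed_functions" for f
  proof -
    have "(\<Oplus>y\<in>carrier M2. \<Phi> f y) = (\<Oplus>y\<in>carrier M2. f (p y))"
      using f by (intro finsum_cong') auto
    then show ?thesis using reindex[of f] f by (simp add: D1.descent_simps D2.descent_simps)
  qed
  moreover have "antipode D2.H (\<Phi> f) = \<Phi> (antipode D1.H f)" for f
    by (rule extensionalityI[of _ "carrier M2"])
      (auto simp: \<Phi>_def D1.descent_simps D2.descent_simps p_inv)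
  ultimately have "\<Phi> \<in> hopf_iso D1.R D1.H D2.H"
    by (simp add: hopf_iso_def ring_iso_def D1.descent_simps(1) D2.descent_simps(1))
  then show ?thesis by blast
qed

text \<open>By duality \<open>\<phi> f y = \<Sum>x. a y x \<sqdot> f x\<close> for a matrix \<open>a\<close> over \<open>E\<close>. Compatibility with the
  comultiplication makes the rows orthogonal idempotents of \<open>E\<^sup>M\<close>, compatibility with the counit
  makes them sum to 1; as \<open>E\<close> is a field, \<open>a\<close> is the matrix of a map \<open>\<pi>\<close>.\<close>

lemma equivariant_iso_of_hopf_iso:
  assumes \<phi>: "\<phi> \<in> hopf_iso D1.R D1.H D2.H" and card: "card (carrier M1) = card (carrier M2)"
  shows "\<exists>\<pi>\<in>iso M1 M2. \<forall>\<rho>\<in>carrier G. \<forall>x\<in>carrier M1. \<pi> (s1 \<rho> x) = s2 \<rho> (\<pi> x)"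
proof -
  obtain I :: "('x \<times> nat) set" and h t where "function_coords E D1.R (carrier M1) D1.H I h t"
    using D1.H_coords by blast
  then interpret C1: function_coords E D1.R "carrier M1" D1.H I h t .
  obtain J :: "('y \<times> nat) set" and h' t' where "function_coords E D1.R (carrier M2) D2.H J h' t'"
    using D2.H_coords by blast
  then interpret C2: function_coords E D1.R "carrier M2" D2.H J h' t' .
  have ring: "\<phi> \<in> ring_hom D1.H D2.H" and bij: "bij_betw \<phi> D1.fixed_functions D2.fixed_functions"
    and smult: "\<And>r f. r \<in> K \<Longrightarrow> f \<in> D1.fixed_functions \<Longrightarrow> \<phi> (r \<odot>\<^bsub>D1.H\<^esub> f) = r \<odot>\<^bsub>D2.H\<^esub> \<phi> f"
    and comult: "\<And>f. f \<in> D1.fixed_functions \<Longrightarrow>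
      comult D2.H (\<phi> f) = tensor_map D1.R D2.H D2.H \<phi> \<phi> (comult D1.H f)"
    and counit: "\<And>f. f \<in> D1.fixed_functions \<Longrightarrow> counit D2.H (\<phi> f) = counit D1.H f"
    using \<phi> by (simp_all add: hopf_iso_def ring_iso_def D1.descent_simps(1) D2.descent_simps(1))
  have cl: "\<phi> f \<in> D2.fixed_functions" if "f \<in> D1.fixed_functions" for f
    using bij that by (auto simp: bij_betw_def)
  have cl' [simp]: "\<phi> f y \<in> carrier E" if "f \<in> D1.fixed_functions" "y \<in> carrier M2" for f y
    using D2.fixed_closed[OF cl] that by simp
  have h: "h k \<in> D1.fixed_functions" "t k \<in> D1.fixed_functions" if "k \<in> I" for k
    using C1.h[OF that] C1.t[OF that] by (simp_all add: D1.descent_simps)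
  have K_zero: "\<zero> \<in> K" using subringE(2)[OF subfieldE(1)[OF subfield_K]] .
  have sum: "\<phi> (C1.fsum S F) y = (\<Oplus>k\<in>S. \<phi> (F k) y)"
    if "finite S" "\<And>k. k \<in> S \<Longrightarrow> F k \<in> D1.fixed_functions" and y: "y \<in> carrier M2"
    for S :: "('x \<times> nat) set" and F y
    using that(1,2)
  proof (induction S)
    case empty
    have z: "\<zero>\<^bsub>D1.H\<^esub> \<in> D1.fixed_functions" using C1.V_zero_closed by (simp add: D1.descent_simps(1))
    \<comment> \<open>\<open>ring_hom\<close> asks for sums, products and one only; that zero is
      preserved is drawn from linearity over K.\<close>
    have "\<phi> \<zero>\<^bsub>D1.H\<^esub> = \<phi> (\<zero> \<odot>\<^bsub>D1.H\<^esub> \<zero>\<^bsub>D1.H\<^esub>)"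
      by (simp add: D1.descent_simps cong: restrict_cong)
    also have "\<dots> = \<zero> \<odot>\<^bsub>D2.H\<^esub> \<phi> \<zero>\<^bsub>D1.H\<^esub>" using smult[OF K_zero z] .
    finally have "\<phi> \<zero>\<^bsub>D1.H\<^esub> y = (\<zero> \<odot>\<^bsub>D2.H\<^esub> \<phi> \<zero>\<^bsub>D1.H\<^esub>) y" by (rule arg_cong)
    also have "\<dots> = \<zero>" using y cl'[OF z y] by (simp add: D2.descent_simps(6))
    finally show ?case by simp
  next
    case (insert k S)
    have F: "F k \<in> carrier D1.H" "C1.fsum S F \<in> carrier D1.H"
      using insert C1.fsum_closed[of S F] by (auto simp: D1.descent_simps(1))
    have "C1.fsum (insert k S) F = F k \<oplus>\<^bsub>D1.H\<^esub> C1.fsum S F"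
      using insert F(2) by (intro C1.fsum_insert) (auto simp: D1.descent_simps(1))
    then have "\<phi> (C1.fsum (insert k S) F) y = \<phi> (F k) y \<oplus> \<phi> (C1.fsum S F) y"
      using ring_hom_memE(3)[OF ring F] y by (simp add: D2.descent_simps(5))
    also have "\<dots> = (\<Oplus>j\<in>insert k S. \<phi> (F j) y)"
      using insert y by (simp add: Pi_def)
    finally show ?case .
  qed
  \<comment> \<open>The entry is the value at \<open>y\<close> of the E-linear extension of \<phi>
    at the indicator of \<open>x\<close>, whose expansion in \<open>h\<close> has the coefficients
    \<open>t k x\<close>.\<close>
  define a where "a y x = (\<Oplus>k\<in>I. t k x \<otimes> \<phi> (h k) y)" for y x
  have a_cl [simp]: "a y x \<in> carrier E" if "y \<in> carrier M2" "x \<in> carrier M1" for y x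
    unfolding a_def using that h by (intro finsum_closed) auto
  have \<phi>_eq: "\<phi> f y = pairing (carrier M1) f (a y)"
    if f: "f \<in> D1.fixed_functions" and y: "y \<in> carrier M2" for f y
  proof -
    have fH: "f \<in> carrier D1.H" using f by (simp add: D1.descent_simps(1))
    have c: "pairing (carrier M1) (t k) f \<in> K" if "k \<in> I" for k
      using D1.pairing_in_K h that f by simp
    have c': "pairing (carrier M1) (t k) f \<in> carrier E" if "k \<in> I" for k
      using c K_closed that by simp
    have "\<phi> f y = \<phi> (C1.fsum I (\<lambda>k. pairing (carrier M1) (t k) f \<odot>\<^bsub>D1.H\<^esub> h k)) y"
      using C1.V_expand[OF fH] by simp
    also have "\<dots> = (\<Oplus>k\<in>I. \<phi> (pairing (carrier M1) (t k) f \<odot>\<^bsub>D1.H\<^esub> h k) y)"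
      using C1.finite_I c h y C1.V_smult_closed
      by (intro sum) (auto simp: D1.descent_simps(1))
    also have "\<dots> = (\<Oplus>k\<in>I. pairing (carrier M1) (t k) f \<otimes> \<phi> (h k) y)"
      using c c' h y by (intro finsum_cong') (auto simp: smult D2.descent_simps(6))
    also have "\<dots> = (\<Oplus>x\<in>carrier M1. f x \<otimes> (\<Oplus>k\<in>I. t k x \<otimes> \<phi> (h k) y))"
      using f h y D1.finite_P C1.finite_I by (intro finsum_pairing) auto
    finally show ?thesis by (simp add: pairing_def a_def)
  qed
  \<comment> \<open>Evaluate \<Delta>(\<phi> f) = (\<phi> \<otimes> \<phi>)(\<Delta> f) at the pair
    of points \<open>y\<close>, \<open>z\<close>. The right side is f paired with the product of two
    rows, the left side is \<phi> f y or 0; \<open>separating\<close> then removes f.\<close>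
  have a_idem: "a y x \<otimes> a z x = (if y = z then a y x else \<zero>)"
    if y: "y \<in> carrier M2" and z: "z \<in> carrier M2" and x: "x \<in> carrier M1" for x y z
  proof (rule C1.separating[of "\<lambda>x. a y x \<otimes> a z x" "\<lambda>x. if y = z then a y x else \<zero>" x])
    fix f assume "f \<in> carrier D1.H"
    then have f: "f \<in> D1.fixed_functions" by (simp add: D1.descent_simps(1))
    obtain B where B: "B \<in> D1.coproducts f" using D1.coproducts_nonempty[OF f] by blast
    then have B1: "B \<in> C1.tensors" by (simp add: D1.coproducts_def D1.descent_simps(1))
    have B': "fst q \<in> D1.fixed_functions" "snd q \<in> D1.fixed_functions" if "q \<in># B" for q
      using B that by (auto simp: D1.coproducts_def)
    let ?B = "image_mset (map_prod \<phi> \<phi>) B"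
    have "?B \<in> C2.tensors"
      using B' cl by (auto simp: D2.descent_simps(1) map_prod_def split_beta)
    then have "?B \<in> tensor_class D1.R D2.H D2.H ?B"
      by (simp add: C2.tensor_class_eq)
    then have "?B \<in> D2.coproducts (\<phi> f)"
      using comult[OF f] B unfolding D1.comult_H[OF f] D2.comult_H[OF cl[OF f]] tensor_map_def by blast
    then have 1: "tensor_value ?B y z = (if y = z then \<phi> f y else \<zero>)"
      using y z by (simp add: D2.coproducts_def)
    have "tensor_value ?B y z = msum (\<lambda>q. \<phi> (fst q) y \<otimes> \<phi> (snd q) z) B"
      unfolding tensor_value_def using B' y z by (subst msum_image) auto
    also have "\<dots> = msum (\<lambda>q. pairing (carrier M1) (a y) (fst q) \<otimes> pairing (carrier M1) (a z) (snd q)) B"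
    proof (rule msum_cong)
      fix q assume q: "q \<in># B"
      show "\<phi> (fst q) y \<otimes> \<phi> (snd q) z \<in> carrier E" using B'[OF q] y z by simp
      have "pairing (carrier M1) (fst q) (a y) = pairing (carrier M1) (a y) (fst q)"
        "pairing (carrier M1) (snd q) (a z) = pairing (carrier M1) (a z) (snd q)"
        using B'[OF q] y z by (auto intro!: pairing_comm)
      then show "\<phi> (fst q) y \<otimes> \<phi> (snd q) z
          = pairing (carrier M1) (a y) (fst q) \<otimes> pairing (carrier M1) (a z) (snd q)"
        using B'[OF q] y z by (simp add: \<phi>_eq)
    qed
    also have "\<dots> = C1.pairing2 (a y) (a z) (tensor_value B)"
      using y z by (intro C1.pairing2_tensor_value[OF B1, symmetric]) auto
    also have "\<dots> = (\<Oplus>x\<in>carrier M1. f x \<otimes> (a y x \<otimes> a z x))"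
      unfolding C1.pairing2_def pairing_def[of _ "a y"]
    proof (intro finsum_cong' Pi_I refl)
      fix x assume x: "x \<in> carrier M1"
      have "pairing (carrier M1) (a z) (tensor_value B x)
          = (\<Oplus>w\<in>carrier M1. if w = x then a z w \<otimes> f w else \<zero>)"
        unfolding pairing_def using B f x z by (intro finsum_cong') (auto simp: D1.coproducts_def)
      also have "\<dots> = a z x \<otimes> f x" using f x z D1.finite_P by (subst finsum_delta) auto
      finally show "a y x \<otimes> pairing (carrier M1) (a z) (tensor_value B x) = f x \<otimes> (a y x \<otimes> a z x)"
        using f x y z by (simp add: m_ac)
    qed (use f y z in auto)
    finally have 2: "pairing (carrier M1) f (\<lambda>x. a y x \<otimes> a z x) = (if y = z then \<phi> f y else \<zero>)"
      using 1 by (simp add: pairing_def)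
    have "pairing (carrier M1) f (\<lambda>x. \<zero>) = \<zero>"
      unfolding pairing_def using f by (intro add.finprod_one_eqI) auto
    then show "pairing (carrier M1) f (\<lambda>x. a y x \<otimes> a z x)
        = pairing (carrier M1) f (\<lambda>x. if y = z then a y x else \<zero>)"
      unfolding 2 using \<phi>_eq[OF f y] by (cases "y = z") auto
  qed (use y z x in auto)
  have a_sum: "(\<Oplus>y\<in>carrier M2. a y x) = \<one>" if x: "x \<in> carrier M1" for x
  proof (rule C1.separating[of "\<lambda>x. \<Oplus>y\<in>carrier M2. a y x" "\<lambda>x. \<one>" x])
    fix f assume "f \<in> carrier D1.H"
    then have f: "f \<in> D1.fixed_functions" by (simp add: D1.descent_simps(1))
    have "pairing (carrier M1) f (\<lambda>x. \<Oplus>y\<in>carrier M2. a y x)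
        = (\<Oplus>x\<in>carrier M1. \<Oplus>y\<in>carrier M2. f x \<otimes> a y x)"
      unfolding pairing_def using f D2.finite_P by (intro finsum_cong') (auto simp: finsum_rdistr)
    also have "\<dots> = (\<Oplus>y\<in>carrier M2. \<Oplus>x\<in>carrier M1. f x \<otimes> a y x)"
      using f D1.finite_P D2.finite_P by (intro finsum_swap) auto
    also have "\<dots> = (\<Oplus>y\<in>carrier M2. \<phi> f y)"
      using f by (intro finsum_cong') (auto simp: \<phi>_eq pairing_def)
    also have "\<dots> = (\<Oplus>x\<in>carrier M1. f x)"
      using counit[OF f] by (simp add: D1.descent_simps(7) D2.descent_simps(7))
    also have "\<dots> = pairing (carrier M1) f (\<lambda>x. \<one>)"
      unfolding pairing_def using f by (intro finsum_cong') auto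
    finally show "pairing (carrier M1) f (\<lambda>x. \<Oplus>y\<in>carrier M2. a y x) = pairing (carrier M1) f (\<lambda>x. \<one>)" .
  qed (use x in auto)
  have "\<exists>y\<in>carrier M2. a y x \<noteq> \<zero>" if x: "x \<in> carrier M1" for x
  proof (rule ccontr)
    assume "\<not> (\<exists>y\<in>carrier M2. a y x \<noteq> \<zero>)"
    then have "(\<Oplus>y\<in>carrier M2. a y x) = \<zero>" by (intro add.finprod_one_eqI) auto
    then show False using a_sum[OF x] one_not_zero by simp
  qed
  then obtain \<pi> where \<pi>: "\<And>x. x \<in> carrier M1 \<Longrightarrow> \<pi> x \<in> carrier M2 \<and> a (\<pi> x) x \<noteq> \<zero>"
    by metis
  have a_eq: "a y x = (if y = \<pi> x then \<one> else \<zero>)" if x: "x \<in> carrier M1" and y: "y \<in> carrier M2" for x y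
  proof (cases "y = \<pi> x")
    case True
    have "a y x \<otimes> a y x = a y x \<otimes> \<one>" using a_idem[OF y y x] x y by simp
    then have "a y x = \<one>"
      using m_lcancel[of "a y x" "a y x" \<one>] \<pi>[OF x] True x y by simp
    then show ?thesis using True by simp
  next
    case False
    then have "a (\<pi> x) x \<otimes> a y x = \<zero>" using a_idem[of "\<pi> x" y x] \<pi>[OF x] x y by simp
    then show ?thesis using integral[of "a (\<pi> x) x" "a y x"] \<pi>[OF x] x y False by simp
  qed
  \<comment> \<open>A point missed by \<pi> has a zero row, so every \<phi> f vanishes there. But
    the constant function 1 is fixed by G and thus of the form \<phi> f. Injectivity then follows
    from equal cardinalities.\<close>
  have "\<pi> ` carrier M1 = carrier M2"
  proof (intro equalityI subsetI)
    fix y assume y: "y \<in> carrier M2"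
    show "y \<in> \<pi> ` carrier M1"
    proof (rule ccontr)
      assume no: "y \<notin> \<pi> ` carrier M1"
      let ?one = "\<lambda>z\<in>carrier M2. \<one>"
      have "?one \<in> D2.fixed_functions"
        unfolding D2.fixed_functions_def by auto
      then obtain f where f: "f \<in> D1.fixed_functions" "?one = \<phi> f"
        using bij by (auto simp: bij_betw_def)
      have "\<phi> f y = \<zero>"
        unfolding \<phi>_eq[OF f(1) y] pairing_def
        using no f y by (intro add.finprod_one_eqI) (auto simp: a_eq)
      moreover have "\<phi> f y = \<one>" using y unfolding f(2)[symmetric] by simp
      ultimately show False using one_not_zero by simp
    qed
  qed (use \<pi> in auto)
  then have \<pi>_bij: "bij_betw \<pi> (carrier M1) (carrier M2)"
    using card D1.finite_P by (auto simp: bij_betw_def intro: eq_card_imp_inj_on)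
  have \<phi>_\<pi>: "\<phi> f (\<pi> x) = f x" if f: "f \<in> D1.fixed_functions" and x: "x \<in> carrier M1" for f x
  proof -
    have "\<phi> f (\<pi> x) = (\<Oplus>w\<in>carrier M1. f w \<otimes> a (\<pi> x) w)"
      using \<phi>_eq[OF f] \<pi>[OF x] by (simp add: pairing_def)
    also have "\<dots> = (\<Oplus>w\<in>carrier M1. if w = x then f w else \<zero>)"
      using f x \<pi> \<pi>_bij by (intro finsum_cong') (auto simp: a_eq bij_betw_def inj_on_def)
    also have "\<dots> = f x" using f x D1.finite_P by (intro finsum_delta) auto
    finally show ?thesis .
  qed
  have points: "x = x'" if "x \<in> carrier M1" "x' \<in> carrier M1"
    and "\<And>f. f \<in> D1.fixed_functions \<Longrightarrow> f x = f x'" for x x'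
    using C1.points_separated[OF that(1,2) one_not_zero] that(3) by (simp add: D1.descent_simps(1))
  define p where "p = inv_into (carrier M1) \<pi>"
  have p [simp]: "p y \<in> carrier M1" "\<pi> (p y) = y" if "y \<in> carrier M2" for y
    using \<pi>_bij that by (auto simp: p_def bij_betw_def inv_into_into f_inv_into_f)
  have \<phi>_p: "\<phi> f y = f (p y)" if "f \<in> D1.fixed_functions" "y \<in> carrier M2" for f y
    using \<phi>_\<pi>[OF that(1), of "p y"] that(2) by simp
  \<comment> \<open>Every fixed f satisfies f(s1 \<rho> x) = \<rho> (f x) = \<rho> (\<phi> f (\<pi>
    x)) = \<phi> f (s2 \<rho> (\<pi> x)), and fixed functions separate points.\<close>
  have "\<pi> (s1 \<rho> x) = s2 \<rho> (\<pi> x)" if r: "\<rho> \<in> carrier G" and x: "x \<in> carrier M1" for \<rho> x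
  proof -
    have s: "s2 \<rho> (\<pi> x) \<in> carrier M2" using r \<pi>[OF x] by simp
    have "s1 \<rho> x = p (s2 \<rho> (\<pi> x))"
    proof (rule points)
      fix f assume f: "f \<in> D1.fixed_functions"
      have "f (s1 \<rho> x) = \<rho> (\<phi> f (\<pi> x))"
        using D1.fixed_equivariant[OF f r x] \<phi>_\<pi>[OF f x] by simp
      also have "\<dots> = f (p (s2 \<rho> (\<pi> x)))"
        using D2.fixed_equivariant[OF cl[OF f] r] \<pi>[OF x] \<phi>_p[OF f s] by simp
      finally show "f (s1 \<rho> x) = f (p (s2 \<rho> (\<pi> x)))" .
    qed (use r x s in auto)
    then show ?thesis using s by simp
  qed
  \<comment> \<open>Compare the convolution of f and g at \<open>p y\<close> with that of their
    images at \<open>y\<close>. Both are pairings of f with a function of u, so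
    \<open>separating\<close> removes f; then g is removed because fixed functions separate points.
    At u = v this determines \<pi> w from \<pi> v and y = \<pi> (v w).\<close>
  moreover have "\<pi> \<in> hom M1 M2"
  proof (rule homI)
    fix v w assume v: "v \<in> carrier M1" and w: "w \<in> carrier M1"
    define y where "y = \<pi> (v \<otimes>\<^bsub>M1\<^esub> w)"
    have y: "y \<in> carrier M2" unfolding y_def using \<pi> v w by simp
    have py: "p y = v \<otimes>\<^bsub>M1\<^esub> w"
      using \<pi>_bij v w by (simp add: y_def p_def bij_betw_def)
    have q: "inv\<^bsub>M2\<^esub> (\<pi> u) \<otimes>\<^bsub>M2\<^esub> y \<in> carrier M2" if "u \<in> carrier M1" for u
      using \<pi>[OF that] y by simp
    have "inv\<^bsub>M1\<^esub> v \<otimes>\<^bsub>M1\<^esub> p y = p (inv\<^bsub>M2\<^esub> (\<pi> v) \<otimes>\<^bsub>M2\<^esub> y)"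
    proof (rule points)
      fix g assume g: "g \<in> D1.fixed_functions"
      show "g (inv\<^bsub>M1\<^esub> v \<otimes>\<^bsub>M1\<^esub> p y) = g (p (inv\<^bsub>M2\<^esub> (\<pi> v) \<otimes>\<^bsub>M2\<^esub> y))"
      proof (rule C1.separating[of "\<lambda>u. g (inv\<^bsub>M1\<^esub> u \<otimes>\<^bsub>M1\<^esub> p y)" "\<lambda>u. g (p (inv\<^bsub>M2\<^esub> (\<pi> u) \<otimes>\<^bsub>M2\<^esub> y))" v])
        fix f assume fH: "f \<in> carrier D1.H"
        then have f: "f \<in> D1.fixed_functions" by (simp add: D1.descent_simps(1))
        have gH: "g \<in> carrier D1.H" using g by (simp add: D1.descent_simps(1))
        have funcset: "(\<lambda>z. \<phi> f z \<otimes> \<phi> g (inv\<^bsub>M2\<^esub> z \<otimes>\<^bsub>M2\<^esub> y)) \<in> \<pi> ` carrier M1 \<rightarrow> carrier E"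
          using f g y \<pi> by auto
        have "pairing (carrier M1) f (\<lambda>u. g (inv\<^bsub>M1\<^esub> u \<otimes>\<^bsub>M1\<^esub> p y)) = (f \<otimes>\<^bsub>D1.H\<^esub> g) (p y)"
          using y by (simp add: pairing_def D1.descent_simps(2))
        also have "\<dots> = \<phi> (f \<otimes>\<^bsub>D1.H\<^esub> g) y"
          using \<phi>_p[OF D1.mult_fixed[OF f g] y] by simp
        also have "\<dots> = (\<Oplus>z\<in>carrier M2. \<phi> f z \<otimes> \<phi> g (inv\<^bsub>M2\<^esub> z \<otimes>\<^bsub>M2\<^esub> y))"
          using ring_hom_memE(2)[OF ring fH gH] y by (simp add: D2.descent_simps(2))
        also have "\<dots> = (\<Oplus>u\<in>carrier M1. \<phi> f (\<pi> u) \<otimes> \<phi> g (inv\<^bsub>M2\<^esub> (\<pi> u) \<otimes>\<^bsub>M2\<^esub> y))"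
          using finsum_reindex[OF funcset] \<pi>_bij by (simp add: bij_betw_def)
        also have "\<dots> = pairing (carrier M1) f (\<lambda>u. g (p (inv\<^bsub>M2\<^esub> (\<pi> u) \<otimes>\<^bsub>M2\<^esub> y)))"
          unfolding pairing_def using f g q by (intro finsum_cong') (auto simp: \<phi>_\<pi> \<phi>_p)
        finally show "pairing (carrier M1) f (\<lambda>u. g (inv\<^bsub>M1\<^esub> u \<otimes>\<^bsub>M1\<^esub> p y))
            = pairing (carrier M1) f (\<lambda>u. g (p (inv\<^bsub>M2\<^esub> (\<pi> u) \<otimes>\<^bsub>M2\<^esub> y)))" .
      qed (use g y v q in auto)
    qed (use v y q in auto)
    moreover have "inv\<^bsub>M1\<^esub> v \<otimes>\<^bsub>M1\<^esub> p y = w"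
      using v w by (simp add: py D1.M.m_assoc[symmetric])
    ultimately have "\<pi> w = inv\<^bsub>M2\<^esub> (\<pi> v) \<otimes>\<^bsub>M2\<^esub> y" using q[OF v] by simp
    then show "\<pi> (v \<otimes>\<^bsub>M1\<^esub> w) = \<pi> v \<otimes>\<^bsub>M2\<^esub> \<pi> w"
      using \<pi>[OF v] y by (simp add: y_def[symmetric] D2.M.m_assoc[symmetric])
  qed (use \<pi> in auto)
  ultimately show ?thesis using \<pi>_bij by (auto simp: iso_def)
qed

end
section \<open>Regular embeddings and Byott's correspondence\<close>

lemma (in group) normalizer_conj:
  assumes "H \<subseteq> carrier G" "g \<in> normalizer G H" "x \<in> H"
  shows "g \<otimes> x \<otimes> inv g \<in> H"
proof -
  have "g <# H #> inv g = H" using assms by (simp add: normalizer_def stabilizer_def)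
  then show ?thesis using assms(3) by (auto simp: l_coset_def r_coset_def)
qed

lemma (in group) normalizerI:
  assumes "H \<subseteq> carrier G" "g \<in> carrier G" "(\<lambda>x. g \<otimes> x \<otimes> inv g) ` H = H"
  shows "g \<in> normalizer G H"
proof -
  have "g <# H #> inv g = (\<lambda>x. g \<otimes> x \<otimes> inv g) ` H" by (auto simp: l_coset_def r_coset_def)
  then show ?thesis using assms by (simp add: normalizer_def stabilizer_def)
qed

lemma BijGroup_mult: "f \<in> Bij S \<Longrightarrow> g \<in> Bij S \<Longrightarrow> f \<otimes>\<^bsub>BijGroup S\<^esub> g = compose S f g"
  by (simp add: BijGroup_def)

lemma BijGroup_carrier: "carrier (BijGroup S) = Bij S"
  by (simp add: BijGroup_def)

lemma BijGroup_one: "\<one>\<^bsub>BijGroup S\<^esub> = (\<lambda>x\<in>S. x)"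
  by (simp add: BijGroup_def)

locale regular_embedding = galois E K + N: group N
  for E :: "('a, 'r) ring_scheme" (structure) and K and N :: "('n, 'm) monoid_scheme" +
  fixes L :: "'a set" and \<alpha> :: "'n \<Rightarrow> ('a \<Rightarrow> 'a) set \<Rightarrow> ('a \<Rightarrow> 'a) set"
  assumes L: "K \<subseteq> L" "L \<subseteq> carrier E"
    and finite_N: "finite (carrier N)"
    and \<alpha>_hom: "\<alpha> \<in> hom N (BijGroup (coset_space E K L))"
    and \<alpha>_inj: "inj_on \<alpha> (carrier N)"
    and regular: "regular_subgroup (coset_space E K L) (\<alpha> ` carrier N)"
    and normalized: "coset_perm E K L ` carrier (gal E K)
           \<subseteq> normalizer (BijGroup (coset_space E K L)) (\<alpha> ` carrier N)"
begin

abbreviation "Y \<equiv> coset_space E K L"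
abbreviation "B \<equiv> BijGroup Y"
abbreviation "P \<equiv> \<alpha> ` carrier N"
abbreviation "M \<equiv> B\<lparr>carrier := P\<rparr>"
abbreviation "c \<equiv> coset_perm E K L"
abbreviation "star \<equiv> star_action E K L"

sublocale B: group B by (rule group_BijGroup)

lemma subgroup_P: "subgroup P B"
  using regular by (simp add: regular_subgroup_def)

sublocale M: group M
  using subgroup.subgroup_is_group[OF subgroup_P group_BijGroup] .

lemma P_subset: "P \<subseteq> carrier B"
  using subgroup.subset[OF subgroup_P] .

lemma \<alpha>_Bij [simp]: "x \<in> carrier N \<Longrightarrow> \<alpha> x \<in> Bij Y"
  using P_subset by (auto simp: BijGroup_carrier)

lemma gal_L_subset: "carrier (gal E L) \<subseteq> carrier G"
  using L by (auto simp: gal_carrier)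

lemma X_subset: "y \<in> Y \<Longrightarrow> y \<subseteq> carrier G"
  using gal_L_subset G.l_coset_subset_G by (auto simp: coset_space_def LCOSETS_def)

lemma coset_closed: "\<rho> \<in> carrier G \<Longrightarrow> y \<in> Y \<Longrightarrow> \<rho> <#\<^bsub>G\<^esub> y \<in> Y"
  using gal_L_subset by (auto simp: coset_space_def LCOSETS_def G.lcos_m_assoc)

lemma base_in_X: "base_coset E K L \<in> Y"
  by (auto simp: base_coset_def coset_space_def LCOSETS_def)

lemma c_normal: "\<rho> \<in> carrier G \<Longrightarrow> c \<rho> \<in> normalizer B P"
  using normalized by auto

lemma c_Bij [simp]: "\<rho> \<in> carrier G \<Longrightarrow> c \<rho> \<in> Bij Y"
  using c_normal by (auto simp: normalizer_def stabilizer_def BijGroup_carrier)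

lemma c_mult:
  assumes "\<rho> \<in> carrier G" "\<tau> \<in> carrier G"
  shows "c (\<rho> \<otimes>\<^bsub>G\<^esub> \<tau>) = c \<rho> \<otimes>\<^bsub>B\<^esub> c \<tau>"
proof -
  have "c (\<rho> \<otimes>\<^bsub>G\<^esub> \<tau>) = compose Y (c \<rho>) (c \<tau>)"
    using assms X_subset coset_closed
    by (intro extensionalityI[of _ Y]) (auto simp: coset_perm_def compose_def G.lcos_m_assoc)
  then show ?thesis using assms by (simp add: BijGroup_mult)
qed

lemma c_one: "c \<one>\<^bsub>G\<^esub> = \<one>\<^bsub>B\<^esub>"
  using X_subset by (intro extensionalityI[of _ Y]) (auto simp: coset_perm_def BijGroup_one G.lcos_mult_one)

lemma star_closed: "\<rho> \<in> carrier G \<Longrightarrow> \<eta> \<in> P \<Longrightarrow> star \<rho> \<eta> \<in> P"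
  unfolding star_action_def using B.normalizer_conj[OF P_subset c_normal] by blast

lemma star_mult_left:
  assumes "\<rho> \<in> carrier G" "\<tau> \<in> carrier G" "\<eta> \<in> P"
  shows "star (\<rho> \<otimes>\<^bsub>G\<^esub> \<tau>) \<eta> = star \<rho> (star \<tau> \<eta>)"
proof -
  have "c \<rho> \<in> carrier B" "c \<tau> \<in> carrier B" "\<eta> \<in> carrier B"
    using assms P_subset by (auto simp: BijGroup_carrier)
  then show ?thesis
    using assms by (simp add: star_action_def c_mult B.inv_mult_group B.m_assoc)
qed

lemma star_hom:
  assumes "\<rho> \<in> carrier G" "\<eta> \<in> P" "\<theta> \<in> P"
  shows "star \<rho> (\<eta> \<otimes>\<^bsub>B\<^esub> \<theta>) = star \<rho> \<eta> \<otimes>\<^bsub>B\<^esub> star \<rho> \<theta>"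
proof -
  have 1: "c \<rho> \<in> carrier B" "\<eta> \<in> carrier B" "\<theta> \<in> carrier B"
    using assms P_subset by (auto simp: BijGroup_carrier)
  then have "inv\<^bsub>B\<^esub> (c \<rho>) \<otimes>\<^bsub>B\<^esub> (c \<rho> \<otimes>\<^bsub>B\<^esub> z) = z" if "z \<in> carrier B" for z
    using that by (simp add: B.m_assoc[symmetric])
  then show ?thesis using 1 by (simp add: star_action_def B.m_assoc)
qed

sublocale D: gal_group E K M star
proof unfold_locales
  show "finite (carrier M)" using finite_N by simp
  fix \<eta> assume "\<eta> \<in> carrier M"
  then show "star \<one>\<^bsub>G\<^esub> \<eta> = \<eta>" using P_subset by (auto simp: star_action_def c_one)
qed (auto simp: star_closed star_mult_left star_hom)

text \<open>Substituting \<open>star \<rho> x\<close> for the argument removes the inverse from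
  \<open>gal_action\<close>; apart from this form of the fixed-point condition the two constructions
  agree.\<close>

lemma fixed_hopf_algebra_eq: "fixed_hopf_algebra E K L P = D.H"
proof -
  let ?A = "group_algebra E M"
  have "gal_action E K L P \<rho> f = f \<longleftrightarrow> (\<forall>x\<in>P. \<rho> (f x) = f (star \<rho> x))"
    if r: "\<rho> \<in> carrier G" and f: "f \<in> P \<rightarrow>\<^sub>E carrier E" for \<rho> f
  proof
    assume eq: "gal_action E K L P \<rho> f = f"
    show "\<forall>x\<in>P. \<rho> (f x) = f (star \<rho> x)"
    proof
      fix x assume x: "x \<in> P"
      have "gal_action E K L P \<rho> f (star \<rho> x) = \<rho> (f (star (inv\<^bsub>G\<^esub> \<rho>) (star \<rho> x)))"
        using star_closed[OF r x] by (simp add: gal_action_def)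
      then show "\<rho> (f x) = f (star \<rho> x)"
        using eq D.s_inv_cancel(2)[OF r, of x] x by simp
    qed
  next
    assume eq: "\<forall>x\<in>P. \<rho> (f x) = f (star \<rho> x)"
    show "gal_action E K L P \<rho> f = f"
    proof (rule extensionalityI[of _ P])
      fix x assume x: "x \<in> P"
      have "\<rho> (f (star (inv\<^bsub>G\<^esub> \<rho>) x)) = f (star \<rho> (star (inv\<^bsub>G\<^esub> \<rho>) x))"
        using eq star_closed[OF G.inv_closed[OF r] x] by blast
      then show "gal_action E K L P \<rho> f x = f x"
        using D.s_inv_cancel(1)[OF r, of x] x by (simp add: gal_action_def)
    qed (use f in \<open>auto simp: gal_action_def PiE_def\<close>)
  qed
  then have "{f \<in> carrier ?A. \<forall>\<rho>\<in>carrier G. gal_action E K L P \<rho> f = f} = descent_carrier E K M star"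
    unfolding descent_carrier_def group_algebra_simps partial_object.simps by auto
  then show ?thesis
    by (simp only: fixed_hopf_algebra_def perm_group_algebra_def descent_algebra_def
        descent_comult_def[abs_def] Let_def)
qed

lemma \<alpha>_iso: "\<alpha> \<in> iso N M"
  using \<alpha>_hom \<alpha>_inj by (auto simp: iso_def hom_def bij_betw_def)

text \<open>The action of the Galois group on \<open>\<alpha>(N)\<close>, transported to \<open>N\<close>.\<close>

definition twist :: "('a \<Rightarrow> 'a) \<Rightarrow> 'n \<Rightarrow> 'n" where
  "twist \<rho> = (\<lambda>x\<in>carrier N. inv_into (carrier N) \<alpha> (star \<rho> (\<alpha> x)))"

lemma twist:
  assumes "\<rho> \<in> carrier G" "x \<in> carrier N"
  shows "twist \<rho> x \<in> carrier N" "\<alpha> (twist \<rho> x) = star \<rho> (\<alpha> x)"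
proof -
  have "star \<rho> (\<alpha> x) \<in> P" using assms star_closed by auto
  then show "twist \<rho> x \<in> carrier N" "\<alpha> (twist \<rho> x) = star \<rho> (\<alpha> x)"
    using assms(2) by (auto simp: twist_def inv_into_into f_inv_into_f)
qed

lemma \<alpha>_mult: "x \<in> carrier N \<Longrightarrow> y \<in> carrier N \<Longrightarrow> \<alpha> (x \<otimes>\<^bsub>N\<^esub> y) = \<alpha> x \<otimes>\<^bsub>B\<^esub> \<alpha> y"
  using hom_mult[OF \<alpha>_hom] .

lemma twist_auto:
  assumes r: "\<rho> \<in> carrier G"
  shows "twist \<rho> \<in> auto N"
proof -
  have "twist \<rho> (x \<otimes>\<^bsub>N\<^esub> y) = twist \<rho> x \<otimes>\<^bsub>N\<^esub> twist \<rho> y" if "x \<in> carrier N" "y \<in> carrier N" for x y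
    using that r twist[OF r] star_hom[OF r]
    by (intro inj_onD[OF \<alpha>_inj]) (auto simp: \<alpha>_mult)
  then have "twist \<rho> \<in> hom N N" using twist[OF r] by (intro homI) auto
  moreover have "bij_betw (twist \<rho>) (carrier N) (carrier N)"
  proof -
    have inv: "twist \<rho> (twist \<tau> x) = x" if "\<rho> \<in> carrier G" "\<tau> \<in> carrier G" "\<rho> \<otimes>\<^bsub>G\<^esub> \<tau> = \<one>\<^bsub>G\<^esub>" "x \<in> carrier N" for \<rho> \<tau> x
      using that twist[of \<tau> x] twist[of \<rho> "twist \<tau> x"] star_mult_left[of \<rho> \<tau> "\<alpha> x"] D.s_one[of "\<alpha> x"]
      by (intro inj_onD[OF \<alpha>_inj]) auto
    show ?thesis
      using r twist inv[of "inv\<^bsub>G\<^esub> \<rho>" \<rho>] inv[of \<rho> "inv\<^bsub>G\<^esub> \<rho>"]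
      by (intro bij_betwI[where g = "twist (inv\<^bsub>G\<^esub> \<rho>)"]) auto
  qed
  ultimately show ?thesis by (auto simp: auto_def Bij_def twist_def)
qed

section \<open>Byott's bijection a and the automorphism component of his embedding\<close>

definition base_map :: "'n \<Rightarrow> ('a \<Rightarrow> 'a) set" where
  "base_map x = \<alpha> x (base_coset E K L)"

lemma base_map_bij: "bij_betw base_map (carrier N) Y"
proof -
  have cl: "base_map ` carrier N \<subseteq> Y"
    using base_in_X \<alpha>_Bij Bij_imp_funcset unfolding base_map_def by fastforce
  have "\<exists>p\<in>P. p (base_coset E K L) = y" if "y \<in> Y" for y
    using regular base_in_X that by (auto simp: regular_subgroup_def)
  then have "base_map ` carrier N = Y" using cl unfolding base_map_def by fastforce
  moreover have "card Y = card (carrier N)"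
    using regular card_image[OF \<alpha>_inj] by (simp add: regular_subgroup_def)
  ultimately show ?thesis
    using finite_N by (auto simp: bij_betw_def intro: eq_card_imp_inj_on)
qed

lemma star_apply:
  assumes r: "\<rho> \<in> carrier G" and x: "x \<in> carrier N" and y: "y \<in> Y"
  shows "star \<rho> (\<alpha> x) (c \<rho> y) = c \<rho> (\<alpha> x y)"
proof -
  have *: "c \<rho> \<in> carrier B" "\<alpha> x \<in> carrier B" using r x by (auto simp: BijGroup_carrier)
  then have "star \<rho> (\<alpha> x) \<otimes>\<^bsub>B\<^esub> c \<rho> = c \<rho> \<otimes>\<^bsub>B\<^esub> \<alpha> x"
    by (simp add: star_action_def B.m_assoc)
  moreover have "star \<rho> (\<alpha> x) \<in> Bij Y"
    using * B.m_closed by (simp add: star_action_def flip: BijGroup_carrier)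
  ultimately have "compose Y (star \<rho> (\<alpha> x)) (c \<rho>) = compose Y (c \<rho>) (\<alpha> x)"
    using r x by (simp add: BijGroup_mult)
  then show ?thesis using y by (metis compose_eq)
qed

text \<open>By \<open>star_apply\<close>, moving \<open>c \<rho>\<close> past
  \<open>\<alpha> x\<close> turns it into \<open>\<alpha> (twist \<rho> x)\<close>, while left
  multiplication by an element of \<open>N\<close> corresponds under \<open>base_map\<close> to the
  action of its image under \<alpha>.\<close>

lemma byott_eq:
  assumes r: "\<rho> \<in> carrier G"
  shows "byott E K L N \<alpha> \<rho> \<in> Bij (carrier N)"
    and "x \<in> carrier N \<Longrightarrow> byott E K L N \<alpha> \<rho> x = twist \<rho> x \<otimes>\<^bsub>N\<^esub> byott E K L N \<alpha> \<rho> \<one>\<^bsub>N\<^esub>"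
proof -
  let ?h = "byott E K L N \<alpha> \<rho>"
  have h: "?h = (\<lambda>x\<in>carrier N. inv_into (carrier N) base_map (c \<rho> (base_map x)))"
    by (simp add: byott_def Let_def base_map_def[abs_def])
  have cb: "bij_betw (c \<rho>) Y Y" using c_Bij[OF r] by (simp add: Bij_def)
  have "bij_betw (inv_into (carrier N) base_map \<circ> (c \<rho> \<circ> base_map)) (carrier N) (carrier N)"
    by (intro bij_betw_trans[OF bij_betw_trans[OF base_map_bij cb]] bij_betw_inv_into base_map_bij)
  then have "bij_betw ?h (carrier N) (carrier N)"
    by (rule bij_betw_cong[THEN iffD1, rotated]) (simp add: h)
  then show Bij: "?h \<in> Bij (carrier N)" by (simp add: Bij_def h)
  have bm: "base_map x \<in> Y" if "x \<in> carrier N" for x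
    using base_map_bij that by (auto simp: bij_betw_def)
  have hx: "?h x \<in> carrier N" "base_map (?h x) = c \<rho> (base_map x)" if "x \<in> carrier N" for x
  proof -
    have "c \<rho> (base_map x) \<in> base_map ` carrier N"
      using base_map_bij cb bm[OF that] by (auto simp: bij_betw_def)
    then show "?h x \<in> carrier N" "base_map (?h x) = c \<rho> (base_map x)"
      using that by (auto simp: h inv_into_into f_inv_into_f)
  qed
  have base_mult: "base_map (x \<otimes>\<^bsub>N\<^esub> y) = \<alpha> x (base_map y)" if "x \<in> carrier N" "y \<in> carrier N" for x y
    using that base_in_X by (simp add: base_map_def \<alpha>_mult BijGroup_mult compose_def)
  assume x: "x \<in> carrier N"
  have "base_map (twist \<rho> x \<otimes>\<^bsub>N\<^esub> ?h \<one>\<^bsub>N\<^esub>) = star \<rho> (\<alpha> x) (c \<rho> (base_map \<one>\<^bsub>N\<^esub>))"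
    using twist[OF r x] hx by (simp add: base_mult)
  also have "\<dots> = c \<rho> (base_map (x \<otimes>\<^bsub>N\<^esub> \<one>\<^bsub>N\<^esub>))"
    using star_apply[OF r x bm] x by (simp only: base_mult N.one_closed)
  also have "\<dots> = base_map (?h x)" using hx x by simp
  finally have "base_map (?h x) = base_map (twist \<rho> x \<otimes>\<^bsub>N\<^esub> ?h \<one>\<^bsub>N\<^esub>)" ..
  then show "?h x = twist \<rho> x \<otimes>\<^bsub>N\<^esub> ?h \<one>\<^bsub>N\<^esub>"
    using x hx(1) twist(1)[OF r x] by (intro inj_onD[OF bij_betw_imp_inj_on[OF base_map_bij]]) auto
qed

text \<open>By \<open>byott_eq\<close> the map is an automorphism followed by a right translation.
  Right translations commute with left ones, so conjugation sends left translation by \<eta> to left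
  translation by \<open>twist \<rho> \<eta>\<close>. Membership matters because
  \<open>hol_aut\<close> is restricted to the holomorph.\<close>

lemma byott_holomorph:
  assumes r: "\<rho> \<in> carrier G"
  shows "byott E K L N \<alpha> \<rho> \<in> holomorph N"
proof -
  let ?h = "byott E K L N \<alpha> \<rho>" and ?B = "BijGroup (carrier N)"
  let ?l = "\<lambda>\<eta>. \<lambda>x\<in>carrier N. \<eta> \<otimes>\<^bsub>N\<^esub> x"
  interpret BN: group ?B by (rule group_BijGroup)
  have l: "?l \<eta> \<in> Bij (carrier N)" if "\<eta> \<in> carrier N" for \<eta>
  proof -
    have "bij_betw (?l \<eta>) (carrier N) (carrier N)"
      using that by (intro bij_betwI[where g = "\<lambda>x. inv\<^bsub>N\<^esub> \<eta> \<otimes>\<^bsub>N\<^esub> x"]) (auto simp: N.m_assoc[symmetric])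
    then show ?thesis by (simp add: Bij_def)
  qed
  have hB: "?h \<in> Bij (carrier N)" using byott_eq(1)[OF r] .
  then have h_cl: "?h x \<in> carrier N" if "x \<in> carrier N" for x
    using Bij_imp_funcset that by blast
  have conj: "?h \<otimes>\<^bsub>?B\<^esub> ?l \<eta> \<otimes>\<^bsub>?B\<^esub> inv\<^bsub>?B\<^esub> ?h = ?l (twist \<rho> \<eta>)" if e: "\<eta> \<in> carrier N" for \<eta>
  proof -
    have te: "twist \<rho> \<eta> \<in> carrier N" using twist[OF r e] by simp
    have "compose (carrier N) ?h (?l \<eta>) x = compose (carrier N) (?l (twist \<rho> \<eta>)) ?h x"
      if x: "x \<in> carrier N" for x
    proof -
      have "twist \<rho> (\<eta> \<otimes>\<^bsub>N\<^esub> x) = twist \<rho> \<eta> \<otimes>\<^bsub>N\<^esub> twist \<rho> x"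
        using twist_auto[OF r] e x by (auto simp: auto_def hom_def)
      then show ?thesis
        using byott_eq(2)[OF r, of "\<eta> \<otimes>\<^bsub>N\<^esub> x"] byott_eq(2)[OF r x] e x te twist(1)[OF r x] h_cl
        by (simp add: compose_eq N.m_assoc)
    qed
    then have "compose (carrier N) ?h (?l \<eta>) = compose (carrier N) (?l (twist \<rho> \<eta>)) ?h"
      by (intro extensionalityI[of _ "carrier N"]) (auto simp: compose_def)
    then have "?h \<otimes>\<^bsub>?B\<^esub> ?l \<eta> = ?l (twist \<rho> \<eta>) \<otimes>\<^bsub>?B\<^esub> ?h"
      using BijGroup_mult[OF hB l[OF e]] BijGroup_mult[OF l[OF te] hB] by simp
    moreover have "?h \<in> carrier ?B" "?l (twist \<rho> \<eta>) \<in> carrier ?B"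
      using hB l[OF te] by (simp_all add: BijGroup_carrier)
    ultimately show ?thesis by (simp add: BN.m_assoc)
  qed
  have "(\<lambda>g. ?h \<otimes>\<^bsub>?B\<^esub> g \<otimes>\<^bsub>?B\<^esub> inv\<^bsub>?B\<^esub> ?h) ` ?l ` carrier N = (\<lambda>\<eta>. ?l (twist \<rho> \<eta>)) ` carrier N"
    unfolding image_image using conj by (rule image_cong[OF HOL.refl])
  also have "\<dots> = ?l ` twist \<rho> ` carrier N"
    by (simp only: image_image)
  also have "twist \<rho> ` carrier N = carrier N"
    using twist_auto[OF r] by (simp add: auto_def Bij_def bij_betw_def)
  finally have "(\<lambda>g. ?h \<otimes>\<^bsub>?B\<^esub> g \<otimes>\<^bsub>?B\<^esub> inv\<^bsub>?B\<^esub> ?h) ` ?l ` carrier N = ?l ` carrier N" .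
  then show ?thesis
    unfolding holomorph_def using hB l
    by (intro BN.normalizerI) (auto simp: BijGroup_carrier)
qed

text \<open>\<open>byott_eq\<close> is a decomposition of the required form. It is the only one:
  automorphisms fix 1, so evaluation at 1 recovers the translation part, and cancelling it recovers
  the automorphism.\<close>

lemma byott_aut_eq:
  assumes r: "\<rho> \<in> carrier G"
  shows "byott_aut E K L N \<alpha> \<rho> = twist \<rho>"
proof -
  let ?h = "byott E K L N \<alpha> \<rho>"
  let ?r = "\<lambda>m. \<lambda>x\<in>carrier N. x \<otimes>\<^bsub>N\<^esub> m"
  have h1: "?h \<one>\<^bsub>N\<^esub> \<in> carrier N"
    using Bij_imp_funcset[OF byott_eq(1)[OF r]] by auto
  have "(THE \<mu>. \<mu> \<in> auto N \<and> (\<exists>m\<in>carrier N. ?h = compose (carrier N) (?r m) \<mu>)) = twist \<rho>"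
  proof (rule the_equality)
    have "?h = compose (carrier N) (?r (?h \<one>\<^bsub>N\<^esub>)) (twist \<rho>)"
    proof (rule extensionalityI[of _ "carrier N"])
      fix x assume x: "x \<in> carrier N"
      have "compose (carrier N) (?r (?h \<one>\<^bsub>N\<^esub>)) (twist \<rho>) x = twist \<rho> x \<otimes>\<^bsub>N\<^esub> ?h \<one>\<^bsub>N\<^esub>"
        using x twist(1)[OF r x] by (simp add: compose_eq)
      then show "?h x = compose (carrier N) (?r (?h \<one>\<^bsub>N\<^esub>)) (twist \<rho>) x"
        unfolding byott_eq(2)[OF r x] by (rule HOL.sym)
    qed (auto simp: byott_def Let_def compose_def)
    then show "twist \<rho> \<in> auto N \<and> (\<exists>m\<in>carrier N. ?h = compose (carrier N) (?r m) (twist \<rho>))"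
      using twist_auto[OF r] h1 by blast
  next
    fix \<mu> assume "\<mu> \<in> auto N \<and> (\<exists>m\<in>carrier N. ?h = compose (carrier N) (?r m) \<mu>)"
    then obtain m where \<mu>: "\<mu> \<in> auto N" and m: "m \<in> carrier N" and eq: "?h = compose (carrier N) (?r m) \<mu>"
      by blast
    have hom: "\<mu> \<in> hom N N" using \<mu> by (simp add: auto_def)
    have cl: "\<mu> x \<in> carrier N" if "x \<in> carrier N" for x
      using hom that by (auto simp: hom_def)
    have hx: "?h x = \<mu> x \<otimes>\<^bsub>N\<^esub> m" if "x \<in> carrier N" for x
      unfolding eq using that cl by (simp add: compose_eq)
    have "\<mu> \<one>\<^bsub>N\<^esub> = \<one>\<^bsub>N\<^esub>" using hom_one[OF hom N.group_axioms N.group_axioms] .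
    then have "?h \<one>\<^bsub>N\<^esub> = m" using hx[OF N.one_closed] m by simp
    then have "\<mu> x = twist \<rho> x" if "x \<in> carrier N" for x
      using hx[OF that] byott_eq(2)[OF r that] that m cl twist(1)[OF r that] by simp
    then show "\<mu> = twist \<rho>"
      using \<mu> by (intro extensionalityI[of _ "carrier N"]) (auto simp: auto_def Bij_def twist_def)
  qed
  then show ?thesis
    using byott_holomorph[OF r] by (simp add: byott_aut_def hol_aut_def)
qed

end

section \<open>Comparison of two embeddings of the same group N\<close>

locale regular_embedding_pair =
  galois E K + A1: regular_embedding E K N L \<alpha>1 + A2: regular_embedding E K N L \<alpha>2
  for E :: "('a, 'r) ring_scheme" (structure) and K L and N :: "('n, 'm) monoid_scheme" and \<alpha>1 \<alpha>2
begin

lemma twist_conj_iff: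
  assumes \<mu>: "\<mu> \<in> auto N" and r: "\<rho> \<in> carrier G"
  shows "A2.twist \<rho> = \<mu> \<otimes>\<^bsub>AutoGroup N\<^esub> A1.twist \<rho> \<otimes>\<^bsub>AutoGroup N\<^esub> inv\<^bsub>AutoGroup N\<^esub> \<mu> \<longleftrightarrow>
    (\<forall>x\<in>carrier N. A2.twist \<rho> (\<mu> x) = \<mu> (A1.twist \<rho> x))"
proof -
  interpret Aut: group "AutoGroup N" by (rule A1.N.AutoGroup)
  have t: "\<mu> \<in> carrier (AutoGroup N)" "A1.twist \<rho> \<in> carrier (AutoGroup N)" "A2.twist \<rho> \<in> carrier (AutoGroup N)"
    using \<mu> A1.twist_auto[OF r] A2.twist_auto[OF r] by (simp_all add: AutoGroup_def)
  have mult: "f \<otimes>\<^bsub>AutoGroup N\<^esub> g = compose (carrier N) f g"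
    if "f \<in> carrier (AutoGroup N)" "g \<in> carrier (AutoGroup N)" for f g
    using that by (simp add: AutoGroup_def auto_def BijGroup_mult)
  have "A2.twist \<rho> = \<mu> \<otimes>\<^bsub>AutoGroup N\<^esub> A1.twist \<rho> \<otimes>\<^bsub>AutoGroup N\<^esub> inv\<^bsub>AutoGroup N\<^esub> \<mu> \<longleftrightarrow>
      \<mu> \<otimes>\<^bsub>AutoGroup N\<^esub> A1.twist \<rho> = A2.twist \<rho> \<otimes>\<^bsub>AutoGroup N\<^esub> \<mu>"
    using t by (intro Aut.inv_solve_right) auto
  also have "\<dots> \<longleftrightarrow> compose (carrier N) \<mu> (A1.twist \<rho>) = compose (carrier N) (A2.twist \<rho>) \<mu>"
    using t by (simp add: mult)
  also have "\<dots> \<longleftrightarrow> (\<forall>x\<in>carrier N. A2.twist \<rho> (\<mu> x) = \<mu> (A1.twist \<rho> x))"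
    by (auto simp: compose_def fun_eq_iff restrict_def)
  finally show ?thesis .
qed

text \<open>The two sides correspond through \<mu> = \<alpha>2^-1 \<circ> \<pi> \<circ> \<alpha>1,
  since each \<open>twist\<close> is the conjugation action pulled back along the respective
  embedding.\<close>

lemma equivariant_iso_iff:
  "(\<exists>\<pi>\<in>iso A1.M A2.M. \<forall>\<rho>\<in>carrier G. \<forall>x\<in>carrier A1.M. \<pi> (A1.star \<rho> x) = A2.star \<rho> (\<pi> x)) \<longleftrightarrow>
   (\<exists>\<mu>\<in>auto N. \<forall>\<rho>\<in>carrier G. \<forall>x\<in>carrier N. A2.twist \<rho> (\<mu> x) = \<mu> (A1.twist \<rho> x))"
proof
  assume "\<exists>\<pi>\<in>iso A1.M A2.M. \<forall>\<rho>\<in>carrier G. \<forall>x\<in>carrier A1.M. \<pi> (A1.star \<rho> x) = A2.star \<rho> (\<pi> x)"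
  then obtain \<pi> where \<pi>: "\<pi> \<in> iso A1.M A2.M"
    and eqv: "\<And>\<rho> x. \<rho> \<in> carrier G \<Longrightarrow> x \<in> carrier N \<Longrightarrow> \<pi> (A1.star \<rho> (\<alpha>1 x)) = A2.star \<rho> (\<pi> (\<alpha>1 x))"
    by auto
  define \<nu> where "\<nu> = inv_into (carrier N) \<alpha>2 \<circ> (\<pi> \<circ> \<alpha>1)"
  \<comment> \<open>Elements of \<open>auto N\<close> are extensional, hence the
    restriction.\<close>
  define \<mu> where "\<mu> = restrict \<nu> (carrier N)"
  have iso: "\<nu> \<in> iso N N"
    unfolding \<nu>_def
    by (intro iso_set_trans[OF iso_set_trans[OF A1.\<alpha>_iso \<pi>]] A1.N.iso_set_sym A2.\<alpha>_iso)
  then have auto: "\<mu> \<in> auto N"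
    by (auto simp: iso_def auto_def Bij_def \<mu>_def hom_def)
  have cl: "\<mu> x \<in> carrier N" if "x \<in> carrier N" for x
    using auto that by (auto simp: auto_def hom_def)
  have \<alpha>\<mu>: "\<alpha>2 (\<mu> x) = \<pi> (\<alpha>1 x)" if x: "x \<in> carrier N" for x
  proof -
    have "\<pi> (\<alpha>1 x) \<in> \<alpha>2 ` carrier N" using \<pi> x by (auto simp: iso_def hom_def)
    then show ?thesis using x by (simp add: \<mu>_def \<nu>_def f_inv_into_f)
  qed
  have "A2.twist \<rho> (\<mu> x) = \<mu> (A1.twist \<rho> x)" if r: "\<rho> \<in> carrier G" and x: "x \<in> carrier N" for \<rho> x
  proof (rule inj_onD[OF A2.\<alpha>_inj])
    show "\<alpha>2 (A2.twist \<rho> (\<mu> x)) = \<alpha>2 (\<mu> (A1.twist \<rho> x))"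
      using A2.twist[OF r cl[OF x]] A1.twist[OF r x] eqv[OF r x] \<alpha>\<mu>[OF x] \<alpha>\<mu>[of "A1.twist \<rho> x"] by simp
  qed (use A2.twist[OF r cl[OF x]] cl A1.twist[OF r x] in auto)
  with auto show "\<exists>\<mu>\<in>auto N. \<forall>\<rho>\<in>carrier G. \<forall>x\<in>carrier N. A2.twist \<rho> (\<mu> x) = \<mu> (A1.twist \<rho> x)"
    by blast
next
  assume "\<exists>\<mu>\<in>auto N. \<forall>\<rho>\<in>carrier G. \<forall>x\<in>carrier N. A2.twist \<rho> (\<mu> x) = \<mu> (A1.twist \<rho> x)"
  then obtain \<mu> where \<mu>: "\<mu> \<in> auto N"
    and eqv: "\<And>\<rho> x. \<rho> \<in> carrier G \<Longrightarrow> x \<in> carrier N \<Longrightarrow> A2.twist \<rho> (\<mu> x) = \<mu> (A1.twist \<rho> x)"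
    by auto
  have iso: "\<mu> \<in> iso N N" using \<mu> by (simp add: iso_def auto_def Bij_def)
  then have cl: "\<mu> x \<in> carrier N" if "x \<in> carrier N" for x
    using that by (auto simp: iso_def hom_def)
  define \<pi> where "\<pi> = (\<alpha>2 \<circ> \<mu>) \<circ> inv_into (carrier N) \<alpha>1"
  have \<pi>: "\<pi> \<in> iso A1.M A2.M"
    unfolding \<pi>_def
    by (rule iso_set_trans[OF A1.N.iso_set_sym[OF A1.\<alpha>_iso] iso_set_trans[OF iso A2.\<alpha>_iso]])
  have \<pi>\<alpha>: "\<pi> (\<alpha>1 x) = \<alpha>2 (\<mu> x)" if "x \<in> carrier N" for x
    using that A1.\<alpha>_inj by (simp add: \<pi>_def)
  have "\<pi> (A1.star \<rho> (\<alpha>1 x)) = A2.star \<rho> (\<pi> (\<alpha>1 x))" if r: "\<rho> \<in> carrier G" and x: "x \<in> carrier N" for \<rho> x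
    using A1.twist[OF r x] A2.twist[OF r cl[OF x]] \<pi>\<alpha>[OF x] \<pi>\<alpha>[of "A1.twist \<rho> x"] eqv[OF r x] by simp
  with \<pi> show "\<exists>\<pi>\<in>iso A1.M A2.M. \<forall>\<rho>\<in>carrier G. \<forall>x\<in>carrier A1.M. \<pi> (A1.star \<rho> x) = A2.star \<rho> (\<pi> x)"
    by auto
qed

sublocale D: gal_group_pair E K A1.M A2.M A1.star A2.star ..

theorem hopf_iso_iff_conjugate:
  "hopf_iso (E\<lparr>carrier := K\<rparr>) (fixed_hopf_algebra E K L (\<alpha>1 ` carrier N))
     (fixed_hopf_algebra E K L (\<alpha>2 ` carrier N)) \<noteq> {} \<longleftrightarrow>
   (\<exists>\<mu>\<in>carrier (AutoGroup N). \<forall>g\<in>carrier G. byott_aut E K L N \<alpha>2 g =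
      \<mu> \<otimes>\<^bsub>AutoGroup N\<^esub> byott_aut E K L N \<alpha>1 g \<otimes>\<^bsub>AutoGroup N\<^esub> inv\<^bsub>AutoGroup N\<^esub> \<mu>)"
proof -
  have card: "card (carrier A1.M) = card (carrier A2.M)"
    using card_image[OF A1.\<alpha>_inj] card_image[OF A2.\<alpha>_inj] by simp
  have "hopf_iso (E\<lparr>carrier := K\<rparr>) A1.D.H A2.D.H \<noteq> {} \<longleftrightarrow>
      (\<exists>\<pi>\<in>iso A1.M A2.M. \<forall>\<rho>\<in>carrier G. \<forall>x\<in>carrier A1.M. \<pi> (A1.star \<rho> x) = A2.star \<rho> (\<pi> x))"
    using D.hopf_iso_of_equivariant_iso D.equivariant_iso_of_hopf_iso[OF _ card] by blast
  also have "\<dots> \<longleftrightarrow> (\<exists>\<mu>\<in>auto N. \<forall>\<rho>\<in>carrier G. \<forall>x\<in>carrier N. A2.twist \<rho> (\<mu> x) = \<mu> (A1.twist \<rho> x))"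
    by (rule equivariant_iso_iff)
  also have "\<dots> \<longleftrightarrow> (\<exists>\<mu>\<in>auto N. \<forall>\<rho>\<in>carrier G. A2.twist \<rho> =
      \<mu> \<otimes>\<^bsub>AutoGroup N\<^esub> A1.twist \<rho> \<otimes>\<^bsub>AutoGroup N\<^esub> inv\<^bsub>AutoGroup N\<^esub> \<mu>)"
    by (simp add: twist_conj_iff)
  finally show ?thesis
    unfolding A1.fixed_hopf_algebra_eq A2.fixed_hopf_algebra_eq
    by (simp add: A1.byott_aut_eq A2.byott_aut_eq AutoGroup_def)
qed

end
theorem theorem2p12:
  fixes E :: "('e, 'r) ring_scheme" and K L :: "'e set"
    and N :: "('n, 'm) monoid_scheme"
    and \<alpha>\<^sub>1 \<alpha>\<^sub>2 :: "'n \<Rightarrow> ('e \<Rightarrow> 'e) set \<Rightarrow> ('e \<Rightarrow> 'e) set"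
  assumes "field E" and "subfield K E" and "subfield L E" and "K \<subseteq> L"
    and "ring.finite_dimension E K L" and "separable_extension E K L"
    and "galois_closure E K L"
    and "group N" and "finite (carrier N)"
    and "card (carrier N) = card (coset_space E K L)"
    and "\<alpha>\<^sub>1 \<in> hom N (BijGroup (coset_space E K L))" and "inj_on \<alpha>\<^sub>1 (carrier N)"
    and "regular_subgroup (coset_space E K L) (\<alpha>\<^sub>1 ` carrier N)"
    and "coset_perm E K L ` carrier (gal E K)
           \<subseteq> normalizer (BijGroup (coset_space E K L)) (\<alpha>\<^sub>1 ` carrier N)"
    and "\<alpha>\<^sub>2 \<in> hom N (BijGroup (coset_space E K L))" and "inj_on \<alpha>\<^sub>2 (carrier N)"
    and "regular_subgroup (coset_space E K L) (\<alpha>\<^sub>2 ` carrier N)"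
    and "coset_perm E K L ` carrier (gal E K)
           \<subseteq> normalizer (BijGroup (coset_space E K L)) (\<alpha>\<^sub>2 ` carrier N)"
  shows "hopf_iso (E\<lparr>carrier := K\<rparr>)
           (fixed_hopf_algebra E K L (\<alpha>\<^sub>1 ` carrier N))
           (fixed_hopf_algebra E K L (\<alpha>\<^sub>2 ` carrier N)) \<noteq> {} \<longleftrightarrow>
         (\<exists>\<mu>\<in>carrier (AutoGroup N). \<forall>g\<in>carrier (gal E K).
            byott_aut E K L N \<alpha>\<^sub>2 g =
              \<mu> \<otimes>\<^bsub>AutoGroup N\<^esub> byott_aut E K L N \<alpha>\<^sub>1 g \<otimes>\<^bsub>AutoGroup N\<^esub> inv\<^bsub>AutoGroup N\<^esub> \<mu>)"
proof -
  interpret regular_embedding_pair E K L N \<alpha>\<^sub>1 \<alpha>\<^sub>2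
    using assms subfieldE(3)[OF assms(3)]
    by (intro regular_embedding_pair.intro regular_embedding.intro regular_embedding_axioms.intro
        galois.intro galois_axioms.intro) (auto simp: galois_closure_def)
  show ?thesis by (rule hopf_iso_iff_conjugate)
qed

end
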